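(* Let $\mathbb{F}$ be a field of characteristic not $2$. Every $5$-dimensional nilpotent binary Lie algebra over $\mathbb{F}$ is a Malcev algebra and is isomorphic to one of the following pairwise nonisomorphic algebras with basis $e_1,\dots,e_5$, whose spaces $\mathrm{H}^2_{M}=\mathrm{H}^2_{M}(\mathbf{A},\mathbb{F})$, $\mathrm{H}^2_{BL}=\mathrm{H}^2_{BL}(\mathbf{A},\mathbb{F})$ and annihilators $\mathrm{Ann}$ are as indicated: - $\mathbf{L}_{5,1}$: all products zero. $\mathrm{H}^2_{BL}=\mathrm{H}^2_M=\langle[\Delta_{ij}]:1\le i<j\le 5\rangle$; $\mathrm{Ann}=\mathbf{L}_{5,1}$. - $\mathbf{L}_{5,2}$: $[e_1,e_2]=e_3$. $\mathrm{H}^2_{BL}=\mathrm{H}^2_M=\langle[\Delta_{13}],[\Delta_{14}],[\Delta_{23}],[\Delta_{24}],[\Delta_{34}],[\Delta_{15}],[\Delta_{25}],[\Delta_{35}],[\Delta_{45}]\rangle$; $\mathrm{Ann}=\langle e_3,e_4,e_5\rangle$. - $\mathbf{L}_{5,3}$: $[e_1,e_2]=e_3$, $[e_1,e_3]=e_4$. $\mathrm{H}^2_{BL}=\mathrm{H}^2_M=\langle[\Delta_{14}],[\Delta_{23}],[\Delta_{15}],[\Delta_{25}],[\Delta_{35}]\rangle$; $\mathrm{Ann}=\langle e_4,e_5\rangle$. - $\mathbf{L}_{5,4}$: $[e_1,e_2]=e_5$, $[e_3,e_4]=e_5$. $\mathrm{H}^2_{BL}=\mathrm{H}^2_M=\langle[\Delta_{13}],[\Delta_{14}],[\Delta_{23}],[\Delta_{24}],[\Delta_{34}],[\Delta_{15}],[\Delta_{25}],[\Delta_{35}],[\Delta_{45}]\rangle$;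 $\mathrm{Ann}=\langle e_5\rangle$. - $\mathbf{L}_{5,5}$: $[e_1,e_2]=e_3$, $[e_1,e_3]=e_5$, $[e_2,e_4]=e_5$. $\mathrm{H}^2_{BL}=\mathrm{H}^2_M=\langle[\Delta_{13}],[\Delta_{14}],[\Delta_{23}],[\Delta_{34}],[\Delta_{15}]\rangle$; $\mathrm{Ann}=\langle e_5\rangle$. - $\mathbf{L}_{5,6}$: $[e_1,e_2]=e_3$, $[e_1,e_3]=e_4$, $[e_1,e_4]=e_5$, $[e_2,e_3]=e_5$. $\mathrm{H}^2_{BL}=\mathrm{H}^2_M=\langle[\Delta_{14}],[\Delta_{15}]+[\Delta_{24}],[\Delta_{25}]-[\Delta_{34}]\rangle$; $\mathrm{Ann}=\langle e_5\rangle$. - $\mathbf{L}_{5,7}$: $[e_1,e_2]=e_3$, $[e_1,e_3]=e_4$, $[e_1,e_4]=e_5$. $\mathrm{H}^2_{BL}=\mathrm{H}^2_M=\langle[\Delta_{15}],[\Delta_{23}],[\Delta_{25}]-[\Delta_{34}]\rangle$; $\mathrm{Ann}=\langle e_5\rangle$. - $\mathbf{L}_{5,8}$: $[e_1,e_2]=e_4$, $[e_1,e_3]=e_5$. $\mathrm{H}^2_M=\langle[\Delta_{14}],[\Delta_{15}],[\Delta_{23}],[\Delta_{24}],[\Delta_{34}],[\Delta_{25}],[\Delta_{35}]\rangle$, $\mathrm{H}^2_{BL}=\mathrm{H}^2_M\oplus\langle[\Delta_{45}]\rangle$; $\mathrm{Ann}=\langle e_4,e_5\rangle$. - $\mathbf{L}_{5,9}$: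 $[e_1,e_2]=e_3$, $[e_1,e_3]=e_4$, $[e_2,e_3]=e_5$. $\mathrm{H}^2_{BL}=\mathrm{H}^2_M=\langle[\Delta_{14}],[\Delta_{15}]+[\Delta_{24}],[\Delta_{25}]\rangle$; $\mathrm{Ann}=\langle e_4,e_5\rangle$. - $\mathbf{M}_{5,1}$: $[e_1,e_2]=e_3$, $[e_3,e_4]=e_5$. $\mathrm{H}^2_M=\langle[\Delta_{13}],[\Delta_{14}],[\Delta_{23}],[\Delta_{24}]\rangle$, $\mathrm{H}^2_{BL}=\mathrm{H}^2_M\oplus\langle[\Delta_{45}]\rangle$; $\mathrm{Ann}=\langle e_5\rangle$. Moreover $\mathbf{U}_1(\mathbf{L}_{5,8})\neq\emptyset$, $\mathbf{U}_1(\mathbf{M}_{5,1})\neq\emptyset$, and $\mathbf{U}_1(\mathbf{L}_{5,i})=\emptyset$ for $i\in\{1,2,3,4,5,6,7,9\}$.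
   Context: An algebra is a vector space with a bilinear product $[-,-]$, not assumed associative; it is anticommutative if $[x,x]=0$ for all $x$. The multiplication of an anticommutative algebra is specified by giving only the nonzero products among basis elements (with $[e_j,e_i]=-[e_i,e_j]$ understood). The Jacobian is $\mathcal{J}(x,y,z):=[[x,y],z]+[[y,z],x]+[[z,x],y]$. An anticommutative algebra $A$ is Malcev if $\mathcal{J}(x,y,[x,z])=[\mathcal{J}(x,y,z),x]$ for all $x,y,z\in A$, and binary Lie if $\mathcal{J}([x,y],x,y)=0$ for all $x,y\in A$. Set $A^{1}=A$, $A^{n+1}=[A^{n},A^{1}]+[A^{n-1},A^{2}]+\cdots+[A^{1},A^{n}]$; $A$ is nilpotent if $A^{n}=0$ for some $n$. $\mathrm{Ann}(A)=\{x\in A:[x,A]=0\}$. For a binary Lie algebra $A$ over $\mathbb{F}$, $\mathrm{Z}^2_{BL}(A,\mathbb{F})$ is the space of skew-symmetric bilinear forms $\theta:A\times A\to\mathbb{F}$ with $\theta([[x,y],x],y)=\theta([[x,y],y],x)$ for all $x,y\in A$; $\mathrm{B}^2(A,\mathbb{F})$ is the subspace of forms $\delta f(x,y)=f([x,y])$ with $f:A\to\mathbb{F}$ linear; $\mathrm{H}^2_{BL}(A,\mathbb{F})=\mathrm{Z}^2_{BL}(A,\mathbb{F})/\mathrm{B}^2(A,\mathbb{F})$, and $[\theta]$ denotes the class of $\theta$. For a Malcev algebra $A$, $\mathrm{Z}^2_M(A,\mathbb{F})$ is the subspace of those $\theta\in\mathrm{Z}^2_{BL}(A,\mathbb{F})$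 with $\theta([w,y],[x,z])=\theta([[w,x],y],z)+\theta([[x,y],z],w)+\theta([[y,z],w],x)+\theta([[z,w],x],y)$ for all $x,y,z,w\in A$, and $\mathrm{H}^2_M(A,\mathbb{F})=\mathrm{Z}^2_M(A,\mathbb{F})/\mathrm{B}^2(A,\mathbb{F})\subseteq\mathrm{H}^2_{BL}(A,\mathbb{F})$. Given a basis $e_1,\dots,e_n$ of $A$, $\Delta_{ij}$ (for $i<j$) is the skew-symmetric bilinear form with $\Delta_{ij}(e_i,e_j)=-\Delta_{ij}(e_j,e_i)=1$ and $\Delta_{ij}(e_l,e_m)=0$ if $\{i,j\}\neq\{l,m\}$. The listed generating classes are linearly independent, i.e. form bases of the respective spaces. For $\theta\in\mathrm{Z}^2_{BL}(A,\mathbb{F})$ put $\theta^{\bot}=\{x\in A:\theta(x,A)=0\}$. Let $G_s(V)$ be the set of $s$-dimensional subspaces of $V$. Put $\mathbf{T}_s(A)=\{\langle[\theta_1],\dots,[\theta_s]\rangle\in G_s(\mathrm{H}^2_{BL}(A,\mathbb{F})):\bigcap_{i=1}^s\theta_i^{\bot}\cap\mathrm{Ann}(A)=0\}$ (this is independent of the chosen representatives), and for $A$ Malcev, $\mathbf{U}_s(A)=\{\mathbf{W}\in\mathbf{T}_s(A):\mathbf{W}\notin G_s(\mathrm{H}^2_M(A,\mathbb{F}))\}$. *)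

theory Defs
  imports "HOL-Analysis.Analysis" "HOL-Library.Set_Algebras" "HOL-Library.Function_Algebras"
begin

section \<open>Nonassociative algebras\<close>

text \<open>
  An algebra is given by a scalar multiplication \<open>s\<close> on a type of vectors together with
  a product \<open>br\<close>.
\<close>

definition bilinear_map ::
    "('f::field \<Rightarrow> 'v::ab_group_add \<Rightarrow> 'v) \<Rightarrow> ('f \<Rightarrow> 'w::ab_group_add \<Rightarrow> 'w) \<Rightarrow> ('v \<Rightarrow> 'v \<Rightarrow> 'w) \<Rightarrow> bool"
  where "bilinear_map s t b \<longleftrightarrow>
    (\<forall>x. Vector_Spaces.linear s t (\<lambda>y. b x y)) \<and> (\<forall>y. Vector_Spaces.linear s t (\<lambda>x. b x y))"

definition anticommutative_algebra ::
    "('f::field \<Rightarrow> 'v::ab_group_add \<Rightarrow> 'v) \<Rightarrow> ('v \<Rightarrow> 'v \<Rightarrow> 'v) \<Rightarrow> bool"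
  where "anticommutative_algebra s br \<longleftrightarrow>
    vector_space s \<and> bilinear_map s s br \<and> (\<forall>x. br x x = 0)"

definition jacobian :: "('v::ab_group_add \<Rightarrow> 'v \<Rightarrow> 'v) \<Rightarrow> 'v \<Rightarrow> 'v \<Rightarrow> 'v \<Rightarrow> 'v"
  where "jacobian br x y z = br (br x y) z + br (br y z) x + br (br z x) y"

definition malcev_algebra ::
    "('f::field \<Rightarrow> 'v::ab_group_add \<Rightarrow> 'v) \<Rightarrow> ('v \<Rightarrow> 'v \<Rightarrow> 'v) \<Rightarrow> bool"
  where "malcev_algebra s br \<longleftrightarrow> anticommutative_algebra s br \<and>
    (\<forall>x y z. jacobian br x y (br x z) = br (jacobian br x y z) x)"

definition binary_lie_algebra ::
    "('f::field \<Rightarrow> 'v::ab_group_add \<Rightarrow> 'v) \<Rightarrow> ('v \<Rightarrow> 'v \<Rightarrow> 'v) \<Rightarrow> bool"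
  where "binary_lie_algebra s br \<longleftrightarrow> anticommutative_algebra s br \<and>
    (\<forall>x y. jacobian br (br x y) x y = 0)"

text \<open>
  The powers \<open>A\<^sup>1 = A\<close>, \<open>A\<^sup>n\<^sup>+\<^sup>1 = [A\<^sup>n, A\<^sup>1] + \<dots> + [A\<^sup>1, A\<^sup>n]\<close>. Here \<open>[U, V]\<close> is the linear span
  of the products of elements of \<open>U\<close> and \<open>V\<close>, so the sum is the span of all these products.
  The value at exponent 0 is a dummy.
\<close>

fun alg_power ::
    "('f::field \<Rightarrow> 'v::ab_group_add \<Rightarrow> 'v) \<Rightarrow> ('v \<Rightarrow> 'v \<Rightarrow> 'v) \<Rightarrow> nat \<Rightarrow> 'v set"
  where
    "alg_power s br 0 = UNIV"
  | "alg_power s br (Suc 0) = UNIV"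
  | "alg_power s br (Suc (Suc n)) = module.span s
       (\<Union>i\<in>{1..Suc n}. {br x y | x y.
          x \<in> alg_power s br i \<and> y \<in> alg_power s br (Suc (Suc n) - i)})"

definition nilpotent_algebra ::
    "('f::field \<Rightarrow> 'v::ab_group_add \<Rightarrow> 'v) \<Rightarrow> ('v \<Rightarrow> 'v \<Rightarrow> 'v) \<Rightarrow> bool"
  where "nilpotent_algebra s br \<longleftrightarrow> (\<exists>n\<ge>1. alg_power s br n = {0})"

definition Ann :: "('v::ab_group_add \<Rightarrow> 'v \<Rightarrow> 'v) \<Rightarrow> 'v set"
  where "Ann br = {x. \<forall>y. br x y = 0}"

definition algebra_isomorphic ::
    "('f::field \<Rightarrow> 'v::ab_group_add \<Rightarrow> 'v) \<Rightarrow> ('v \<Rightarrow> 'v \<Rightarrow> 'v) \<Rightarrow>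
     ('f \<Rightarrow> 'w::ab_group_add \<Rightarrow> 'w) \<Rightarrow> ('w \<Rightarrow> 'w \<Rightarrow> 'w) \<Rightarrow> bool"
  where "algebra_isomorphic s br t br' \<longleftrightarrow>
    (\<exists>\<phi>. Vector_Spaces.linear s t \<phi> \<and> bij \<phi> \<and> (\<forall>x y. \<phi> (br x y) = br' (\<phi> x) (\<phi> y)))"


section \<open>Cocycles, coboundaries and cohomology\<close>

definition Z2_BL ::
    "('f::field \<Rightarrow> 'v::ab_group_add \<Rightarrow> 'v) \<Rightarrow> ('v \<Rightarrow> 'v \<Rightarrow> 'v) \<Rightarrow> ('v \<Rightarrow> 'v \<Rightarrow> 'f) set"
  where "Z2_BL s br = {\<theta>. bilinear_map s (*) \<theta> \<and> (\<forall>x y. \<theta> x y = - \<theta> y x) \<and>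
    (\<forall>x y. \<theta> (br (br x y) x) y = \<theta> (br (br x y) y) x)}"

definition Z2_M ::
    "('f::field \<Rightarrow> 'v::ab_group_add \<Rightarrow> 'v) \<Rightarrow> ('v \<Rightarrow> 'v \<Rightarrow> 'v) \<Rightarrow> ('v \<Rightarrow> 'v \<Rightarrow> 'f) set"
  where "Z2_M s br = {\<theta> \<in> Z2_BL s br. \<forall>x y z w.
    \<theta> (br w y) (br x z) =
      \<theta> (br (br w x) y) z + \<theta> (br (br x y) z) w + \<theta> (br (br y z) w) x + \<theta> (br (br z w) x) y}"

definition B2 ::
    "('f::field \<Rightarrow> 'v::ab_group_add \<Rightarrow> 'v) \<Rightarrow> ('v \<Rightarrow> 'v \<Rightarrow> 'v) \<Rightarrow> ('v \<Rightarrow> 'v \<Rightarrow> 'f) set"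
  where "B2 s br = {\<lambda>x y. f (br x y) | f. Vector_Spaces.linear s (*) f}"

text \<open>
  Elements of a quotient by a space \<open>B\<close> of forms are the cosets \<open>\<theta> +o B\<close>; forms are added
  pointwise and cosets are added elementwise. \<open>B\<close> itself is the zero of the quotient.
\<close>

definition H2_BL ::
    "('f::field \<Rightarrow> 'v::ab_group_add \<Rightarrow> 'v) \<Rightarrow> ('v \<Rightarrow> 'v \<Rightarrow> 'v) \<Rightarrow> ('v \<Rightarrow> 'v \<Rightarrow> 'f) set set"
  where "H2_BL s br = (\<lambda>\<theta>. \<theta> +o B2 s br) ` Z2_BL s br"

definition H2_M ::
    "('f::field \<Rightarrow> 'v::ab_group_add \<Rightarrow> 'v) \<Rightarrow> ('v \<Rightarrow> 'v \<Rightarrow> 'v) \<Rightarrow> ('v \<Rightarrow> 'v \<Rightarrow> 'f) set set"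
  where "H2_M s br = (\<lambda>\<theta>. \<theta> +o B2 s br) ` Z2_M s br"

text \<open>\<open>B\<close> is added so that scaling by 0 yields the zero coset \<open>B\<close> rather than \<open>{0}\<close>.\<close>

definition qscale ::
    "('v \<Rightarrow> 'v \<Rightarrow> 'f::field) set \<Rightarrow> 'f \<Rightarrow> ('v \<Rightarrow> 'v \<Rightarrow> 'f) set \<Rightarrow> ('v \<Rightarrow> 'v \<Rightarrow> 'f) set"
  where "qscale B c X = (\<lambda>\<theta> x y. c * \<theta> x y) ` X + B"

text \<open>Again, adding \<open>B\<close> makes the empty linear combination equal to the zero coset.\<close>

definition qlincomb ::
    "('v \<Rightarrow> 'v \<Rightarrow> 'f::field) set \<Rightarrow> 'f list \<Rightarrow> ('v \<Rightarrow> 'v \<Rightarrow> 'f) set list \<Rightarrow> ('v \<Rightarrow> 'v \<Rightarrow> 'f) set"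
  where "qlincomb B cs Xs = sum_list (map2 (qscale B) cs Xs) + B"

definition qspan ::
    "('v \<Rightarrow> 'v \<Rightarrow> 'f::field) set \<Rightarrow> ('v \<Rightarrow> 'v \<Rightarrow> 'f) set list \<Rightarrow> ('v \<Rightarrow> 'v \<Rightarrow> 'f) set set"
  where "qspan B Xs = {qlincomb B cs Xs | cs. length cs = length Xs}"

definition qindependent ::
    "('v \<Rightarrow> 'v \<Rightarrow> 'f::field) set \<Rightarrow> ('v \<Rightarrow> 'v \<Rightarrow> 'f) set list \<Rightarrow> bool"
  where "qindependent B Xs \<longleftrightarrow>
    (\<forall>cs. length cs = length Xs \<longrightarrow> qlincomb B cs Xs = B \<longrightarrow> (\<forall>c\<in>set cs. c = 0))"

definition qbasis ::
    "('v \<Rightarrow> 'v \<Rightarrow> 'f::field) set \<Rightarrow> ('v \<Rightarrow> 'v \<Rightarrow> 'f) set set \<Rightarrow> ('v \<Rightarrow> 'v \<Rightarrow> 'f) set list \<Rightarrow> bool"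
  where "qbasis B V Xs \<longleftrightarrow> set Xs \<subseteq> V \<and> qindependent B Xs \<and> V = qspan B Xs"

definition qdirect_sum ::
    "('v \<Rightarrow> 'v \<Rightarrow> 'f::field) set \<Rightarrow> ('v \<Rightarrow> 'v \<Rightarrow> 'f) set set \<Rightarrow> ('v \<Rightarrow> 'v \<Rightarrow> 'f) set set \<Rightarrow>
     ('v \<Rightarrow> 'v \<Rightarrow> 'f) set set \<Rightarrow> bool"
  where "qdirect_sum B V W1 W2 \<longleftrightarrow> V = {X + Y | X Y. X \<in> W1 \<and> Y \<in> W2} \<and> W1 \<inter> W2 = {B}"

text \<open>The set \<open>G\<^sub>r(V)\<close> of \<open>r\<close>-dimensional subspaces of a subspace \<open>V\<close> of the quotient by \<open>B\<close>.\<close>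

definition grassmannian ::
    "('v \<Rightarrow> 'v \<Rightarrow> 'f::field) set \<Rightarrow> nat \<Rightarrow> ('v \<Rightarrow> 'v \<Rightarrow> 'f) set set \<Rightarrow> ('v \<Rightarrow> 'v \<Rightarrow> 'f) set set set"
  where "grassmannian B r V = {W. W \<subseteq> V \<and> (\<exists>Xs. length Xs = r \<and> qbasis B W Xs)}"

definition form_perp :: "('v \<Rightarrow> 'v \<Rightarrow> 'f::field) \<Rightarrow> 'v set"
  where "form_perp \<theta> = {x. \<forall>y. \<theta> x y = 0}"

definition T_set ::
    "nat \<Rightarrow> ('f::field \<Rightarrow> 'v::ab_group_add \<Rightarrow> 'v) \<Rightarrow> ('v \<Rightarrow> 'v \<Rightarrow> 'v) \<Rightarrow> ('v \<Rightarrow> 'v \<Rightarrow> 'f) set set set"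
  where "T_set r s br = {W \<in> grassmannian (B2 s br) r (H2_BL s br).
    \<exists>\<theta>s. length \<theta>s = r \<and> set \<theta>s \<subseteq> Z2_BL s br \<and>
      W = qspan (B2 s br) (map (\<lambda>\<theta>. \<theta> +o B2 s br) \<theta>s) \<and>
      (\<Inter>\<theta>\<in>set \<theta>s. form_perp \<theta>) \<inter> Ann br = {0}}"

definition U_set ::
    "nat \<Rightarrow> ('f::field \<Rightarrow> 'v::ab_group_add \<Rightarrow> 'v) \<Rightarrow> ('v \<Rightarrow> 'v \<Rightarrow> 'v) \<Rightarrow> ('v \<Rightarrow> 'v \<Rightarrow> 'f) set set set"
  where "U_set r s br = {W \<in> T_set r s br. W \<notin> grassmannian (B2 s br) r (H2_M s br)}"


section \<open>The algebras on \<open>F\<^sup>5\<close>\<close>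

text \<open>
  Vectors are indexed by the five-element numeral type; its elements are 1, 2, 3, 4, 5, where
  the numeral 5 denotes the same element as 0.
\<close>

definition e :: "5 \<Rightarrow> 'f::field ^ 5"
  where "e i = axis i 1"

definition \<Delta> :: "5 \<Rightarrow> 5 \<Rightarrow> 'f::field ^ 5 \<Rightarrow> 'f ^ 5 \<Rightarrow> 'f"
  where "\<Delta> i j x y = x $ i * y $ j - x $ j * y $ i"

text \<open>
  The anticommutative bilinear product whose nonzero products of basis elements are given by
  a list of triples \<open>(i, j, k)\<close>, each standing for \<open>[e\<^sub>i, e\<^sub>j] = e\<^sub>k\<close> (and \<open>[e\<^sub>j, e\<^sub>i] = - e\<^sub>k\<close>).
\<close>

definition table_product :: "(5 \<times> 5 \<times> 5) list \<Rightarrow> 'f::field ^ 5 \<Rightarrow> 'f ^ 5 \<Rightarrow> 'f ^ 5"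
  where "table_product T x y = (\<Sum>(i, j, k)\<leftarrow>T. (x $ i * y $ j - x $ j * y $ i) *s e k)"

definition L5_1 :: "'f::field ^ 5 \<Rightarrow> 'f ^ 5 \<Rightarrow> 'f ^ 5"
  where "L5_1 = table_product []"

definition L5_2 :: "'f::field ^ 5 \<Rightarrow> 'f ^ 5 \<Rightarrow> 'f ^ 5"
  where "L5_2 = table_product [(1,2,3)]"

definition L5_3 :: "'f::field ^ 5 \<Rightarrow> 'f ^ 5 \<Rightarrow> 'f ^ 5"
  where "L5_3 = table_product [(1,2,3), (1,3,4)]"

definition L5_4 :: "'f::field ^ 5 \<Rightarrow> 'f ^ 5 \<Rightarrow> 'f ^ 5"
  where "L5_4 = table_product [(1,2,5), (3,4,5)]"

definition L5_5 :: "'f::field ^ 5 \<Rightarrow> 'f ^ 5 \<Rightarrow> 'f ^ 5"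
  where "L5_5 = table_product [(1,2,3), (1,3,5), (2,4,5)]"

definition L5_6 :: "'f::field ^ 5 \<Rightarrow> 'f ^ 5 \<Rightarrow> 'f ^ 5"
  where "L5_6 = table_product [(1,2,3), (1,3,4), (1,4,5), (2,3,5)]"

definition L5_7 :: "'f::field ^ 5 \<Rightarrow> 'f ^ 5 \<Rightarrow> 'f ^ 5"
  where "L5_7 = table_product [(1,2,3), (1,3,4), (1,4,5)]"

definition L5_8 :: "'f::field ^ 5 \<Rightarrow> 'f ^ 5 \<Rightarrow> 'f ^ 5"
  where "L5_8 = table_product [(1,2,4), (1,3,5)]"

definition L5_9 :: "'f::field ^ 5 \<Rightarrow> 'f ^ 5 \<Rightarrow> 'f ^ 5"
  where "L5_9 = table_product [(1,2,3), (1,3,4), (2,3,5)]"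

definition M5_1 :: "'f::field ^ 5 \<Rightarrow> 'f ^ 5 \<Rightarrow> 'f ^ 5"
  where "M5_1 = table_product [(1,2,3), (3,4,5)]"

definition algebras5 :: "('f::field ^ 5 \<Rightarrow> 'f ^ 5 \<Rightarrow> 'f ^ 5) list"
  where "algebras5 = [L5_1, L5_2, L5_3, L5_4, L5_5, L5_6, L5_7, L5_8, L5_9, M5_1]"

text \<open>The cohomology class of \<open>\<Delta> i j\<close> for the algebra with product \<open>br\<close>.\<close>

definition Dcl ::
    "('f::field ^ 5 \<Rightarrow> 'f ^ 5 \<Rightarrow> 'f ^ 5) \<Rightarrow> 5 \<Rightarrow> 5 \<Rightarrow> ('f ^ 5 \<Rightarrow> 'f ^ 5 \<Rightarrow> 'f) set"
  where "Dcl br i j = \<Delta> i j +o B2 (*s) br"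

definition H2_M_has_basis ::
    "('f::field ^ 5 \<Rightarrow> 'f ^ 5 \<Rightarrow> 'f ^ 5) \<Rightarrow> ('f ^ 5 \<Rightarrow> 'f ^ 5 \<Rightarrow> 'f) set list \<Rightarrow> bool"
  where "H2_M_has_basis br Xs \<longleftrightarrow> qbasis (B2 (*s) br) (H2_M (*s) br) Xs"

text \<open>\<open>H\<^sup>2\<^sub>B\<^sub>L = H\<^sup>2\<^sub>M \<oplus> \<langle>X\<rangle>\<close> with \<open>X\<close> nonzero.\<close>

definition H2_BL_is_H2_M_plus ::
    "('f::field ^ 5 \<Rightarrow> 'f ^ 5 \<Rightarrow> 'f ^ 5) \<Rightarrow> ('f ^ 5 \<Rightarrow> 'f ^ 5 \<Rightarrow> 'f) set \<Rightarrow> bool"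
  where "H2_BL_is_H2_M_plus br X \<longleftrightarrow> qindependent (B2 (*s) br) [X] \<and>
    qdirect_sum (B2 (*s) br) (H2_BL (*s) br) (H2_M (*s) br) (qspan (B2 (*s) br) [X])"

end

theory Submission
  imports Defs
begin

text \<open>
  A nilpotent algebra has a basis \<open>b\<^sub>1, \<dots>, b\<^sub>5\<close> with \<open>[b\<^sub>i, A]\<close> contained in the span of
  \<open>b\<^sub>i\<^sub>+\<^sub>1, \<dots>, b\<^sub>5\<close>, so its product is determined by ten structure constants. The Jacobian of such
  a product has only the components \<open>J(b\<^sub>1, b\<^sub>2, b\<^sub>3)\<close> and \<open>J(b\<^sub>1, b\<^sub>2, b\<^sub>4)\<close>, both multiples of
  \<open>b\<^sub>5\<close>, and the binary Lie identity becomes three polynomial equations that also imply the Malcev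
  identity. Explicit changes of basis then bring every solution to one of the ten tables. The tables
  are told apart by the dimensions of \<open>{x. [x, A] = 0}\<close>, \<open>{x. [x, [A, A]] = 0}\<close>,
  \<open>{x. [x, [A, [A, A]]] = 0}\<close> and by the Jacobi identity. In characteristic other than 2 a
  skew-symmetric form is a combination of the ten \<open>\<Delta>\<^sub>i\<^sub>j\<close>, so the spaces of cocycles and
  coboundaries are cut out by linear equations in ten coefficients.
\<close>

section \<open>Products adapted to a flag of ideals\<close>

text \<open>A full flag, unlike the lower central series with its varying dimensions, puts all
  candidates into one ten-parameter family, so the identities are examined only once, symbolically.
  The classification branches on the coefficient a3 of e3 in [e1, e2]. If it is nonzero, [e1, e2]
  itself can serve as e3; if it is zero, all products lie in the span of e4 and e5 and the question
  becomes one about alternating forms. The non-Lie algebra M5_1 appears in both branches: if a3 and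
  r are nonzero, the binary Lie equations force b4 = c4 = 0, so every product except [e1, e2] falls
  into the line of e5; if a3 = 0, a nonzero J(e1, e2, e3) becomes, up to sign, the coefficient r of
  a new table with [e1, e2] = e3. All normalisations divide by nonzero constants and none extracts a
  root, which is why a single list serves every field. On the cohomological side the class of
  \<open>\<Delta> 4 5\<close> is the only one that the Malcev cocycle identity excludes, and it does
  so for two algebras only.\<close>

lemma exhaust_5: fixes x :: 5 shows "x = 1 \<or> x = 2 \<or> x = 3 \<or> x = 4 \<or> x = 5"
proof (induct x)
  case (of_int z)
  then have "0 \<le> z" and "z < 5" by simp_all
  then have "z = 0 \<or> z = 1 \<or> z = 2 \<or> z = 3 \<or> z = 4" by arith
  then show ?case by auto
qed
lemma forall_5: "(\<forall>i::5. P i) \<longleftrightarrow> P 1 \<and> P 2 \<and> P 3 \<and> P 4 \<and> P 5"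
  by (metis exhaust_5)
definition vec5 :: "'a \<Rightarrow> 'a \<Rightarrow> 'a \<Rightarrow> 'a \<Rightarrow> 'a \<Rightarrow> 'a ^ 5"
  where "vec5 a b c d k = (\<chi> i. if i = 1 then a else if i = 2 then b else if i = 3 then c else
      if i = 4 then d else k)"

lemma vec5_nth [simp]:
  "vec5 a b c d k $ 1 = a" "vec5 a b c d k $ 2 = b" "vec5 a b c d k $ 3 = c" "vec5 a b c d k $ 4
      = d"
  "vec5 a b c d k $ 5 = k"
  by (simp_all add: vec5_def)
lemma vec_eq_5: "x = y \<longleftrightarrow> x $ 1 = y $ 1 \<and> x $ 2 = y $ 2 \<and> x $ 3 = y $ 3 \<and> x $ 4 = y $ 4 \<and> x $
    (5::5) = y $ 5"
  by (simp add: vec_eq_iff forall_5)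

text \<open>
  The general product adapted to a flag of ideals: \<open>a\<close>, \<open>b\<close>, \<open>c\<close> are the coefficients of
  \<open>[e\<^sub>1, e\<^sub>2]\<close>, \<open>[e\<^sub>1, e\<^sub>3]\<close>, \<open>[e\<^sub>2, e\<^sub>3]\<close>, indexed by the basis vector they belong to, and
  \<open>[e\<^sub>1, e\<^sub>4] = p e\<^sub>5\<close>, \<open>[e\<^sub>2, e\<^sub>4] = q e\<^sub>5\<close>, \<open>[e\<^sub>3, e\<^sub>4] = r e\<^sub>5\<close>.
\<close>

definition graded_product ::
    "'f::field \<Rightarrow> 'f \<Rightarrow> 'f \<Rightarrow> 'f \<Rightarrow> 'f \<Rightarrow> 'f \<Rightarrow> 'f \<Rightarrow> 'f \<Rightarrow> 'f \<Rightarrow> 'f \<Rightarrow> 'f ^ 5 \<Rightarrow> 'f ^ 5 \<Rightarrow> 'f ^ 5"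
  where "graded_product a3 a4 a5 b4 b5 c4 c5 p q r x y = vec5 0 0
    (a3 * \<Delta> 1 2 x y)
    (a4 * \<Delta> 1 2 x y + b4 * \<Delta> 1 3 x y + c4 * \<Delta> 2 3 x y)
    (a5 * \<Delta> 1 2 x y + b5 * \<Delta> 1 3 x y + c5 * \<Delta> 2 3 x y
      + p * \<Delta> 1 4 x y + q * \<Delta> 2 4 x y + r * \<Delta> 3 4 x y)"

lemmas graded_product_simps = graded_product_def \<Delta>_def vec5_nth vector_add_component
    vector_smult_component
  vector_minus_component vector_uminus_component zero_index

lemma table_product_component:
  "table_product T x y $ m = (\<Sum>(i, j, k)\<leftarrow>T. if k = m then \<Delta> i j x y else 0)"
  by (induction T) (auto simp: table_product_def \<Delta>_def e_def axis_def)

text \<open>The bases of the ten tables are already adapted to a flag, so anything computed for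
  general structure constants specialises to each of them.\<close>

lemma algebras5_graded:
  "L5_1 = graded_product 0 0 0 0 0 0 0 0 0 0"
  "L5_2 = graded_product 1 0 0 0 0 0 0 0 0 0"
  "L5_3 = graded_product 1 0 0 1 0 0 0 0 0 0"
  "L5_4 = graded_product 0 0 1 0 0 0 0 0 0 1"
  "L5_5 = graded_product 1 0 0 0 1 0 0 0 1 0"
  "L5_6 = graded_product 1 0 0 1 0 0 1 1 0 0"
  "L5_7 = graded_product 1 0 0 1 0 0 0 1 0 0"
  "L5_8 = graded_product 0 1 0 0 1 0 0 0 0 0"
  "L5_9 = graded_product 1 0 0 1 0 0 1 0 0 0"
  "M5_1 = graded_product 1 0 0 0 0 0 0 0 0 1"
  by (simp_all add: fun_eq_iff vec_eq_5 L5_1_def L5_2_def L5_3_def L5_4_def L5_5_def L5_6_def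
      L5_7_def
      L5_8_def L5_9_def M5_1_def table_product_component graded_product_def)

lemma bilinear_graded_product: "bilinear_map (*s) (*s) (graded_product a3 a4 a5 b4 b5 c4 c5 p q r)"
  by (auto simp: bilinear_map_def vec_eq_5 graded_product_simps algebra_simps
      intro!: Vector_Spaces.linear.intro vec.vector_space_axioms module_hom_axioms.intro
      module_hom.intro vec.module_axioms)

lemma anticommutative_graded_product:
  "anticommutative_algebra (*s) (graded_product a3 a4 a5 b4 b5 c4 c5 p q r)"
  using bilinear_graded_product vec.vector_space_axioms
  by (auto simp: anticommutative_algebra_def vec_eq_5 graded_product_simps)

text \<open>The two brackets are the 3 by 3 determinants in the coordinates 1, 2, 3 and 1, 2, 4.
  Triples that contain both e3 and e4 contribute nothing, since [e3, e4] and all [e_i, e4] are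
  multiples of the central e5 and [e_i, e3] lies in the span of e4 and e5.\<close>

lemma jacobian_graded_product:
  "jacobian (graded_product a3 a4 a5 b4 b5 c4 c5 p q r) x y z = vec5 0 0 0 0
    ((b4 * q - c4 * p - a4 * r) * (x $ 1 * \<Delta> 2 3 y z - x $ 2 * \<Delta> 1 3 y z + x $ 3 * \<Delta> 1 2 y z)
     + a3 * r * (x $ 1 * \<Delta> 2 4 y z - x $ 2 * \<Delta> 1 4 y z + x $ 4 * \<Delta> 1 2 y z))"
  unfolding vec_eq_5 jacobian_def graded_product_simps
  by (simp add: algebra_simps)

text \<open>Since [x, y] has no first or second coordinate, J([x, y], x, y) is
  \<open>\<Delta> 1 2 x y\<close> times a linear form in its third and fourth coordinates. Three
  pairs of test vectors separate the three equations.\<close>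

lemma binary_lie_graded_productD:
  assumes "binary_lie_algebra (*s) (graded_product a3 a4 a5 b4 b5 c4 c5 p q r)"
  shows "a3 * (b4 * q - c4 * p) = 0" "a3 * b4 * r = 0" "a3 * c4 * r = 0"
proof -
  let ?J = "jacobian (graded_product a3 a4 a5 b4 b5 c4 c5 p q r)"
  let ?br = "graded_product a3 a4 a5 b4 b5 c4 c5 p q r"
  have J: "?J (?br x y) x y $ 5 = 0" for x y
    using assms by (simp add: binary_lie_algebra_def)
  note J = J[unfolded jacobian_graded_product graded_product_simps]
  \<comment> \<open>At (e1, e2) the term with a4 * r occurs once from each component of the
    Jacobian, with opposite signs, and cancels.\<close>
  have 1: "a3 * (b4 * q) = a3 * (c4 * p)"
    using J[of "vec5 1 0 0 0 0" "vec5 0 1 0 0 0"] by (simp add: algebra_simps)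
  then show "a3 * (b4 * q - c4 * p) = 0" by (simp add: algebra_simps)
  \<comment> \<open>Adding e3 to the second argument changes only the fourth coordinate of [x, y]
    that matters here, by b4; exchanging the roles of e1 and e2 gives c4 in the same way.\<close>
  have "a3 * (b4 * q) + a3 * (b4 * r) = a3 * (c4 * p)"
    using J[of "vec5 1 0 0 0 0" "vec5 0 1 1 0 0"] by (simp add: algebra_simps)
  with 1 show "a3 * b4 * r = 0" by algebra
  have "a3 * (b4 * q) = a3 * (c4 * p) + a3 * (c4 * r)"
    using J[of "vec5 0 1 0 0 0" "vec5 1 0 1 0 0"] by (simp add: algebra_simps)
  with 1 show "a3 * c4 * r = 0" by algebra
qed

text \<open>On arguments without first and second coordinates the Jacobian reduces to one linear
  form in the coordinates 3 and 4. Evaluated at a product, this form is a combination of exactly the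
  three expressions assumed to vanish.\<close>

lemma jacobian_graded_product_derived:
  assumes "a3 * (b4 * q - c4 * p) = 0" "a3 * b4 * r = 0" "a3 * c4 * r = 0"
  shows "jacobian (graded_product a3 a4 a5 b4 b5 c4 c5 p q r) x y
    (graded_product a3 a4 a5 b4 b5 c4 c5 p q r z w) = 0"
proof -
  let ?u = "graded_product a3 a4 a5 b4 b5 c4 c5 p q r z w"
  have "(b4 * q - c4 * p - a4 * r) * ?u $ 3 + a3 * r * ?u $ 4
      = (a3 * (b4 * q - c4 * p)) * \<Delta> 1 2 z w + (a3 * b4 * r) * \<Delta> 1 3 z w + (a3 * c4 * r) * \<Delta> 2 3
          z w"
    by (simp add: graded_product_def algebra_simps)
  then have 0: "(b4 * q - c4 * p - a4 * r) * ?u $ 3 + a3 * r * ?u $ 4 = 0"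
    unfolding assms by simp
  have "jacobian (graded_product a3 a4 a5 b4 b5 c4 c5 p q r) x y u = vec5 0 0 0 0
      (\<Delta> 1 2 x y * ((b4 * q - c4 * p - a4 * r) * u $ 3 + a3 * r * u $ 4))"
    if "u $ 1 = 0" "u $ 2 = 0" for u
    unfolding jacobian_graded_product using that by (simp add: \<Delta>_def algebra_simps)
  from this[of ?u] have "jacobian (graded_product a3 a4 a5 b4 b5 c4 c5 p q r) x y ?u = vec5 0 0
      0 0 0"
    unfolding 0 by (simp add: graded_product_def)
  then show ?thesis by (simp add: vec_eq_5)
qed

text \<open>Both sides of the Malcev identity vanish: the left one has a product in its last slot,
  and on the right the Jacobian is a multiple of e5, which annihilates everything.\<close>

lemma malcev_graded_product:
  assumes "a3 * (b4 * q - c4 * p) = 0" "a3 * b4 * r = 0" "a3 * c4 * r = 0"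
  shows "malcev_algebra (*s) (graded_product a3 a4 a5 b4 b5 c4 c5 p q r)"
  using anticommutative_graded_product
  by (simp add: malcev_algebra_def jacobian_graded_product_derived[OF assms])
    (simp add: jacobian_graded_product graded_product_def \<Delta>_def vec_eq_5)

text \<open>Moves the product in J([x, y], x, y) to the last slot, where
  \<open>jacobian_graded_product_derived\<close> applies.\<close>

lemma jacobian_rotate: "jacobian br x y z = jacobian br y z x"
  by (simp add: jacobian_def ac_simps)

lemma binary_lie_graded_product:
  assumes "a3 * (b4 * q - c4 * p) = 0" "a3 * b4 * r = 0" "a3 * c4 * r = 0"
  shows "binary_lie_algebra (*s) (graded_product a3 a4 a5 b4 b5 c4 c5 p q r)"
  unfolding binary_lie_algebra_def
  by (subst jacobian_rotate)
    (simp add: anticommutative_graded_product jacobian_graded_product_derived[OF assms])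

lemma nilpotent_graded_product:
  "nilpotent_algebra (*s) (graded_product a3 a4 a5 b4 b5 c4 c5 p q r)"
proof -
  let ?br = "graded_product a3 a4 a5 b4 b5 c4 c5 p q r"
  let ?A = "alg_power (*s) ?br"
  \<comment> \<open>The filtration allows e1 and e2 up to degree 1, e3 up to 2, e4 up to 3 and e5 up
    to 6. The threshold 7 is chosen because i + j \<ge> 7 forces i or j to be at least 4, and
    \<open>W 4\<close> contains only multiples of the central e5.\<close>
  define W :: "nat \<Rightarrow> ('a ^ 5) set" where "W n = {x. (n \<ge> 2 \<longrightarrow> x $ 1 = 0 \<and> x $ 2 = 0) \<and>
    (n \<ge> 3 \<longrightarrow> x $ 3 = 0) \<and> (n \<ge> 4 \<longrightarrow> x $ 4 = 0) \<and> (n \<ge> 7 \<longrightarrow> x $ 5 = 0)}" for n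
  have W: "?br x y \<in> W (i + j)" if "x \<in> W i" "y \<in> W j" "i \<ge> 1" "j \<ge> 1" for x y i j
  proof -
    have "i = 1 \<or> i = 2 \<or> i = 3 \<or> i \<ge> 4" "j = 1 \<or> j = 2 \<or> j = 3 \<or> j \<ge> 4" using that(3,4) by
        linarith+
    then show ?thesis using that(1,2) by (elim disjE) (simp_all add: W_def graded_product_simps)
  qed
  have sub: "vec.subspace (W n)" for n
    by (auto simp: vec.subspace_def W_def)
  have A: "?A n \<subseteq> W n" if "n \<ge> 1" for n
    using that
  proof (induction n rule: less_induct)
    case (less n)
    show ?case
    proof (cases "n = 1")
      case True then show ?thesis by (simp add: W_def)
    next
      case False
      with less.prems have "n = Suc (Suc (n - 2))" by simp
      then obtain m where m: "n = Suc (Suc m)" by blast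
      have "?br x y \<in> W n" if i: "i \<in> {1..Suc m}" and x: "x \<in> ?A i" and y: "y \<in> ?A (n - i)" for
          i x y
      proof -
        have "i < n" "i \<ge> 1" "n - i < n" "n - i \<ge> 1" "i + (n - i) = n" using i m by auto
        moreover from this have "x \<in> W i" "y \<in> W (n - i)"
          using less.IH[of i] less.IH[of "n - i"] x y by blast+
        ultimately show ?thesis using W[of x i y "n - i"] by simp
      qed
      then have *: "(\<Union>i\<in>{1..Suc m}. {?br x y | x y. x \<in> ?A i \<and> y \<in> ?A (n - i)}) \<subseteq> W n" by blast
      have "vec.span (\<Union>i\<in>{1..Suc m}. {?br x y | x y. x \<in> ?A i \<and> y \<in> ?A (n - i)}) \<subseteq> W n"
        using * sub by (rule vec.span_minimal)
      then show ?thesis unfolding m alg_power.simps .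
    qed
  qed
  \<comment> \<open>Seven is written with two successors so that the recursive equation of
    \<open>alg_power\<close> applies.\<close>
  have "?A (Suc (Suc 5)) \<subseteq> W (Suc (Suc 5))" by (rule A) simp
  moreover have "W (Suc (Suc 5)) = {0}" by (auto simp: W_def vec_eq_5)
  moreover have "0 \<in> ?A (Suc (Suc 5))"
    unfolding alg_power.simps by (rule vec.span_zero)
  ultimately have "?A (Suc (Suc 5)) = {0}" by blast
  then show ?thesis unfolding nilpotent_algebra_def by (intro exI[of _ "Suc (Suc 5)"] conjI)
      (simp del: alg_power.simps)
qed

section \<open>Isomorphisms and adapted bases\<close>

lemma bilinear_mapD:
  assumes "bilinear_map s t b"
  shows "b (x + y) z = b x z + b y z" "b x (y + z) = b x y + b x z"
    "b (s c x) y = t c (b x y)" "b x (s c y) = t c (b x y)"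
    "b (- x) y = - b x y" "b x (- y) = - b x y" "b 0 y = 0" "b x 0 = 0"
    "b (x - y) z = b x z - b y z" "b x (y - z) = b x y - b x z"
proof -
  have 1: "Vector_Spaces.linear s t (\<lambda>x. b x y)" and 2: "Vector_Spaces.linear s t (b x)" for x y
    using assms by (auto simp: bilinear_map_def)
  note h1 = module_hom_iff_linear[THEN iffD2, OF 1]
  note h2 = module_hom_iff_linear[THEN iffD2, OF 2]
  show "b (x + y) z = b x z + b y z" "b x (y + z) = b x y + b x z"
    "b (s c x) y = t c (b x y)" "b x (s c y) = t c (b x y)"
    "b (- x) y = - b x y" "b x (- y) = - b x y" "b 0 y = 0" "b x 0 = 0"
    "b (x - y) z = b x z - b y z" "b x (y - z) = b x y - b x z"
    using module_hom.add[OF h1] module_hom.add[OF h2] module_hom.scale[OF h1]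
        module_hom.scale[OF h2]
      module_hom.neg[OF h1] module_hom.neg[OF h2] module_hom.zero[OF h1] module_hom.zero[OF h2]
      module_hom.diff[OF h1] module_hom.diff[OF h2]
    by metis+
qed

lemma anticommutativeD:
  assumes "anticommutative_algebra s br"
  shows "br x y = - br y x"
proof -
  have b: "bilinear_map s s br" and z: "\<And>x. br x x = 0"
    using assms by (auto simp: anticommutative_algebra_def)
  have "br (x + y) (x + y) = br x y + br y x"
    unfolding bilinear_mapD(1,2)[OF b] by (simp add: z)
  then show ?thesis unfolding z by (simp add: eq_neg_iff_add_eq_0)
qed

lemma algebra_isomorphic_sym:
  assumes "algebra_isomorphic s br t br'"
  shows "algebra_isomorphic t br' s br"
proof -
  from assms obtain \<phi> where lin: "Vector_Spaces.linear s t \<phi>" and bij: "bij \<phi>"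
    and hom: "\<And>x y. \<phi> (br x y) = br' (\<phi> x) (\<phi> y)"
    unfolding algebra_isomorphic_def by blast
  interpret Vector_Spaces.linear s t \<phi> by (rule lin)
  have surj: "\<phi> (inv \<phi> y) = y" for y using bij by (simp add: bij_def surj_f_inv_f)
  have inj: "inj \<phi>" using bij by (simp add: bij_def)
  have "Vector_Spaces.linear t s (inv \<phi>)"
    by (intro Vector_Spaces.linear.intro module_hom.intro module_hom_axioms.intro
        vs1.vector_space_axioms vs2.vector_space_axioms vs1.module_axioms vs2.module_axioms;
        rule injD[OF inj]; simp add: surj add scale)
  moreover have "inv \<phi> (br' x y) = br (inv \<phi> x) (inv \<phi> y)" for x y
    by (rule injD[OF inj]) (simp add: surj hom)
  ultimately show ?thesis
    unfolding algebra_isomorphic_def using bij_imp_bij_inv[OF bij] by blast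
qed

lemma algebra_isomorphic_trans:
  assumes "algebra_isomorphic s br t br'" "algebra_isomorphic t br' u br''"
  shows "algebra_isomorphic s br u br''"
proof -
  from assms obtain \<phi> \<psi> where "Vector_Spaces.linear s t \<phi>" "bij \<phi>"
      "\<And>x y. \<phi> (br x y) = br' (\<phi> x) (\<phi> y)" "Vector_Spaces.linear t u \<psi>" "bij \<psi>"
      "\<And>x y. \<psi> (br' x y) = br'' (\<psi> x) (\<psi> y)"
    unfolding algebra_isomorphic_def by blast
  then show ?thesis unfolding algebra_isomorphic_def
    by (intro exI[of _ "\<psi> \<circ> \<phi>"]) (auto intro: Vector_Spaces.linear_compose bij_comp)
qed

lemma jacobian_hom:
  assumes "Vector_Spaces.linear s t \<phi>" "\<And>x y. \<phi> (br x y) = br' (\<phi> x) (\<phi> y)"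
  shows "\<phi> (jacobian br x y z) = jacobian br' (\<phi> x) (\<phi> y) (\<phi> z)"
proof -
  interpret Vector_Spaces.linear s t \<phi> by (rule assms)
  show ?thesis by (simp add: jacobian_def add assms(2))
qed

lemma algebra_isomorphic_binary_lie:
  assumes "algebra_isomorphic s br t br'" "binary_lie_algebra s br" "anticommutative_algebra t br'"
  shows "binary_lie_algebra t br'"
proof -
  from assms(1) obtain \<phi> where lin: "Vector_Spaces.linear s t \<phi>" and bij: "bij \<phi>"
    and hom: "\<And>x y. \<phi> (br x y) = br' (\<phi> x) (\<phi> y)"
    unfolding algebra_isomorphic_def by blast
  interpret Vector_Spaces.linear s t \<phi> by (rule lin)
  have "jacobian br' (br' x y) x y = 0" for x y
  proof -
    define u v where "u = inv \<phi> x" and "v = inv \<phi> y"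
    then have "x = \<phi> u" "y = \<phi> v" using bij by (simp_all add: bij_def surj_f_inv_f)
    then have "jacobian br' (br' x y) x y = \<phi> (jacobian br (br u v) u v)"
      by (simp add: jacobian_hom[of s t \<phi> br br', OF lin hom] hom)
    then show ?thesis using assms(2) by (simp add: binary_lie_algebra_def zero)
  qed
  then show ?thesis using assms(3) by (simp add: binary_lie_algebra_def)
qed

lemma algebra_isomorphic_malcev:
  assumes "algebra_isomorphic s br t br'" "malcev_algebra s br" "anticommutative_algebra t br'"
  shows "malcev_algebra t br'"
proof -
  from assms(1) obtain \<phi> where lin: "Vector_Spaces.linear s t \<phi>" and bij: "bij \<phi>"
    and hom: "\<And>x y. \<phi> (br x y) = br' (\<phi> x) (\<phi> y)"
    unfolding algebra_isomorphic_def by blast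
  have "jacobian br' x y (br' x z) = br' (jacobian br' x y z) x" for x y z
  proof -
    define u v w where "u = inv \<phi> x" and "v = inv \<phi> y" and "w = inv \<phi> z"
    then have uvw: "x = \<phi> u" "y = \<phi> v" "z = \<phi> w" using bij by (simp_all add: bij_def surj_f_inv_f)
    have "jacobian br u v (br u w) = br (jacobian br u v w) u"
      using assms(2) by (simp add: malcev_algebra_def)
    from this[THEN arg_cong[where f = \<phi>]] show ?thesis
      unfolding uvw by (simp add: jacobian_hom[of s t \<phi> br br', OF lin hom] hom)
  qed
  then show ?thesis using assms(3) by (simp add: malcev_algebra_def)
qed

section \<open>Coordinates with respect to five vectors, and adapted bases\<close>

definition comb5 :: "('f::field \<Rightarrow> 'v::ab_group_add \<Rightarrow> 'v) \<Rightarrow> 'v \<Rightarrow> 'v \<Rightarrow> 'v \<Rightarrow> 'v \<Rightarrow> 'v \<Rightarrow> 'f ^ 5 \<Rightarrow> 'v"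
  where "comb5 s b1 b2 b3 b4 b5 x = s (x $ 1) b1 + s (x $ 2) b2 + s (x $ 3) b3 + s (x $ 4) b4 +
      s (x $ 5) b5"

lemma linear_comb5:
  assumes "vector_space s"
  shows "Vector_Spaces.linear (*s) s (comb5 s b1 b2 b3 b4 b5)"
proof -
  interpret vector_space s by (rule assms)
  show ?thesis
    by (intro Vector_Spaces.linear.intro module_hom.intro module_hom_axioms.intro
        vec.vector_space_axioms vec.module_axioms assms module_axioms)
      (simp_all add: comb5_def scale_left_distrib scale_right_distrib ac_simps)
qed

lemma product_comb5:
  assumes "anticommutative_algebra s br"
  shows "br (comb5 s b1 b2 b3 b4 b5 x) (comb5 s b1 b2 b3 b4 b5 y) =
    s (\<Delta> 1 2 x y) (br b1 b2) + s (\<Delta> 1 3 x y) (br b1 b3) + s (\<Delta> 2 3 x y) (br b2 b3) +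
    s (\<Delta> 1 4 x y) (br b1 b4) + s (\<Delta> 2 4 x y) (br b2 b4) + s (\<Delta> 3 4 x y) (br b3 b4) +
    s (\<Delta> 1 5 x y) (br b1 b5) + s (\<Delta> 2 5 x y) (br b2 b5) + s (\<Delta> 3 5 x y) (br b3 b5) +
    s (\<Delta> 4 5 x y) (br b4 b5)"
proof -
  interpret vector_space s using assms by (simp add: anticommutative_algebra_def)
  have b: "bilinear_map s s br" and z: "\<And>x. br x x = 0"
    using assms by (auto simp: anticommutative_algebra_def)
  note ac = anticommutativeD[OF assms]
  note sw = ac[of b2 b1] ac[of b3 b1] ac[of b3 b2] ac[of b4 b1] ac[of b4 b2] ac[of b4 b3]
    ac[of b5 b1] ac[of b5 b2] ac[of b5 b3] ac[of b5 b4]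
  show ?thesis
    unfolding comb5_def bilinear_mapD[OF b] sw z \<Delta>_def scale_left_diff_distrib scale_right_distrib
      scale_minus_right scale_scale scale_zero_right
    by (simp add: algebra_simps)
qed

text \<open>Peels one coefficient off a vanishing combination of flag vectors: each of them lies
  outside the span of the later ones.\<close>

lemma (in vector_space) scale_add_eq_0D:
  assumes "scale c v + w = 0" "subspace S" "w \<in> S" "v \<notin> S"
  shows "c = 0"
proof (rule ccontr)
  assume "c \<noteq> 0"
  have "scale c v \<in> S" using assms(1,2,3) by (metis add_eq_0_iff2 subspace_neg)
  then have "scale (inverse c) (scale c v) \<in> S" using assms(2) by (rule subspace_scale[rotated])
  with \<open>c \<noteq> 0\<close> assms(4) show False by simp
qed

text \<open>Take \<open>v\<close> in the last power of the algebra that is not contained in \<open>S\<close>.\<close>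

lemma nilpotent_extend_flag:
  assumes "vector_space s" "nilpotent_algebra s br" "S \<noteq> UNIV" "0 \<in> S"
  obtains v where "v \<notin> S" "\<And>x. br v x \<in> S"
proof -
  interpret vector_space s by (rule assms)
  let ?A = "alg_power s br"
  define N where "N = (LEAST n. n \<ge> 1 \<and> ?A n \<subseteq> S)"
  from assms(2,4) have "\<exists>n. n \<ge> 1 \<and> ?A n \<subseteq> S" unfolding nilpotent_algebra_def by force
  then have N: "N \<ge> 1" "?A N \<subseteq> S" unfolding N_def by (metis (mono_tags, lifting) LeastI_ex)+
  have "N \<noteq> 1" using N(2) assms(3) by auto
  with N(1) have "N = Suc (Suc (N - 2))" by simp
  then obtain m where m: "N = Suc (Suc m)" by blast
  have "\<not> ?A (Suc m) \<subseteq> S"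
    using not_less_Least[of "Suc m" "\<lambda>n. n \<ge> 1 \<and> ?A n \<subseteq> S"] unfolding N_def[symmetric] m by simp
  then obtain v where v: "v \<in> ?A (Suc m)" "v \<notin> S" by blast
  have "br v x \<in> ?A N" for x
  \<comment> \<open>In the recursion for power N the index i = \<open>Suc m\<close> pairs power
    \<open>Suc m\<close> with the first power, which is the whole algebra, so x may be
    arbitrary.\<close>
  proof -
    have "br v x \<in> (\<Union>i\<in>{1..Suc m}. {br x y | x y. x \<in> ?A i \<and> y \<in> ?A (Suc (Suc m) - i)})"
      using v(1) by (intro UN_I[of "Suc m"]) (auto simp: Suc_diff_le)
    then show ?thesis unfolding m alg_power.simps by (rule span_base)
  qed
  with N(2) v(2) show ?thesis using that by blast
qed

text \<open>The flag is built from the bottom: b5 is central, and each earlier vector is new modulo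
  the later ones and multiplies the algebra into their span. For i < j the product [b_i, b_j] is
  controlled by the condition on b_j, which leaves 3 + 2 + 2 + 1 + 1 + 1 structure
  constants.\<close>

lemma nilpotent_dim5_graded:
  fixes s :: "'f::field \<Rightarrow> 'v::ab_group_add \<Rightarrow> 'v"
  assumes ac: "anticommutative_algebra s br" and nil: "nilpotent_algebra s br"
    and dim: "vector_space.dim s UNIV = 5"
  obtains a3 a4 a5 b4 b5 c4 c5 p q r
  where "algebra_isomorphic (*s) (graded_product a3 a4 a5 b4 b5 c4 c5 p q r) s br"
proof -
  have vs: "vector_space s" using ac by (simp add: anticommutative_algebra_def)
  interpret vector_space s by (rule vs)
  have zero: "\<And>x. br x x = 0" using ac by (auto simp: anticommutative_algebra_def)
  have ext: "\<exists>v. v \<notin> span B \<and> (\<forall>x. br v x \<in> span B)"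
    if "independent B" "card B < 5" for B
  proof -
    have "span B \<noteq> UNIV" using basis_card_eq_dim[of B UNIV] that dim by auto
    then show ?thesis using nilpotent_extend_flag[OF vs nil, of "span B"] span_zero by metis
  qed
  obtain b5 where b5: "b5 \<notin> span {}" "\<And>x. br b5 x \<in> span {}"
    using ext[of "{}"] independent_empty by auto
  have i5: "independent {b5}" using b5(1) independent_insertI[of b5 "{}"] independent_empty by simp
  obtain b4 where b4: "b4 \<notin> span {b5}" "\<And>x. br b4 x \<in> span {b5}"
    using ext[OF i5] by auto
  note i4 = independent_insertI[OF b4(1) i5]
  have d4: "b4 \<noteq> b5" using b4(1) by (auto intro: span_base)
  obtain b3 where b3: "b3 \<notin> span {b4, b5}" "\<And>x. br b3 x \<in> span {b4, b5}"
    using ext[OF i4] d4 by auto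
  note i3 = independent_insertI[OF b3(1) i4]
  have d3: "b3 \<noteq> b4" "b3 \<noteq> b5" using b3(1) by (auto intro: span_base)
  obtain b2 where b2: "b2 \<notin> span {b3, b4, b5}" "\<And>x. br b2 x \<in> span {b3, b4, b5}"
    using ext[OF i3] d4 d3 by auto
  note i2 = independent_insertI[OF b2(1) i3]
  have d2: "b2 \<noteq> b3" "b2 \<noteq> b4" "b2 \<noteq> b5" using b2(1) by (auto intro: span_base)
  obtain b1 where b1: "b1 \<notin> span {b2, b3, b4, b5}"
    using ext[OF i2] d4 d3 d2 by auto
  note i1 = independent_insertI[OF b1 i2]
  have d1: "b1 \<noteq> b2" "b1 \<noteq> b3" "b1 \<noteq> b4" "b1 \<noteq> b5" using b1 by (auto intro: span_base)
  have span: "span {b1, b2, b3, b4, b5} = UNIV"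
  proof (rule ccontr)
    assume "span {b1, b2, b3, b4, b5} \<noteq> UNIV"
    then obtain v where v: "v \<notin> span {b1, b2, b3, b4, b5}" by blast
    note i = independent_insertI[OF v i1]
    have "v \<notin> {b1, b2, b3, b4, b5}" using v by (blast intro: span_base)
    then have c: "card {v, b1, b2, b3, b4, b5} = 6" using d1 d2 d3 d4 by simp
    obtain B where B: "independent B" "UNIV \<subseteq> span B" "card B = dim UNIV"
      using basis_exists[of UNIV] by auto
    \<comment> \<open>Infinite sets have cardinality 0, so cardinality 5 entails finiteness.\<close>
    have "finite B" using B(3) dim by (metis card.infinite zero_neq_numeral)
    then have "card {v, b1, b2, b3, b4, b5} \<le> card B"
      using independent_span_bound[of B] i B(2) by blast
    then show False using c B(3) dim by simp
  qed
  let ?\<phi> = "comb5 s b1 b2 b3 b4 b5"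
  have lin: "Vector_Spaces.linear (*s) s ?\<phi>" by (rule linear_comb5[OF vs])
  have in1: "s c u \<in> span B" if "u \<in> B" for c u B
    using that by (intro span_scale span_base)
  have "x = 0" if "?\<phi> x = 0" for x
  proof -
    have x1: "x $ 1 = 0"
      using that by (intro scale_add_eq_0D[OF _ subspace_span _ b1, of _ "s (x $ 2) b2 + s (x $
          3) b3 + s (x $ 4) b4 + s (x $ 5) b5"])
        (auto simp: comb5_def ac_simps intro!: span_add in1)
    have x2: "x $ 2 = 0"
      using that x1 by (intro scale_add_eq_0D[OF _ subspace_span _ b2(1), of _ "s (x $ 3) b3 + s
          (x $ 4) b4 + s (x $ 5) b5"])
        (auto simp: comb5_def ac_simps intro!: span_add in1)
    have x3: "x $ 3 = 0"
      using that x1 x2 by (intro scale_add_eq_0D[OF _ subspace_span _ b3(1), of _ "s (x $ 4) b4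
          + s (x $ 5) b5"])
        (auto simp: comb5_def ac_simps intro!: span_add in1)
    have x4: "x $ 4 = 0"
      using that x1 x2 x3 by (intro scale_add_eq_0D[OF _ subspace_span _ b4(1), of _ "s (x $ 5)
          b5"])
        (auto simp: comb5_def ac_simps intro!: span_add in1)
    have x5: "x $ 5 = 0"
      using that x1 x2 x3 x4 b5(1) by (auto simp: comb5_def)
    show ?thesis using x1 x2 x3 x4 x5 by (simp add: vec_eq_5)
  qed
  then have inj: "inj ?\<phi>"
    using module_hom.inj_iff_eq_0[OF module_hom_iff_linear[THEN iffD2, OF lin]] by blast
  have "\<exists>x. ?\<phi> x = v" for v
  proof -
    have "v \<in> span {b1, b2, b3, b4, b5}" using span by simp
    then obtain k1 k2 k3 k4 k5 where "v - s k1 b1 - s k2 b2 - s k3 b3 - s k4 b4 - s k5 b5 = 0"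
      unfolding span_breakdown_eq by auto
    then have "?\<phi> (vec5 k1 k2 k3 k4 k5) = v" by (simp add: comb5_def algebra_simps)
    then show ?thesis by blast
  qed
  then have surj: "surj ?\<phi>" by (metis surjI)
  have e2: "\<exists>k3 k4 k5. br x b2 = s k3 b3 + s k4 b4 + s k5 b5" for x
  proof -
    have "br x b2 \<in> span {b3, b4, b5}" using b2(2)[of x] anticommutativeD[OF ac, of x b2]
        span_neg by simp
    then obtain k3 k4 k5 where "br x b2 - s k3 b3 - s k4 b4 - s k5 b5 = 0"
      unfolding span_breakdown_eq by auto
    then have "br x b2 = s k3 b3 + s k4 b4 + s k5 b5" by (simp add: algebra_simps)
    then show ?thesis by blast
  qed
  have e3: "\<exists>k4 k5. br x b3 = s k4 b4 + s k5 b5" for x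
  proof -
    have "br x b3 \<in> span {b4, b5}" using b3(2)[of x] anticommutativeD[OF ac, of x b3] span_neg
        by simp
    then obtain k4 k5 where "br x b3 - s k4 b4 - s k5 b5 = 0"
      unfolding span_breakdown_eq by auto
    then have "br x b3 = s k4 b4 + s k5 b5" by (simp add: algebra_simps)
    then show ?thesis by blast
  qed
  have e4: "\<exists>k5. br x b4 = s k5 b5" for x
  proof -
    have "br x b4 \<in> span {b5}" using b4(2)[of x] anticommutativeD[OF ac, of x b4] span_neg by simp
    then obtain k5 where "br x b4 - s k5 b5 = 0"
      unfolding span_breakdown_eq by auto
    then have "br x b4 = s k5 b5" by (simp add: algebra_simps)
    then show ?thesis by blast
  qed
  have e5: "br x b5 = 0" for x
    using b5(2)[of x] anticommutativeD[OF ac, of x b5] by simp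
  obtain a3 a4 a5 where t12: "br b1 b2 = s a3 b3 + s a4 b4 + s a5 b5" using e2 by blast
  obtain c4 c5 where t13: "br b1 b3 = s c4 b4 + s c5 b5" using e3 by blast
  obtain d4 d5 where t23: "br b2 b3 = s d4 b4 + s d5 b5" using e3 by blast
  obtain p q r where t4: "br b1 b4 = s p b5" "br b2 b4 = s q b5" "br b3 b4 = s r b5" using e4 by
      metis
  have "?\<phi> (graded_product a3 a4 a5 c4 c5 d4 d5 p q r x y) = br (?\<phi> x) (?\<phi> y)" for x y
    unfolding product_comb5[OF ac] t12 t13 t23 t4 e5
    unfolding comb5_def graded_product_def vec5_nth
    by (simp add: scale_left_distrib scale_right_distrib algebra_simps)
  then have "algebra_isomorphic (*s) (graded_product a3 a4 a5 c4 c5 d4 d5 p q r) s br"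
    unfolding algebra_isomorphic_def using lin inj surj by (auto simp: bij_def)
  then show ?thesis by (rule that)
qed

section \<open>Normal forms\<close>

text \<open>Turns every change of basis into a finite check: five vectors of B without a nontrivial
  relation whose ten products match the desired table. Surjectivity then follows from injectivity,
  as both sides have dimension 5.\<close>

lemma graded_product_isoI:
  fixes B :: "'f::field ^ 5 \<Rightarrow> 'f ^ 5 \<Rightarrow> 'f ^ 5"
  assumes "anticommutative_algebra (*s) B"
    and inj: "\<And>x. comb5 (*s) v1 v2 v3 v4 v5 x = 0 \<Longrightarrow> x = 0"
    and "B v1 v2 = a3 *s v3 + a4 *s v4 + a5 *s v5"
    and "B v1 v3 = b4 *s v4 + b5 *s v5" "B v2 v3 = c4 *s v4 + c5 *s v5"
    and "B v1 v4 = p *s v5" "B v2 v4 = q *s v5" "B v3 v4 = r *s v5"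
    and "B v1 v5 = 0" "B v2 v5 = 0" "B v3 v5 = 0" "B v4 v5 = 0"
  shows "algebra_isomorphic (*s) (graded_product a3 a4 a5 b4 b5 c4 c5 p q r) (*s) B"
proof -
  let ?\<phi> = "comb5 (*s) v1 v2 v3 v4 v5"
  have lin: "Vector_Spaces.linear (*s) (*s) ?\<phi>"
    by (rule linear_comb5) (rule vec.vector_space_axioms)
  have "inj ?\<phi>" unfolding vec.linear_inj_iff_eq_0[OF lin] using inj by blast
  then have "bij ?\<phi>" using vec.linear_inj_imp_surj[OF lin] by (simp add: bij_def)
  moreover have "?\<phi> (graded_product a3 a4 a5 b4 b5 c4 c5 p q r x y) = B (?\<phi> x) (?\<phi> y)" for x y
    unfolding product_comb5[OF assms(1)] assms(3-)
    by (simp add: comb5_def graded_product_def vec_eq_5 algebra_simps)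
  ultimately show ?thesis unfolding algebra_isomorphic_def using lin by blast
qed

lemmas graded_product_iso_gradedI = graded_product_isoI[OF anticommutative_graded_product]
lemmas graded_iso_simps = vec_eq_5 comb5_def graded_product_simps

definition classified :: "('f::field ^ 5 \<Rightarrow> 'f ^ 5 \<Rightarrow> 'f ^ 5) \<Rightarrow> bool"
  where "classified A \<longleftrightarrow> (\<exists>B\<in>set algebras5. algebra_isomorphic (*s) B (*s) A)"

lemma classified_iso: "classified A \<Longrightarrow> algebra_isomorphic (*s) A (*s) B \<Longrightarrow> classified B"
  unfolding classified_def using algebra_isomorphic_trans by blast

lemma classifiedI: "B \<in> set algebras5 \<Longrightarrow> algebra_isomorphic (*s) B (*s) A \<Longrightarrow> classified A"
  unfolding classified_def by blast

lemma graded_product_in_algebras5: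
  "graded_product 0 0 0 0 0 0 0 0 0 0 \<in> set algebras5"
  "graded_product 1 0 0 0 0 0 0 0 0 0 \<in> set algebras5"
  "graded_product 1 0 0 1 0 0 0 0 0 0 \<in> set algebras5"
  "graded_product 0 0 1 0 0 0 0 0 0 1 \<in> set algebras5"
  "graded_product 1 0 0 0 1 0 0 0 1 0 \<in> set algebras5"
  "graded_product 1 0 0 1 0 0 1 1 0 0 \<in> set algebras5"
  "graded_product 1 0 0 1 0 0 0 1 0 0 \<in> set algebras5"
  "graded_product 0 1 0 0 1 0 0 0 0 0 \<in> set algebras5"
  "graded_product 1 0 0 1 0 0 1 0 0 0 \<in> set algebras5"
  "graded_product 1 0 0 0 0 0 0 0 0 1 \<in> set algebras5"
  unfolding algebras5_def algebras5_graded by simp_all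

text \<open>Here all products other than \<open>[e\<^sub>1, e\<^sub>2] = e\<^sub>3\<close> are multiples of \<open>e\<^sub>5\<close>.\<close>

lemma classified_tail_r:
  assumes "r \<noteq> 0" shows "classified (graded_product 1 0 0 0 b 0 c p q r)"
  \<comment> \<open>As [e3, e4] is nonzero, e1 and e2 can be corrected by multiples of e3 and e4 so
    that both products with e3 and with e4 vanish. The third vector is the product of the corrected
    ones.\<close>
  by (rule classifiedI[OF graded_product_in_algebras5(10)], rule graded_product_iso_gradedI[of
      "vec5 1 0 (- p / r) (b / r) 0" "vec5 0 1 (- q / r) (c / r) 0"
        "vec5 0 0 1 0 ((p * c - b * q) / r)" "vec5 0 0 0 1 0" "vec5 0 0 0 0 r"])
    (use assms in \<open>auto simp: graded_iso_simps field_simps\<close>)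

text \<open>If q = 0, subtracting p / b times e3 from e4 makes it central, so it splits off. If q is
  nonzero, a combination of e3 and e4 commutes with e1 and has the same product with e2 as e1 has
  with e3.\<close>

lemma classified_tail_b:
  assumes "b \<noteq> 0" shows "classified (graded_product 1 0 0 0 b 0 0 p q 0)"
proof (cases "q = 0")
  case True
  show ?thesis
    by (rule classifiedI[OF graded_product_in_algebras5(3)], rule graded_product_iso_gradedI[of
        "vec5 1 0 0 0 0" "vec5 0 1 0 0 0"
        "vec5 0 0 1 0 0" "vec5 0 0 0 0 b" "vec5 0 0 (- p / b) 1 0"])
    (use assms True in \<open>auto simp: graded_iso_simps field_simps\<close>)
next
  case False
  show ?thesis
    by (rule classifiedI[OF graded_product_in_algebras5(5)], rule graded_product_iso_gradedI[of
        "vec5 1 0 0 0 0" "vec5 0 1 0 0 0"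
        "vec5 0 0 1 0 0" "vec5 0 0 (- p / q) (b / q) 0" "vec5 0 0 0 0 b"])
    (use assms False in \<open>auto simp: graded_iso_simps field_simps\<close>)
qed

text \<open>Two moves preserve [e1, e2] = e3: subtracting a multiple of e1 from e2, which removes c
  when b is nonzero, and replacing (e1, e2) by (e2, -e1), which puts c in the place of b. If b = c =
  r = 0, the same elimination is applied to p and q.\<close>

lemma classified_tail:
  "classified (graded_product 1 0 0 0 b 0 c p q r)"
proof -
  consider "r \<noteq> 0" | "r = 0" "b \<noteq> 0" | "r = 0" "b = 0" "c \<noteq> 0" | "r = 0" "b = 0" "c = 0" "p \<noteq> 0"
    | "r = 0" "b = 0" "c = 0" "p = 0" "q \<noteq> 0" | "r = 0" "b = 0" "c = 0" "p = 0" "q = 0" by blast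
  then show ?thesis
  proof cases
    case 1 then show ?thesis by (rule classified_tail_r)
  next
    case 2
    show ?thesis
      by (rule classified_iso[OF classified_tail_b[OF 2(2), of p "q - c / b * p"]],
          rule graded_product_iso_gradedI[of "vec5 1 0 0 0 0" "vec5 (- c / b) 1 0 0 0" "vec5 0 0
              1 0 0" "vec5 0 0 0 1 0" "vec5 0 0 0 0 1"])
        (use 2 in \<open>auto simp: graded_iso_simps field_simps\<close>)
  next
    case 3
    show ?thesis
      by (rule classified_iso[OF classified_tail_b[OF 3(3), of q "- p"]],
          rule graded_product_iso_gradedI[of "vec5 0 1 0 0 0" "vec5 (- 1) 0 0 0 0" "vec5 0 0 1 0
              0" "vec5 0 0 0 1 0" "vec5 0 0 0 0 1"])
        (use 3 in \<open>auto simp: graded_iso_simps field_simps\<close>)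
  next
    case 4
    show ?thesis
      by (rule classifiedI[OF graded_product_in_algebras5(8)], rule
          graded_product_iso_gradedI[of "vec5 1 0 0 0 0" "vec5 (- q / p) 1 0 0 0"
        "vec5 0 0 0 1 0" "vec5 0 0 1 0 0" "vec5 0 0 0 0 p"])
        (use 4 in \<open>auto simp: graded_iso_simps field_simps\<close>)
  next
    case 5
    show ?thesis
      by (rule classifiedI[OF graded_product_in_algebras5(8)], rule
          graded_product_iso_gradedI[of "vec5 0 1 0 0 0" "vec5 1 0 0 0 0"
        "vec5 0 0 0 1 0" "vec5 0 0 (- 1) 0 0" "vec5 0 0 0 0 q"])
        (use 5 in \<open>auto simp: graded_iso_simps field_simps\<close>)
  next
    case 6
    show ?thesis
      by (rule classifiedI[OF graded_product_in_algebras5(2)], rule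
          graded_product_iso_gradedI[of "vec5 1 0 0 0 0" "vec5 0 1 0 0 0"
        "vec5 0 0 1 0 0" "vec5 0 0 0 1 0" "vec5 0 0 0 0 1"])
        (use 6 in \<open>auto simp: graded_iso_simps field_simps\<close>)
  qed
qed

lemma classified_filiform: "classified (graded_product 1 0 0 1 0 0 c p 0 0)"
proof -
  consider "c = 0" "p = 0" | "c \<noteq> 0" "p = 0" | "c = 0" "p \<noteq> 0" | "c \<noteq> 0" "p \<noteq> 0" by blast
  then show ?thesis
  proof cases
    case 1
    show ?thesis
      by (rule classifiedI[OF graded_product_in_algebras5(3)], rule
          graded_product_iso_gradedI[of "vec5 1 0 0 0 0" "vec5 0 1 0 0 0"
        "vec5 0 0 1 0 0" "vec5 0 0 0 1 0" "vec5 0 0 0 0 1"])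
        (use 1 in \<open>auto simp: graded_iso_simps field_simps\<close>)
  next
    case 2
    show ?thesis
      by (rule classifiedI[OF graded_product_in_algebras5(9)], rule
          graded_product_iso_gradedI[of "vec5 1 0 0 0 0" "vec5 0 1 0 0 0"
        "vec5 0 0 1 0 0" "vec5 0 0 0 1 0" "vec5 0 0 0 0 c"])
        (use 2 in \<open>auto simp: graded_iso_simps field_simps\<close>)
  next
    case 3
    show ?thesis
      by (rule classifiedI[OF graded_product_in_algebras5(7)], rule
          graded_product_iso_gradedI[of "vec5 1 0 0 0 0" "vec5 0 1 0 0 0"
        "vec5 0 0 1 0 0" "vec5 0 0 0 1 0" "vec5 0 0 0 0 p"])
        (use 3 in \<open>auto simp: graded_iso_simps field_simps\<close>)
  next
    \<comment> \<open>Scaling e2, e3 and e4 by t multiplies [e1, e4] by t and [e2, e3] by the square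
      of t. Both become the same multiple of e5 when t * p = t * t * c, so t = p / c.\<close>
    case 4
    show ?thesis
      by (rule classifiedI[OF graded_product_in_algebras5(6)], rule
          graded_product_iso_gradedI[of "vec5 1 0 0 0 0" "vec5 0 (p / c) 0 0 0"
        "vec5 0 0 (p / c) 0 0" "vec5 0 0 0 (p / c) 0" "vec5 0 0 0 0 (p * p / c)"])
        (use 4 in \<open>auto simp: graded_iso_simps field_simps\<close>)
  qed
qed

lemma classified_a3_nonzero:
  assumes "a3 \<noteq> 0" "b4 * q = c4 * p" "b4 * r = 0" "c4 * r = 0"
  shows "classified (graded_product a3 a4 a5 b4 b5 c4 c5 p q r)"
proof -
  have 1: "classified (graded_product 1 0 0 b4 b5 c4 c5 p q r)"
    if eqs: "b4 * q = c4 * p" "b4 * r = 0" "c4 * r = 0" for b4 b5 c4 c5 p q r :: 'a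
  proof -
    consider "b4 = 0" "c4 = 0" | "b4 \<noteq> 0" "r = 0" | "b4 = 0" "c4 \<noteq> 0" "r = 0" "p = 0"
      using eqs by (cases "b4 = 0"; cases "c4 = 0") auto
    then show ?thesis
    proof cases
      case 1 then show ?thesis using classified_tail by simp
    next
      \<comment> \<open>With e2 corrected by - c4 / b4 times e1, the product [e2, e3] loses its e4
        component, and [e1, e3] can be taken as e4. The relation b4 * q = c4 * p then says that the
        new e2 and e4 commute.\<close>
      case 2
      then show ?thesis
        by (intro classified_iso[OF classified_filiform[of "c5 - c4 / b4 * b5" "b4 * p"]]
          graded_product_iso_gradedI[of "vec5 1 0 0 0 0" "vec5 (- c4 / b4) 1 0 0 0" "vec5 0 0 1
              0 0" "vec5 0 0 0 b4 b5" "vec5 0 0 0 0 1"])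
          (use eqs(1) in \<open>auto simp: graded_iso_simps field_simps\<close>)
    next
      case 3
      then show ?thesis
        by (intro classified_iso[OF classified_filiform[of "- b5" "c4 * q"]]
          graded_product_iso_gradedI[of "vec5 0 1 0 0 0" "vec5 (- 1) 0 0 0 0" "vec5 0 0 1 0 0"
              "vec5 0 0 0 c4 c5" "vec5 0 0 0 0 1"])
          (auto simp: graded_iso_simps field_simps)
    qed
  qed
  have "(a3 * b4) * q = (a3 * c4) * p" "(a3 * b4) * (a3 * r) = 0" "(a3 * c4) * (a3 * r) = 0"
    using assms by (auto simp: mult.assoc)
  \<comment> \<open>The product [e1, e2] becomes the third basis vector; its e4 component a4
    contributes the terms a4 * p and a4 * q.\<close>
  from 1[OF this] show ?thesis
    by (rule classified_iso[where A = "graded_product 1 0 0 (a3 * b4) (a3 * b5 + a4 * p) (a3 *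
        c4) (a3 * c5 + a4 * q) p q (a3 * r)"],
        intro graded_product_iso_gradedI[of "vec5 1 0 0 0 0" "vec5 0 1 0 0 0" "vec5 0 0 a3 a4
            a5" "vec5 0 0 0 1 0" "vec5 0 0 0 0 1"])
      (use assms(1) in \<open>auto simp: graded_iso_simps field_simps\<close>)
qed

text \<open>
  Modulo \<open>e\<^sub>5\<close> the products of \<open>e\<^sub>1, e\<^sub>2, e\<^sub>3\<close> are the values of a nonzero skew form on a
  3-dimensional space; its kernel is spanned by the fourth vector of the new basis.
\<close>

lemma classified_a3_zero_a4:
  assumes "a4 \<noteq> 0"
  shows "classified (graded_product 0 a4 a5 b4 b5 c4 c5 p q r)"
proof -
  let ?v = "vec5 (c4 / a4) (- b4 / a4) 1 0 0"
  let ?br = "graded_product 0 a4 a5 b4 b5 c4 c5 p q r"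
  \<comment> \<open>Taking [e1, e2] as third vector and \<open>?v\<close> as fourth leaves every
    other product in the line of e5, as \<open>classified_tail\<close> requires.\<close>
  show ?thesis
    by (rule classified_iso[OF classified_tail[of "a4 * p" "a4 * q" "?br (vec5 1 0 0 0 0) ?v $
        5" "?br (vec5 0 1 0 0 0) ?v $ 5"
            "- a4 * (p * c4 / a4 - q * b4 / a4 + r)"]],
        rule graded_product_iso_gradedI[of "vec5 1 0 0 0 0" "vec5 0 1 0 0 0" "vec5 0 0 0 a4 a5"
            ?v "vec5 0 0 0 0 1"])
      (use assms in \<open>auto simp: graded_iso_simps field_simps\<close>)
qed

text \<open>All products lie in the line of e5, so the algebra is an alternating form on the span of
  e1, ..., e4. As e1 and e2 pair nontrivially, e3 and e4 can be made orthogonal to both. The one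
  value left, [e3, e4], decides between rank 2 and rank 4.\<close>

lemma classified_heisenberg_a:
  assumes "a \<noteq> 0"
  shows "classified (graded_product 0 0 a 0 b 0 c p q r)"
proof -
  have 1: "classified (graded_product 0 0 1 0 0 0 0 0 0 r)" for r :: 'a
  proof (cases "r = 0")
    case True
    then show ?thesis
      by (intro classifiedI[OF graded_product_in_algebras5(2)] graded_product_iso_gradedI[of
          "vec5 1 0 0 0 0" "vec5 0 1 0 0 0" "vec5 0 0 0 0 1" "vec5 0 0 0 1 0" "vec5 0 0 1 0 0"])
        (auto simp: graded_iso_simps field_simps)
  next
    case False
    then show ?thesis
      by (intro classifiedI[OF graded_product_in_algebras5(4)] graded_product_iso_gradedI[of
          "vec5 1 0 0 0 0" "vec5 0 1 0 0 0" "vec5 0 0 1 0 0" "vec5 0 0 0 (1 / r) 0" "vec5 0 0 0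
          0 1"])
        (auto simp: graded_iso_simps field_simps)
  qed
  show ?thesis
    by (rule classified_iso[OF 1[of "(r + c * p / a - b * q / a) / a"]],
        rule graded_product_iso_gradedI[of "vec5 1 0 0 0 0" "vec5 0 1 0 0 0" "vec5 (c / a) (- b
            / a) 1 0 0" "vec5 (q / a) (- p / a) 0 1 0" "vec5 0 0 0 0 a"])
      (use assms in \<open>auto simp: graded_iso_simps field_simps\<close>)
qed

text \<open>A nonzero form has a nonzero value on some pair of basis vectors, which a permutation
  brings to the front. The signs among the new constants come from reversing products.\<close>

lemma classified_heisenberg:
  "classified (graded_product 0 0 a 0 b 0 c p q r)"
proof -
  let ?e1 = "vec5 1 0 0 0 0 :: 'a ^ 5" and ?e2 = "vec5 0 1 0 0 0 :: 'a ^ 5" and ?e3 = "vec5 0 0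
      1 0 0 :: 'a ^ 5"
   and ?e4 = "vec5 0 0 0 1 0 :: 'a ^ 5" and ?e5 = "vec5 0 0 0 0 1 :: 'a ^ 5"
  consider "a \<noteq> 0" | "b \<noteq> 0" | "c \<noteq> 0" | "p \<noteq> 0" | "q \<noteq> 0" | "r \<noteq> 0"
    | "a = 0" "b = 0" "c = 0" "p = 0" "q = 0" "r = 0" by blast
  then show ?thesis
  proof cases
    case 1 then show ?thesis by (rule classified_heisenberg_a)
  next
    case 2 show ?thesis
      by (rule classified_iso[OF classified_heisenberg_a[OF 2, of a "- c" p r q]], rule
          graded_product_iso_gradedI[of ?e1 ?e3 ?e2 ?e4 ?e5])
        (auto simp: graded_iso_simps)
  next
    case 3 show ?thesis
      by (rule classified_iso[OF classified_heisenberg_a[OF 3, of "- a" "- b" q r p]], rule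
          graded_product_iso_gradedI[of ?e2 ?e3 ?e1 ?e4 ?e5])
        (auto simp: graded_iso_simps)
  next
    case 4 show ?thesis
      by (rule classified_iso[OF classified_heisenberg_a[OF 4, of b "- r" a "- q" "- c"]], rule
          graded_product_iso_gradedI[of ?e1 ?e4 ?e3 ?e2 ?e5])
        (auto simp: graded_iso_simps)
  next
    case 5 show ?thesis
      by (rule classified_iso[OF classified_heisenberg_a[OF 5, of c "- r" "- a" "- p" "- b"]],
          rule graded_product_iso_gradedI[of ?e2 ?e4 ?e3 ?e1 ?e5])
        (auto simp: graded_iso_simps)
  next
    case 6 show ?thesis
      by (rule classified_iso[OF classified_heisenberg_a[OF 6, of "- b" "- p" "- c" "- q" a]],
          rule graded_product_iso_gradedI[of ?e3 ?e4 ?e1 ?e2 ?e5])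
        (auto simp: graded_iso_simps)
  next
    case 7 show ?thesis
      unfolding 7 by (rule classifiedI[OF graded_product_in_algebras5(1)], rule
          graded_product_iso_gradedI[of ?e1 ?e2 ?e3 ?e4 ?e5])
        (auto simp: graded_iso_simps)
  qed
qed

text \<open>Permuting e1, e2 and e3 moves a nonzero e4 component of one of their products to
  [e1, e2]. Without such a component, all products are multiples of e5.\<close>

lemma classified_a3_zero: "classified (graded_product 0 a4 a5 b4 b5 c4 c5 p q r)"
proof -
  let ?e1 = "vec5 1 0 0 0 0 :: 'a ^ 5" and ?e2 = "vec5 0 1 0 0 0 :: 'a ^ 5" and ?e3 = "vec5 0 0
      1 0 0 :: 'a ^ 5"
   and ?e4 = "vec5 0 0 0 1 0 :: 'a ^ 5" and ?e5 = "vec5 0 0 0 0 1 :: 'a ^ 5"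
  consider "a4 \<noteq> 0" | "b4 \<noteq> 0" | "c4 \<noteq> 0" | "a4 = 0" "b4 = 0" "c4 = 0" by blast
  then show ?thesis
  proof cases
    case 1 then show ?thesis by (rule classified_a3_zero_a4)
  next
    case 2 show ?thesis
      by (rule classified_iso[OF classified_a3_zero_a4[OF 2, of b5 a4 a5 "- c4" "- c5" p r q]],
          rule graded_product_iso_gradedI[of ?e1 ?e3 ?e2 ?e4 ?e5])
        (auto simp: graded_iso_simps)
  next
    case 3 show ?thesis
      by (rule classified_iso[OF classified_a3_zero_a4[OF 3, of c5 "- a4" "- a5" "- b4" "- b5" q
          r p]], rule graded_product_iso_gradedI[of ?e2 ?e3 ?e1 ?e4 ?e5])
        (auto simp: graded_iso_simps)
  next
    case 4 then show ?thesis using classified_heisenberg by simp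
  qed
qed

lemma binary_lie_classification:
  assumes "binary_lie_algebra s br" "nilpotent_algebra s br" "vector_space.dim s UNIV = 5"
  shows "malcev_algebra s br" "\<exists>A\<in>set algebras5. algebra_isomorphic s br (*s) A"
proof -
  have ac: "anticommutative_algebra s br" using assms(1) by (simp add: binary_lie_algebra_def)
  obtain a3 a4 a5 b4 b5 c4 c5 p q r
    where iso: "algebra_isomorphic (*s) (graded_product a3 a4 a5 b4 b5 c4 c5 p q r) s br"
    using nilpotent_dim5_graded[OF ac assms(2,3)] .
  let ?G = "graded_product a3 a4 a5 b4 b5 c4 c5 p q r"
  have "binary_lie_algebra (*s) ?G"
    using algebra_isomorphic_binary_lie[OF algebra_isomorphic_sym[OF iso] assms(1)
        anticommutative_graded_product] .
  note eqs = binary_lie_graded_productD[OF this]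
  show "malcev_algebra s br"
    by (rule algebra_isomorphic_malcev[OF iso malcev_graded_product[OF eqs] ac])
  have "classified ?G"
  proof (cases "a3 = 0")
    case True then show ?thesis using classified_a3_zero by simp
  next
    case False then show ?thesis using eqs by (intro classified_a3_nonzero) auto
  qed
  then show "\<exists>A\<in>set algebras5. algebra_isomorphic s br (*s) A"
    unfolding classified_def using algebra_isomorphic_sym algebra_isomorphic_trans iso by blast
qed

section \<open>Invariants\<close>

definition ann2 :: "('v::ab_group_add \<Rightarrow> 'v \<Rightarrow> 'v) \<Rightarrow> 'v set"
  where "ann2 br = {x. \<forall>y z. br x (br y z) = 0}"

definition ann3 :: "('v::ab_group_add \<Rightarrow> 'v \<Rightarrow> 'v) \<Rightarrow> 'v set"
  where "ann3 br = {x. \<forall>y z w. br x (br y (br z w)) = 0}"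

definition invariants :: "('f::field ^ 5 \<Rightarrow> 'f ^ 5 \<Rightarrow> 'f ^ 5) \<Rightarrow> nat \<times> nat \<times> nat \<times> bool"
  where "invariants br = (vec.dim (Ann br), vec.dim (ann2 br), vec.dim (ann3 br),
    \<forall>x y z. jacobian br x y z = 0)"

lemma invariants_eq:
  assumes "algebra_isomorphic (*s) br (*s) br'"
  shows "invariants br = invariants br'"
proof -
  from assms obtain \<phi> where lin: "Vector_Spaces.linear (*s) (*s) \<phi>" and bij: "bij \<phi>"
    and hom: "\<And>x y. \<phi> (br x y) = br' (\<phi> x) (\<phi> y)"
    unfolding algebra_isomorphic_def by blast
  interpret Vector_Spaces.linear "(*s)" "(*s)" \<phi> by (rule lin)
  have inj: "inj \<phi>" and surj: "surj \<phi>" using bij by (auto simp: bij_def)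
  have eq0: "\<phi> x = 0 \<longleftrightarrow> x = 0" for x using inj zero by (metis injD)
  \<comment> \<open>By surjectivity a quantifier over the target may be read as one over images,
    which lets the homomorphism property rewrite the defining conditions.\<close>
  have all1: "(\<forall>y. P y) \<longleftrightarrow> (\<forall>y. P (\<phi> y))" for P using surj by (metis surjD)
  have all2: "(\<forall>y z. P y z) \<longleftrightarrow> (\<forall>y z. P (\<phi> y) (\<phi> z))" for P using surj by (metis surjD)
  have all3: "(\<forall>y z w. P y z w) \<longleftrightarrow> (\<forall>y z w. P (\<phi> y) (\<phi> z) (\<phi> w))" for P using surj by (metis surjD)
  have image: "\<phi> ` S = T" if "\<And>x. x \<in> S \<longleftrightarrow> \<phi> x \<in> T" for S T
    using that surj by (auto simp: image_iff) (metis surjD)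
  have dim: "vec.dim (\<phi> ` S) = vec.dim S" for S
    by (rule vec.dim_image_eq[OF lin]) (meson inj inj_on_subset subset_UNIV)
  have "\<phi> ` Ann br = Ann br'"
    by (rule image) (simp add: Ann_def all1[of "\<lambda>y. br' (\<phi> x) y = 0" for x] hom[symmetric] eq0)
  moreover have "\<phi> ` ann2 br = ann2 br'"
    by (rule image) (simp add: ann2_def all2[of "\<lambda>y z. br' (\<phi> x) (br' y z) = 0" for x]
        hom[symmetric] eq0)
  moreover have "\<phi> ` ann3 br = ann3 br'"
    by (rule image)
      (simp add: ann3_def all3[of "\<lambda>y z w. br' (\<phi> x) (br' y (br' z w)) = 0" for x]
          hom[symmetric] eq0)
  moreover have "(\<forall>x y z. jacobian br x y z = 0) \<longleftrightarrow> (\<forall>x y z. jacobian br' x y z = 0)"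
    by (simp add: all3[of "\<lambda>x y z. jacobian br' x y z = 0"]
        jacobian_hom[of _ _ \<phi> br br', OF lin hom, symmetric] eq0)
  ultimately show ?thesis
    using dim[of "Ann br"] dim[of "ann2 br"] dim[of "ann3 br"] by (simp add: invariants_def)
qed

text \<open>In the given bases every annihilator that occurs is spanned by some of the basis
  vectors, so its dimension is a matter of counting indices.\<close>

definition coord_subspace :: "'n set \<Rightarrow> ('f::field ^ 'n::finite) set"
  where "coord_subspace I = {x. \<forall>i. i \<notin> I \<longrightarrow> x $ i = 0}"

lemma dim_coord_subspace: "vec.dim (coord_subspace I) = card I"
  unfolding coord_subspace_def by (rule dim_substandard_cart)

lemma span_coord_subspace: "vec.span (e ` I) = (coord_subspace I :: ('f::field ^ 5) set)"
  (is "?S = ?C")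
proof
  show "?S \<subseteq> ?C"
    by (rule vec.span_minimal) (auto simp: coord_subspace_def e_def axis_def vec.subspace_def)
  show "?C \<subseteq> ?S"
  proof
    fix x :: "'f ^ 5" assume x: "x \<in> ?C"
    have "x = (\<Sum>i\<in>UNIV. x $ i *s axis i 1)" by (rule basis_expansion[symmetric])
    also have "\<dots> = (\<Sum>i\<in>I. x $ i *s e i)"
      using x by (intro sum.mono_neutral_cong_right) (auto simp: e_def coord_subspace_def)
    finally have "x = (\<Sum>i\<in>I. x $ i *s e i)" .
    moreover have "(\<Sum>i\<in>I. x $ i *s e i) \<in> ?S"
      by (intro vec.span_sum vec.span_scale vec.span_base) auto
    ultimately show "x \<in> ?S" by simp
  qed
qed

lemma e_vec5:
  "e 1 = vec5 1 0 0 0 0" "e 2 = vec5 0 1 0 0 0" "e 3 = vec5 0 0 1 0 0" "e 4 = vec5 0 0 0 1 0" "e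
      5 = vec5 0 0 0 0 1"
  by (simp_all add: vec_eq_5 e_def axis_def)

text \<open>The product is linear in its second argument and e5 is central, so four test vectors
  suffice.\<close>

lemma Ann_graded_product:
  assumes G_def: "G = graded_product a3 a4 a5 b4 b5 c4 c5 p q r"
  shows "x \<in> Ann G \<longleftrightarrow> G x (e 1) = 0 \<and> G x (e 2) = 0 \<and> G x (e 3) = 0 \<and> G x (e 4) = 0"
proof -
  have "G x y = y $ 1 *s G x (e 1) + y $ 2 *s G x (e 2) + y $ 3 *s G x (e 3) + y $ 4 *s G x (e
      4)" for y
    unfolding G_def e_vec5 vec_eq_5 graded_product_simps by (simp add: algebra_simps)
  then have "G x y = 0" if "G x (e 1) = 0 \<and> G x (e 2) = 0 \<and> G x (e 3) = 0 \<and> G x (e 4) = 0" for y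
    using that by simp
  then show ?thesis unfolding Ann_def by blast
qed

text \<open>Products with e4 are multiples of the central e5, so only the three products among e1,
  e2, e3 need testing.\<close>

lemma ann2_graded_product:
  assumes G_def: "G = graded_product a3 a4 a5 b4 b5 c4 c5 p q r"
  shows "x \<in> ann2 G \<longleftrightarrow> G x (G (e 1) (e 2)) = 0 \<and> G x (G (e 1) (e 3)) = 0 \<and> G x (G (e 2) (e 3)) = 0"
proof -
  have "G x (G y z) = \<Delta> 1 2 y z *s G x (G (e 1) (e 2)) + \<Delta> 1 3 y z *s G x (G (e 1) (e 3)) +
      \<Delta> 2 3 y z *s G x (G (e 2) (e 3))" for y z
    unfolding G_def e_vec5 vec_eq_5 graded_product_simps by (simp add: algebra_simps)
  then have "G x (G y z) = 0"
    if "G x (G (e 1) (e 2)) = 0 \<and> G x (G (e 1) (e 3)) = 0 \<and> G x (G (e 2) (e 3)) = 0" for y z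
    using that by simp
  then show ?thesis unfolding ann2_def by blast
qed

text \<open>Modulo the central e5, the product [y, [z, w]] depends on z and w only through
  \<open>\<Delta> 1 2 z w\<close> and on y only through its first two coordinates.\<close>

lemma ann3_graded_product:
  assumes G_def: "G = graded_product a3 a4 a5 b4 b5 c4 c5 p q r"
  shows "x \<in> ann3 G \<longleftrightarrow> G x (G (e 1) (G (e 1) (e 2))) = 0 \<and> G x (G (e 2) (G (e 1) (e 2))) = 0"
proof -
  have "G x (G y (G z w)) = (y $ 1 * \<Delta> 1 2 z w) *s G x (G (e 1) (G (e 1) (e 2))) +
      (y $ 2 * \<Delta> 1 2 z w) *s G x (G (e 2) (G (e 1) (e 2)))" for y z w
    unfolding G_def e_vec5 vec_eq_5 graded_product_simps by (simp add: algebra_simps)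
  then have "G x (G y (G z w)) = 0"
    if "G x (G (e 1) (G (e 1) (e 2))) = 0 \<and> G x (G (e 2) (G (e 1) (e 2))) = 0" for y z w
    using that by simp
  then show ?thesis unfolding ann3_def by blast
qed

lemma lie_graded_product:
  "(\<forall>x y z. jacobian (graded_product a3 a4 a5 b4 b5 c4 c5 p q r) x y z = 0) \<longleftrightarrow>
    b4 * q - c4 * p - a4 * r = 0 \<and> a3 * r = 0" (is "?L \<longleftrightarrow> ?R")
proof
  assume L: ?L
  from L[rule_format, of "e 1" "e 2" "e 3"] L[rule_format, of "e 1" "e 2" "e 4"] show ?R
    unfolding jacobian_graded_product e_vec5 vec_eq_5 graded_product_simps by simp
qed (unfold jacobian_graded_product, simp add: vec_eq_5)

lemmas coord_simps = set_eq_iff Ann_graded_product[OF refl]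
  ann2_graded_product[OF refl] ann3_graded_product[OF refl]
  coord_subspace_def forall_5 e_vec5 vec_eq_5 graded_product_simps

lemma Ann_algebras5:
  "Ann L5_1 = coord_subspace UNIV" "Ann L5_2 = coord_subspace {3, 4, 5}" "Ann L5_3 =
      coord_subspace {4, 5}"
  "Ann L5_4 = coord_subspace {5}" "Ann L5_5 = coord_subspace {5}" "Ann L5_6 = coord_subspace {5}"
  "Ann L5_7 = coord_subspace {5}" "Ann L5_8 = coord_subspace {4, 5}" "Ann L5_9 = coord_subspace
      {4, 5}"
  "Ann M5_1 = coord_subspace {5}"
  unfolding algebras5_graded by (auto simp: coord_simps)

lemma ann2_algebras5:
  "ann2 L5_1 = coord_subspace UNIV" "ann2 L5_2 = coord_subspace UNIV" "ann2 L5_3 =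
      coord_subspace {2, 3, 4, 5}"
  "ann2 L5_4 = coord_subspace UNIV" "ann2 L5_5 = coord_subspace {2, 3, 4, 5}" "ann2 L5_6 =
      coord_subspace {3, 4, 5}"
  "ann2 L5_7 = coord_subspace {2, 3, 4, 5}" "ann2 L5_8 = coord_subspace UNIV" "ann2 L5_9 =
      coord_subspace {3, 4, 5}"
  "ann2 M5_1 = coord_subspace {1, 2, 3, 5}"
  unfolding algebras5_graded by (auto simp: coord_simps)

lemma ann3_algebras5:
  "ann3 L5_1 = coord_subspace UNIV" "ann3 L5_2 = coord_subspace UNIV" "ann3 L5_3 =
      coord_subspace UNIV"
  "ann3 L5_4 = coord_subspace UNIV" "ann3 L5_5 = coord_subspace UNIV" "ann3 L5_6 =
      coord_subspace {2, 3, 4, 5}"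
  "ann3 L5_7 = coord_subspace {2, 3, 4, 5}" "ann3 L5_8 = coord_subspace UNIV" "ann3 L5_9 =
      coord_subspace UNIV"
  "ann3 M5_1 = coord_subspace UNIV"
  unfolding algebras5_graded by (auto simp: coord_simps)

text \<open>The first two dimensions leave only L5_5, L5_7 and M5_1 together, at (1, 4). The third
  dimension singles out L5_7, and the Jacobi identity singles out M5_1.\<close>

lemma invariants_algebras5:
  "map invariants algebras5 = [(5, 5, 5, True), (3, 5, 5, True), (2, 4, 5, True), (1, 5, 5,
      True), (1, 4, 5, True),
    (1, 3, 4, True), (1, 4, 4, True), (2, 5, 5, True), (2, 3, 5, True), (1, 4, 5, False)]"
  unfolding algebras5_def list.map invariants_def Ann_algebras5 ann2_algebras5 ann3_algebras5
      dim_coord_subspace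
  unfolding algebras5_graded lie_graded_product by simp

lemma algebras5_nonisomorphic:
  assumes "i < length (algebras5 :: ('f::field ^ 5 \<Rightarrow> 'f ^ 5 \<Rightarrow> 'f ^ 5) list)" "j < length
      (algebras5 :: ('f ^ 5 \<Rightarrow> 'f ^ 5 \<Rightarrow> 'f ^ 5) list)" "i \<noteq> j"
  shows "\<not> algebra_isomorphic (*s) ((algebras5 :: ('f ^ 5 \<Rightarrow> 'f ^ 5 \<Rightarrow> 'f ^ 5) list) ! i) (*s)
      (algebras5 ! j)"
proof
  let ?A = "algebras5 :: ('f ^ 5 \<Rightarrow> 'f ^ 5 \<Rightarrow> 'f ^ 5) list"
  assume "algebra_isomorphic (*s) (?A ! i) (*s) (?A ! j)"
  then have "map invariants ?A ! i = map invariants ?A ! j" using assms invariants_eq by simp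
  moreover have "distinct (map invariants ?A)" unfolding invariants_algebras5 by simp
  ultimately show False using assms nth_eq_iff_index_eq[of "map invariants ?A" i j] by simp
qed

lemma algebras5_nilpotent_malcev:
  assumes "A \<in> set algebras5"
  shows "binary_lie_algebra (*s) A" "nilpotent_algebra (*s) A" "malcev_algebra (*s) A"
  using assms unfolding algebras5_def algebras5_graded
  by (auto intro: nilpotent_graded_product binary_lie_graded_product malcev_graded_product)

section \<open>Quotients of spaces of forms\<close>

definition form_subspace :: "('v \<Rightarrow> 'v \<Rightarrow> 'f::field) set \<Rightarrow> bool"
  where "form_subspace B \<longleftrightarrow> 0 \<in> B \<and> (\<forall>\<theta>\<in>B. \<forall>\<eta>\<in>B. \<theta> + \<eta> \<in> B) \<and> (\<forall>c. \<forall>\<theta>\<in>B. (\<lambda>x y. c * \<theta> x y) \<in> B)"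

lemma form_subspaceD:
  assumes "form_subspace B"
  shows "0 \<in> B" "\<theta> \<in> B \<Longrightarrow> \<eta> \<in> B \<Longrightarrow> \<theta> + \<eta> \<in> B" "\<theta> \<in> B \<Longrightarrow> (\<lambda>x y. c * \<theta> x y) \<in> B"
    "\<theta> \<in> B \<Longrightarrow> - \<theta> \<in> B" "\<theta> \<in> B \<Longrightarrow> \<eta> \<in> B \<Longrightarrow> \<theta> - \<eta> \<in> B"
proof -
  show 1: "0 \<in> B" "\<theta> \<in> B \<Longrightarrow> \<eta> \<in> B \<Longrightarrow> \<theta> + \<eta> \<in> B" "\<theta> \<in> B \<Longrightarrow> (\<lambda>x y. c * \<theta> x y) \<in> B" for \<theta> \<eta> c
    using assms by (auto simp: form_subspace_def)
  have "- \<theta> = (\<lambda>x y. - 1 * \<theta> x y)" for \<theta> :: "'a \<Rightarrow> 'a \<Rightarrow> 'b" by (simp add: fun_eq_iff)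
  then show 2: "\<theta> \<in> B \<Longrightarrow> - \<theta> \<in> B" for \<theta> using 1(3)[of \<theta> "- 1"] by simp
  show "\<theta> \<in> B \<Longrightarrow> \<eta> \<in> B \<Longrightarrow> \<theta> - \<eta> \<in> B" using 1(2)[of \<theta> "- \<eta>"] 2[of \<eta>] by simp
qed

lemma form_subspace_plus: "form_subspace B \<Longrightarrow> B + B = B"
  using form_subspaceD(1)[THEN set_zero_plus2, of B B] form_subspaceD(2)[of B]
  by (auto elim!: set_plus_elim)

lemma coset_eq_iff:
  assumes "form_subspace B"
  shows "\<theta> +o B = \<eta> +o B \<longleftrightarrow> \<theta> - \<eta> \<in> B"
proof
  assume "\<theta> +o B = \<eta> +o B"
  then show "\<theta> - \<eta> \<in> B"
    using form_subspaceD(1)[OF assms] set_plus_intro2[of 0 B \<theta>] set_plus_imp_minus[of \<theta> \<eta> B] by simp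
next
  assume d: "\<theta> - \<eta> \<in> B"
  have "\<theta> +o B = \<eta> +o ((\<theta> - \<eta>) +o B)" by (simp add: set_plus_rearrange2)
  also have "(\<theta> - \<eta>) +o B = B"
  proof
    show "(\<theta> - \<eta>) +o B \<subseteq> B" using form_subspaceD(2)[OF assms d] by (auto simp: elt_set_plus_def)
    show "B \<subseteq> (\<theta> - \<eta>) +o B"
      using form_subspaceD(5)[OF assms _ d] by (auto intro!: set_minus_imp_plus)
  qed
  finally show "\<theta> +o B = \<eta> +o B" .
qed

lemma coset_eq_subspace_iff:
  assumes "form_subspace B" shows "\<theta> +o B = B \<longleftrightarrow> \<theta> \<in> B"
  using coset_eq_iff[OF assms, of \<theta> 0] by simp

lemma coset_plus:
  assumes "form_subspace B"
  shows "(\<theta> +o B) + (\<eta> +o B) = (\<theta> + \<eta>) +o B" "(\<theta> +o B) + B = \<theta> +o B"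
  by (metis set_plus_rearrange set_plus_rearrange3 form_subspace_plus[OF assms])+

lemma qscale_coset:
  assumes B: "form_subspace B"
  shows "qscale B c (\<theta> +o B) = (\<lambda>x y. c * \<theta> x y) +o B"
proof
  have d: "(\<lambda>x y. c * (\<theta> + b) x y) = (\<lambda>x y. c * \<theta> x y) + (\<lambda>x y. c * b x y)" for b
    by (simp add: fun_eq_iff algebra_simps)
  show "qscale B c (\<theta> +o B) \<subseteq> (\<lambda>x y. c * \<theta> x y) +o B"
  proof
    fix \<eta> assume "\<eta> \<in> qscale B c (\<theta> +o B)"
    then obtain b b' where b: "b \<in> B" "b' \<in> B" and \<eta>: "\<eta> = (\<lambda>x y. c * (\<theta> + b) x y) + b'"
      by (auto simp: qscale_def set_plus_def elt_set_plus_def)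
    have "\<eta> = (\<lambda>x y. c * \<theta> x y) + ((\<lambda>x y. c * b x y) + b')" unfolding \<eta> d by (simp add: add.assoc)
    then show "\<eta> \<in> (\<lambda>x y. c * \<theta> x y) +o B"
      using form_subspaceD(2)[OF B form_subspaceD(3)[OF B b(1)] b(2)] by (auto simp:
          elt_set_plus_def)
  qed
  have "\<theta> \<in> \<theta> +o B" using form_subspaceD(1)[OF B] set_plus_intro2[of 0 B \<theta>] by simp
  then show "(\<lambda>x y. c * \<theta> x y) +o B \<subseteq> qscale B c (\<theta> +o B)"
    unfolding qscale_def by (intro set_plus_mono3) auto
qed

definition lincomb :: "'f::field list \<Rightarrow> ('v \<Rightarrow> 'v \<Rightarrow> 'f) list \<Rightarrow> 'v \<Rightarrow> 'v \<Rightarrow> 'f"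
  where "lincomb cs \<theta>s = sum_list (map2 (\<lambda>c \<theta> x y. c * \<theta> x y) cs \<theta>s)"

lemma lincomb_simps [simp]:
  "lincomb [] \<theta>s = 0" "lincomb (c # cs) (\<theta> # \<theta>s) = (\<lambda>x y. c * \<theta> x y) + lincomb cs \<theta>s"
  by (simp_all add: lincomb_def)

text \<open>The passage from cosets to representatives: from here on, spans and independence in the
  quotient are questions about \<open>lincomb\<close> of forms modulo membership in B.\<close>

lemma qlincomb_cosets:
  assumes B: "form_subspace B" and "length cs = length \<theta>s"
  shows "qlincomb B cs (map (\<lambda>\<theta>. \<theta> +o B) \<theta>s) = lincomb cs \<theta>s +o B"
  using assms(2)
proof (induction cs \<theta>s rule: list_induct2)
  case Nil
  show ?case unfolding lincomb_simps set_zero_plus by (simp add: qlincomb_def)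
next
  case (Cons c cs \<theta> \<theta>s)
  have "qlincomb B (c # cs) (map (\<lambda>\<theta>. \<theta> +o B) (\<theta> # \<theta>s)) =
      qscale B c (\<theta> +o B) + qlincomb B cs (map (\<lambda>\<theta>. \<theta> +o B) \<theta>s)"
    by (simp add: qlincomb_def add.assoc)
  then show ?case unfolding Cons.IH qscale_coset[OF B] coset_plus[OF B] lincomb_simps .
qed

lemma qspan_cosets:
  assumes "form_subspace B"
  shows "qspan B (map (\<lambda>\<theta>. \<theta> +o B) \<theta>s) = {lincomb cs \<theta>s +o B | cs. length cs = length \<theta>s}"
  by (simp add: qspan_def qlincomb_cosets[OF assms] cong: rev_conj_cong)

lemma qindependent_cosets:
  assumes "form_subspace B"
  shows "qindependent B (map (\<lambda>\<theta>. \<theta> +o B) \<theta>s) \<longleftrightarrow>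
    (\<forall>cs. length cs = length \<theta>s \<longrightarrow> lincomb cs \<theta>s \<in> B \<longrightarrow> (\<forall>c\<in>set cs. c = 0))"
  by (simp add: qindependent_def qlincomb_cosets[OF assms] coset_eq_subspace_iff[OF assms] cong:
      imp_cong)

lemma qbasisI:
  assumes B: "form_subspace B" and "set \<theta>s \<subseteq> Z"
    and "\<And>cs. length cs = length \<theta>s \<Longrightarrow> lincomb cs \<theta>s \<in> Z"
    and "\<And>cs. length cs = length \<theta>s \<Longrightarrow> lincomb cs \<theta>s \<in> B \<Longrightarrow> \<forall>c\<in>set cs. c = 0"
    and "\<And>\<theta>. \<theta> \<in> Z \<Longrightarrow> \<exists>cs. length cs = length \<theta>s \<and> \<theta> - lincomb cs \<theta>s \<in> B"
  shows "qbasis B ((\<lambda>\<theta>. \<theta> +o B) ` Z) (map (\<lambda>\<theta>. \<theta> +o B) \<theta>s)"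
  unfolding qbasis_def qspan_cosets[OF B] qindependent_cosets[OF B]
proof (intro conjI allI impI)
  show "(\<lambda>\<theta>. \<theta> +o B) ` Z = {lincomb cs \<theta>s +o B | cs. length cs = length \<theta>s}"
  proof
    show "(\<lambda>\<theta>. \<theta> +o B) ` Z \<subseteq> {lincomb cs \<theta>s +o B | cs. length cs = length \<theta>s}"
    proof
      fix X assume "X \<in> (\<lambda>\<theta>. \<theta> +o B) ` Z"
      then obtain \<theta> where "\<theta> \<in> Z" "X = \<theta> +o B" by blast
      moreover from assms(5)[OF this(1)] obtain cs where "length cs = length \<theta>s" "\<theta> - lincomb cs
          \<theta>s \<in> B" by blast
      ultimately show "X \<in> {lincomb cs \<theta>s +o B | cs. length cs = length \<theta>s}"
        using coset_eq_iff[OF B] by blast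
    qed
    show "{lincomb cs \<theta>s +o B | cs. length cs = length \<theta>s} \<subseteq> (\<lambda>\<theta>. \<theta> +o B) ` Z"
      using assms(3) by auto
  qed
qed (use assms(2,4) in auto)

lemma ex_length_1: "(\<exists>cs. P cs \<and> length cs = Suc 0) \<longleftrightarrow> (\<exists>c. P [c])"
  by (auto simp: length_Suc_conv)

text \<open>The assumption \<open>ind\<close> says that no nonzero multiple of \<eta> lies in Z. As
  B is contained in Z, this yields both the independence of the class of \<eta> and the trivial
  intersection of the two summands.\<close>

lemma qdirect_sumI:
  assumes B: "form_subspace B" and Z: "form_subspace Z" and BZ: "B \<subseteq> Z"
    and ind: "\<And>c. (\<lambda>x y. c * \<eta> x y) \<in> Z \<Longrightarrow> c = 0"
    and Z': "Z' = {\<theta> + (\<lambda>x y. c * \<eta> x y) | \<theta> c. \<theta> \<in> Z}"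
  shows "qindependent B [\<eta> +o B]"
    "qdirect_sum B ((\<lambda>\<theta>. \<theta> +o B) ` Z') ((\<lambda>\<theta>. \<theta> +o B) ` Z) (qspan B [\<eta> +o B])"
proof -
  have "{lincomb cs [\<eta>] +o B | cs. length cs = length [\<eta>]} = {(\<lambda>x y. c * \<eta> x y) +o B | c. True}"
    by (simp add: ex_length_1)
  then have span: "qspan B [\<eta> +o B] = {(\<lambda>x y. c * \<eta> x y) +o B | c. True}"
    using qspan_cosets[OF B, of "[\<eta>]"] by simp
  show "qindependent B [\<eta> +o B]"
    using qindependent_cosets[OF B, of "[\<eta>]"] ind BZ by (auto simp: length_Suc_conv)
  have "(\<lambda>\<theta>. \<theta> +o B) ` Z' = {X + Y | X Y. X \<in> (\<lambda>\<theta>. \<theta> +o B) ` Z \<and> Y \<in> qspan B [\<eta> +o B]}"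
    (is "?L = ?R")
  proof
    show "?L \<subseteq> ?R"
    proof
      fix X assume "X \<in> ?L"
      then obtain \<theta> c where "\<theta> \<in> Z" "X = (\<theta> +o B) + ((\<lambda>x y. c * \<eta> x y) +o B)"
        unfolding Z' coset_plus(1)[OF B] by blast
      then show "X \<in> ?R" unfolding span by blast
    qed
    show "?R \<subseteq> ?L"
    proof
      fix X assume "X \<in> ?R"
      then obtain \<theta> c where "\<theta> \<in> Z" "X = (\<theta> +o B) + ((\<lambda>x y. c * \<eta> x y) +o B)"
        unfolding span by blast
      then show "X \<in> ?L" unfolding Z' coset_plus(1)[OF B] by blast
    qed
  qed
  moreover have "(\<lambda>\<theta>. \<theta> +o B) ` Z \<inter> qspan B [\<eta> +o B] = {B}"
  proof
    show "(\<lambda>\<theta>. \<theta> +o B) ` Z \<inter> qspan B [\<eta> +o B] \<subseteq> {B}"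
    proof
      fix X assume "X \<in> (\<lambda>\<theta>. \<theta> +o B) ` Z \<inter> qspan B [\<eta> +o B]"
      then obtain \<theta> c where X: "\<theta> \<in> Z" "X = \<theta> +o B" "X = (\<lambda>x y. c * \<eta> x y) +o B"
        unfolding span by auto
      \<comment> \<open>Two representatives of one coset differ by an element of B, hence of Z,
        which forces the multiple of \<eta> itself into Z.\<close>
      then have "(\<lambda>x y. c * \<eta> x y) - \<theta> \<in> Z" using coset_eq_iff[OF B] BZ by blast
      from form_subspaceD(2)[OF Z this X(1)] have "(\<lambda>x y. c * \<eta> x y) \<in> Z" by simp
      then have "c = 0" by (rule ind)
      then have "X = 0 +o B" using X(3) by (simp add: zero_fun_def)
      then show "X \<in> {B}" by simp
    qed
    have "B = 0 +o B" "(\<lambda>x y. 0 * \<eta> x y) +o B = B" by (simp_all add: zero_fun_def[symmetric])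
    then show "{B} \<subseteq> (\<lambda>\<theta>. \<theta> +o B) ` Z \<inter> qspan B [\<eta> +o B]"
      unfolding span using form_subspaceD(1)[OF Z] by blast
  qed
  ultimately show "qdirect_sum B ((\<lambda>\<theta>. \<theta> +o B) ` Z') ((\<lambda>\<theta>. \<theta> +o B) ` Z) (qspan B [\<eta> +o B])"
    unfolding qdirect_sum_def by blast
qed

lemma bilinear_map_form_iff:
  "bilinear_map s (*) \<theta> \<longleftrightarrow> vector_space s \<and> (\<forall>x y z. \<theta> (x + y) z = \<theta> x z + \<theta> y z) \<and>
    (\<forall>x y z. \<theta> x (y + z) = \<theta> x y + \<theta> x z) \<and> (\<forall>c x y. \<theta> (s c x) y = c * \<theta> x y) \<and>
    (\<forall>c x y. \<theta> x (s c y) = c * \<theta> x y)" (is "?L \<longleftrightarrow> ?R")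
proof
  assume L: ?L
  then have "vector_space s"
    by (auto simp: bilinear_map_def Vector_Spaces.linear_def)
  then show ?R using bilinear_mapD(1-4)[OF L] by simp
next
  assume R: ?R
  then interpret vector_space s by simp
  show ?L unfolding bilinear_map_def
    by (intro conjI allI Vector_Spaces.linear.intro module_hom.intro module_hom_axioms.intro
        vector_space_axioms module_axioms vector_space_over_itself.vector_space_axioms
        vector_space_over_itself.module_axioms) (use R in auto)
qed

lemma form_subspace_Z2_BL:
  assumes "vector_space s" shows "form_subspace (Z2_BL s br)"
  unfolding form_subspace_def
proof (intro conjI ballI allI)
  show "0 \<in> Z2_BL s br" using assms by (simp add: Z2_BL_def bilinear_map_form_iff)
  fix \<theta> assume "\<theta> \<in> Z2_BL s br"
  then have \<theta>: "bilinear_map s (*) \<theta>" "\<And>x y. \<theta> x y = - \<theta> y x"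
    "\<And>x y. \<theta> (br (br x y) x) y = \<theta> (br (br x y) y) x" unfolding Z2_BL_def by blast+
  have "c * \<theta> x y = - (c * \<theta> y x)" for c x y using \<theta>(2)[of x y] by simp
  moreover have "bilinear_map s (*) (\<lambda>x y. c * \<theta> x y)" for c
    using \<theta>(1) unfolding bilinear_map_form_iff by (simp add: algebra_simps)
  moreover have "c * \<theta> (br (br x y) x) y = c * \<theta> (br (br x y) y) x" for c x y
    using \<theta>(3)[of x y] by simp
  ultimately show "(\<lambda>x y. c * \<theta> x y) \<in> Z2_BL s br" for c
    unfolding Z2_BL_def mem_Collect_eq by blast
  fix \<eta> assume "\<eta> \<in> Z2_BL s br"
  then have \<eta>: "bilinear_map s (*) \<eta>" "\<And>x y. \<eta> x y = - \<eta> y x"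
    "\<And>x y. \<eta> (br (br x y) x) y = \<eta> (br (br x y) y) x" unfolding Z2_BL_def by blast+
  have "bilinear_map s (*) (\<theta> + \<eta>)"
    using \<theta>(1) \<eta>(1) unfolding bilinear_map_form_iff by (simp add: algebra_simps)
  moreover have "(\<theta> + \<eta>) x y = - ((\<theta> + \<eta>) y x)" for x y using \<theta>(2)[of x y] \<eta>(2)[of x y] by simp
  moreover have "(\<theta> + \<eta>) (br (br x y) x) y = (\<theta> + \<eta>) (br (br x y) y) x" for x y
    using \<theta>(3)[of x y] \<eta>(3)[of x y] by simp
  ultimately show "\<theta> + \<eta> \<in> Z2_BL s br"
    unfolding Z2_BL_def mem_Collect_eq by blast
qed

lemma form_subspace_Z2_M:
  assumes "vector_space s" shows "form_subspace (Z2_M s br)"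
  unfolding form_subspace_def
proof (intro conjI ballI allI)
  note Z = form_subspaceD(1-3)[OF form_subspace_Z2_BL[OF assms, of br]]
  show "0 \<in> Z2_M s br" using Z(1) by (simp add: Z2_M_def)
  fix \<theta> assume \<theta>: "\<theta> \<in> Z2_M s br"
  then show "(\<lambda>x y. c * \<theta> x y) \<in> Z2_M s br" for c
    using Z(3)[of \<theta> c] by (simp add: Z2_M_def distrib_left)
  fix \<eta> assume "\<eta> \<in> Z2_M s br"
  with \<theta> show "\<theta> + \<eta> \<in> Z2_M s br"
    using Z(2)[of \<theta> \<eta>] by (simp add: Z2_M_def ac_simps)
qed

lemma form_subspace_B2:
  assumes "vector_space s" shows "form_subspace (B2 s br)"
proof -
  interpret vector_space_pair s "(*) :: 'a \<Rightarrow> 'a \<Rightarrow> 'a"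
    by (intro vector_space_pair.intro assms vector_space_over_itself.vector_space_axioms)
  show ?thesis unfolding form_subspace_def B2_def
  proof (intro conjI ballI allI)
    show "0 \<in> {\<lambda>x y. f (br x y) |f. Vector_Spaces.linear s (*) f}"
      using linear_zero by (fastforce simp: zero_fun_def)
    show "\<theta> + \<eta> \<in> {\<lambda>x y. f (br x y) |f. Vector_Spaces.linear s (*) f}"
      if "\<theta> \<in> {\<lambda>x y. f (br x y) |f. Vector_Spaces.linear s (*) f}"
        "\<eta> \<in> {\<lambda>x y. f (br x y) |f. Vector_Spaces.linear s (*) f}" for \<theta> \<eta>
    proof -
      from that obtain f g where "Vector_Spaces.linear s (*) f" "Vector_Spaces.linear s (*) g"
        "\<theta> = (\<lambda>x y. f (br x y))" "\<eta> = (\<lambda>x y. g (br x y))" by blast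
      then show ?thesis using linear_compose_add[of f g]
        by (intro CollectI exI[of _ "\<lambda>x. f x + g x"]) (simp add: fun_eq_iff)
    qed
    show "(\<lambda>x y. c * \<theta> x y) \<in> {\<lambda>x y. f (br x y) |f. Vector_Spaces.linear s (*) f}"
      if "\<theta> \<in> {\<lambda>x y. f (br x y) |f. Vector_Spaces.linear s (*) f}" for \<theta> c
    proof -
      from that obtain f where "Vector_Spaces.linear s (*) f" "\<theta> = (\<lambda>x y. f (br x y))" by blast
      then show ?thesis using linear_compose_scale_right[of f c]
        by (intro CollectI exI[of _ "\<lambda>x. c * f x"]) simp
    qed
  qed
qed

section \<open>Cocycles of the ten algebras\<close>

definition skew_form :: "'f::field \<Rightarrow> 'f \<Rightarrow> 'f \<Rightarrow> 'f \<Rightarrow> 'f \<Rightarrow> 'f \<Rightarrow> 'f \<Rightarrow> 'f \<Rightarrow> 'f \<Rightarrow> 'f \<Rightarrow> 'f ^ 5 \<Rightarrow> 'f ^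
    5 \<Rightarrow> 'f"
  where "skew_form t12 t13 t14 t15 t23 t24 t25 t34 t35 t45 x y =
    t12 * \<Delta> 1 2 x y + t13 * \<Delta> 1 3 x y + t14 * \<Delta> 1 4 x y + t15 * \<Delta> 1 5 x y + t23 * \<Delta> 2 3 x y
    + t24 * \<Delta> 2 4 x y + t25 * \<Delta> 2 5 x y + t34 * \<Delta> 3 4 x y + t35 * \<Delta> 3 5 x y + t45 * \<Delta> 4 5 x y"

lemma skew_form_eq_iff:
  "skew_form t12 t13 t14 t15 t23 t24 t25 t34 t35 t45 = skew_form u12 u13 u14 u15 u23 u24 u25 u34
      u35 u45 \<longleftrightarrow>
    t12 = u12 \<and> t13 = u13 \<and> t14 = u14 \<and> t15 = u15 \<and> t23 = u23 \<and> t24 = u24 \<and> t25 = u25 \<and> t34 = u34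
    \<and> t35 = u35 \<and> t45 = u45" (is "?f = ?g \<longleftrightarrow> ?R")
proof
  assume "?f = ?g"
  then have "?f (e i) (e j) = ?g (e i) (e j)" for i j by simp
  from this[of 1 2] this[of 1 3] this[of 1 4] this[of 1 5] this[of 2 3] this[of 2 4] this[of 2
      5] this[of 3 4]
    this[of 3 5] this[of 4 5]
  show ?R by (simp add: skew_form_def \<Delta>_def e_vec5)
qed simp

lemma skew_form_arith:
  "skew_form t12 t13 t14 t15 t23 t24 t25 t34 t35 t45 + skew_form u12 u13 u14 u15 u23 u24 u25 u34
      u35 u45 =
    skew_form (t12 + u12) (t13 + u13) (t14 + u14) (t15 + u15) (t23 + u23) (t24 + u24) (t25 +
        u25) (t34 + u34)
      (t35 + u35) (t45 + u45)"
  "skew_form t12 t13 t14 t15 t23 t24 t25 t34 t35 t45 - skew_form u12 u13 u14 u15 u23 u24 u25 u34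
      u35 u45 =
    skew_form (t12 - u12) (t13 - u13) (t14 - u14) (t15 - u15) (t23 - u23) (t24 - u24) (t25 -
        u25) (t34 - u34)
      (t35 - u35) (t45 - u45)"
  "(\<lambda>x y. c * skew_form t12 t13 t14 t15 t23 t24 t25 t34 t35 t45 x y) =
    skew_form (c * t12) (c * t13) (c * t14) (c * t15) (c * t23) (c * t24) (c * t25) (c * t34) (c
        * t35) (c * t45)"
  "0 = skew_form 0 0 0 0 0 0 0 0 0 0"
  by (simp_all add: fun_eq_iff skew_form_def algebra_simps)

lemma \<Delta>_skew_form:
  "\<Delta> 1 2 = skew_form 1 0 0 0 0 0 0 0 0 0" "\<Delta> 1 3 = skew_form 0 1 0 0 0 0 0 0 0 0"
  "\<Delta> 1 4 = skew_form 0 0 1 0 0 0 0 0 0 0" "\<Delta> 1 5 = skew_form 0 0 0 1 0 0 0 0 0 0"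
  "\<Delta> 2 3 = skew_form 0 0 0 0 1 0 0 0 0 0" "\<Delta> 2 4 = skew_form 0 0 0 0 0 1 0 0 0 0"
  "\<Delta> 2 5 = skew_form 0 0 0 0 0 0 1 0 0 0" "\<Delta> 3 4 = skew_form 0 0 0 0 0 0 0 1 0 0"
  "\<Delta> 3 5 = skew_form 0 0 0 0 0 0 0 0 1 0" "\<Delta> 4 5 = skew_form 0 0 0 0 0 0 0 0 0 1"
  by (simp_all add: fun_eq_iff skew_form_def)

lemma bilinear_map_skew_form: "bilinear_map (*s) (*) (skew_form t12 t13 t14 t15 t23 t24 t25 t34
    t35 t45)"
  unfolding bilinear_map_form_iff
  by (simp add: vec.vector_space_axioms skew_form_def \<Delta>_def algebra_simps)

lemma skew_form_swap: "skew_form t12 t13 t14 t15 t23 t24 t25 t34 t35 t45 x y =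
    - skew_form t12 t13 t14 t15 t23 t24 t25 t34 t35 t45 y x"
  by (simp add: skew_form_def \<Delta>_def algebra_simps)

lemma vec5_expand: "x = x $ 1 *s e 1 + x $ 2 *s e 2 + x $ 3 *s e 3 + x $ 4 *s e 4 + x $ 5 *s e 5"
  by (simp add: vec_eq_5 e_vec5)

lemma skew_form_exhaust:
  fixes \<theta> :: "'f::field ^ 5 \<Rightarrow> 'f ^ 5 \<Rightarrow> 'f"
  assumes "(2 :: 'f) \<noteq> 0" and b: "bilinear_map (*s) (*) \<theta>" and skew: "\<And>x y. \<theta> x y = - \<theta> y x"
  obtains t12 t13 t14 t15 t23 t24 t25 t34 t35 t45
  where "\<theta> = skew_form t12 t13 t14 t15 t23 t24 t25 t34 t35 t45"
proof -
  \<comment> \<open>The characteristic enters here: skew-symmetry alone gives only 2 * \<theta> x x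
    = 0, while every combination of the \<open>\<Delta> i j\<close> vanishes on the
    diagonal.\<close>
  have z: "\<theta> x x = 0" for x
  proof -
    have "2 * \<theta> x x = 0" using skew[of x x] by (simp only: mult_2) (metis add.right_inverse)
    then show ?thesis using assms(1) by simp
  qed
  note sw = skew[of "e 2" "e 1"] skew[of "e 3" "e 1"] skew[of "e 4" "e 1"] skew[of "e 5" "e 1"]
      skew[of "e 3" "e 2"]
    skew[of "e 4" "e 2"] skew[of "e 5" "e 2"] skew[of "e 4" "e 3"] skew[of "e 5" "e 3"] skew[of
        "e 5" "e 4"]
  have "\<theta> x y = skew_form (\<theta> (e 1) (e 2)) (\<theta> (e 1) (e 3)) (\<theta> (e 1) (e 4)) (\<theta> (e 1) (e 5)) (\<theta> (e
      2) (e 3))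
    (\<theta> (e 2) (e 4)) (\<theta> (e 2) (e 5)) (\<theta> (e 3) (e 4)) (\<theta> (e 3) (e 5)) (\<theta> (e 4) (e 5)) x y" for x y
    apply (subst vec5_expand[of x], subst vec5_expand[of y])
    unfolding bilinear_mapD(1-4)[OF b] sw z skew_form_def \<Delta>_def
    by (simp add: algebra_simps)
  then show ?thesis using that by blast
qed

section \<open>Coboundaries in coordinates\<close>

lemma linear_vec5: "Vector_Spaces.linear (*s) (*) f \<longleftrightarrow>
   (\<exists>f1 f2 f3 f4 f5. \<forall>x. f (x :: 'f::field ^ 5) = f1 * x $ 1 + f2 * x $ 2 + f3 * x $ 3 + f4 * x
       $ 4 + f5 * x $ 5)"
   (is "?L \<longleftrightarrow> ?R")
proof
  assume ?L
  then interpret Vector_Spaces.linear "(*s)" "(*)" f .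
  have "f x = f (e 1) * x $ 1 + f (e 2) * x $ 2 + f (e 3) * x $ 3 + f (e 4) * x $ 4 + f (e 5) *
      x $ 5" for x
    by (subst vec5_expand[of x]) (simp add: add scale)
  then show ?R by blast
next
  assume ?R
  then obtain f1 f2 f3 f4 f5 where "f = (\<lambda>x. f1 * x $ 1 + f2 * x $ 2 + f3 * x $ 3 + f4 * x $ 4 +
      f5 * x $ 5)" by blast
  then show ?L
    by (auto intro!: Vector_Spaces.linear.intro module_hom.intro module_hom_axioms.intro
        vec.vector_space_axioms vec.module_axioms vector_space_over_itself.vector_space_axioms
        vector_space_over_itself.module_axioms simp: algebra_simps)
qed

text \<open>The coefficient of \<open>\<Delta> i j\<close> in the coboundary of f is f([e_i, e_j]).
  Products have no components along e1 and e2, so only three coefficients of f survive.\<close>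

lemma B2_graded_product:
  "B2 (*s) (graded_product a3 a4 a5 b4 b5 c4 c5 p q r) =
    {skew_form (f3 * a3 + f4 * a4 + f5 * a5) (f4 * b4 + f5 * b5) (f5 * p) 0 (f4 * c4 + f5 * c5)
        (f5 * q) 0 (f5 * r) 0 0
     | f3 f4 f5. True}"
proof -
  have "(\<lambda>x y. f1 * G x y $ 1 + f2 * G x y $ 2 + f3 * G x y $ 3 + f4 * G x y $ 4 + f5 * G x y $ 5) =
    skew_form (f3 * a3 + f4 * a4 + f5 * a5) (f4 * b4 + f5 * b5) (f5 * p) 0 (f4 * c4 + f5 * c5)
        (f5 * q) 0 (f5 * r) 0 0"
    if "G = graded_product a3 a4 a5 b4 b5 c4 c5 p q r" for f1 f2 f3 f4 f5 G
    unfolding that by (simp add: fun_eq_iff skew_form_def graded_product_def algebra_simps)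
  note * = this[OF refl]
  show ?thesis unfolding B2_def linear_vec5
  proof (intro set_eqI iffI; clarify)
    fix \<theta> f f1 f2 f3 f4 f5
    assume "\<forall>x :: 'a ^ 5. f x = f1 * x $ 1 + f2 * x $ 2 + f3 * x $ 3 + f4 * x $ 4 + f5 * x $ 5"
    then show "\<exists>g3 g4 g5. (\<lambda>x y. f (graded_product a3 a4 a5 b4 b5 c4 c5 p q r x y)) =
      skew_form (g3 * a3 + g4 * a4 + g5 * a5) (g4 * b4 + g5 * b5) (g5 * p) 0 (g4 * c4 + g5 * c5)
          (g5 * q) 0 (g5 * r) 0 0 \<and> True"
      using *[of f1 f2 f3 f4 f5] by auto
  next
    fix \<theta> f3 f4 f5
    show "\<exists>f. skew_form (f3 * a3 + f4 * a4 + f5 * a5) (f4 * b4 + f5 * b5) (f5 * p) 0 (f4 * c4 +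
        f5 * c5) (f5 * q) 0 (f5 * r) 0 0
       = (\<lambda>x y. f (graded_product a3 a4 a5 b4 b5 c4 c5 p q r x y)) \<and>
       (\<exists>f1 f2 f3 f4 f5. \<forall>x. f x = f1 * x $ 1 + f2 * x $ 2 + f3 * x $ 3 + f4 * x $ 4 + f5 * x $ 5)"
      using *[of 0 0 f3 f4 f5, symmetric]
      by (intro exI[of _ "\<lambda>x. 0 * x $ 1 + 0 * x $ 2 + f3 * x $ 3 + f4 * x $ 4 + f5 * x $ 5"]) blast
  qed
qed

lemma B2_algebras5:
  assumes \<theta>: "\<theta> = skew_form t12 t13 t14 t15 t23 t24 t25 t34 t35 t45"
  shows "\<theta> \<in> B2 (*s) L5_1 \<longleftrightarrow> \<theta> = 0"
  "\<theta> \<in> B2 (*s) L5_2 \<longleftrightarrow> t13 = 0 \<and> t14 = 0 \<and> t15 = 0 \<and> t23 = 0 \<and> t24 = 0 \<and> t25 = 0 \<and> t34 = 0 \<and> t35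
      = 0 \<and> t45 = 0"
  "\<theta> \<in> B2 (*s) L5_3 \<longleftrightarrow> t14 = 0 \<and> t15 = 0 \<and> t23 = 0 \<and> t24 = 0 \<and> t25 = 0 \<and> t34 = 0 \<and> t35 = 0 \<and> t45 = 0"
  "\<theta> \<in> B2 (*s) L5_4 \<longleftrightarrow> t34 = t12 \<and> t13 = 0 \<and> t14 = 0 \<and> t15 = 0 \<and> t23 = 0 \<and> t24 = 0 \<and> t25 = 0 \<and>
      t35 = 0 \<and> t45 = 0"
  "\<theta> \<in> B2 (*s) L5_5 \<longleftrightarrow> t24 = t13 \<and> t14 = 0 \<and> t15 = 0 \<and> t23 = 0 \<and> t25 = 0 \<and> t34 = 0 \<and> t35 = 0 \<and>
      t45 = 0"
  "\<theta> \<in> B2 (*s) L5_6 \<longleftrightarrow> t23 = t14 \<and> t15 = 0 \<and> t24 = 0 \<and> t25 = 0 \<and> t34 = 0 \<and> t35 = 0 \<and> t45 = 0"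
  "\<theta> \<in> B2 (*s) L5_7 \<longleftrightarrow> t15 = 0 \<and> t23 = 0 \<and> t24 = 0 \<and> t25 = 0 \<and> t34 = 0 \<and> t35 = 0 \<and> t45 = 0"
  "\<theta> \<in> B2 (*s) L5_8 \<longleftrightarrow> t14 = 0 \<and> t15 = 0 \<and> t23 = 0 \<and> t24 = 0 \<and> t25 = 0 \<and> t34 = 0 \<and> t35 = 0 \<and> t45 = 0"
  "\<theta> \<in> B2 (*s) L5_9 \<longleftrightarrow> t14 = 0 \<and> t15 = 0 \<and> t24 = 0 \<and> t25 = 0 \<and> t34 = 0 \<and> t35 = 0 \<and> t45 = 0"
  "\<theta> \<in> B2 (*s) M5_1 \<longleftrightarrow> t13 = 0 \<and> t14 = 0 \<and> t15 = 0 \<and> t23 = 0 \<and> t24 = 0 \<and> t25 = 0 \<and> t35 = 0 \<and> t45 = 0"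
  unfolding algebras5_graded B2_graded_product \<theta> skew_form_arith(4) by (auto simp: skew_form_eq_iff)

section \<open>Cocycle conditions in coordinates\<close>

lemma Z2_BL_skew_form_iff:
  "skew_form t12 t13 t14 t15 t23 t24 t25 t34 t35 t45 \<in> Z2_BL (*s) A \<longleftrightarrow>
    (\<forall>x y. skew_form t12 t13 t14 t15 t23 t24 t25 t34 t35 t45 (A (A x y) x) y =
      skew_form t12 t13 t14 t15 t23 t24 t25 t34 t35 t45 (A (A x y) y) x)"
  unfolding Z2_BL_def mem_Collect_eq
  by (intro iffI conjI allI bilinear_map_skew_form skew_form_swap) blast+

text \<open>
  Enough substitutions in the binary Lie cocycle identity to cut out the cocycles of each of
  the ten algebras.
\<close>

lemma Z2_BL_instances:
  assumes "\<theta> \<in> Z2_BL (*s) A"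
  shows "\<theta> (A (A (e 1) (e 2)) (e 1)) (e 2) = \<theta> (A (A (e 1) (e 2)) (e 2)) (e 1)"
    "\<theta> (A (A (e 1) (e 3)) (e 1)) (e 3) = \<theta> (A (A (e 1) (e 3)) (e 3)) (e 1)"
    "\<theta> (A (A (e 1) (e 2 + e 3)) (e 1)) (e 2 + e 3) = \<theta> (A (A (e 1) (e 2 + e 3)) (e 2 + e 3)) (e 1)"
    "\<theta> (A (A (e 1) (e 2 + e 4)) (e 1)) (e 2 + e 4) = \<theta> (A (A (e 1) (e 2 + e 4)) (e 2 + e 4)) (e 1)"
    "\<theta> (A (A (e 1) (e 2 + e 5)) (e 1)) (e 2 + e 5) = \<theta> (A (A (e 1) (e 2 + e 5)) (e 2 + e 5)) (e 1)"
    "\<theta> (A (A (e 2) (e 1 + e 3)) (e 2)) (e 1 + e 3) = \<theta> (A (A (e 2) (e 1 + e 3)) (e 1 + e 3)) (e 2)"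
    "\<theta> (A (A (e 2) (e 1 + e 4)) (e 2)) (e 1 + e 4) = \<theta> (A (A (e 2) (e 1 + e 4)) (e 1 + e 4)) (e 2)"
    "\<theta> (A (A (e 1 + e 3) (e 2 + e 4)) (e 1 + e 3)) (e 2 + e 4) =
      \<theta> (A (A (e 1 + e 3) (e 2 + e 4)) (e 2 + e 4)) (e 1 + e 3)"
  using assms unfolding Z2_BL_def by blast+

lemma Z2_M_instance:
  assumes "\<theta> \<in> Z2_M (*s) A"
  shows "\<theta> (A w y) (A x z) = \<theta> (A (A w x) y) z + \<theta> (A (A x y) z) w + \<theta> (A (A y z) w) x + \<theta> (A (A
      z w) x) y"
  using assms unfolding Z2_M_def by blast

lemma Z2_M_subset: "Z2_M s br \<subseteq> Z2_BL s br"
  by (auto simp: Z2_M_def)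

lemma Z2_BL_algebras5D:
  assumes \<theta>: "\<theta> = skew_form t12 t13 t14 t15 t23 t24 t25 t34 t35 t45"
  shows "\<theta> \<in> Z2_BL (*s) L5_3 \<Longrightarrow> t24 = 0 \<and> t34 = 0 \<and> t45 = 0"
  "\<theta> \<in> Z2_BL (*s) L5_5 \<Longrightarrow> t25 = 0 \<and> t35 = 0 \<and> t45 = 0"
  "\<theta> \<in> Z2_BL (*s) L5_6 \<Longrightarrow> t24 = t15 \<and> t34 = - t25 \<and> t35 = 0 \<and> t45 = 0"
  "\<theta> \<in> Z2_BL (*s) L5_7 \<Longrightarrow> t24 = 0 \<and> t34 = - t25 \<and> t35 = 0 \<and> t45 = 0"
  "\<theta> \<in> Z2_BL (*s) L5_9 \<Longrightarrow> t24 = t15 \<and> t34 = 0 \<and> t35 = 0 \<and> t45 = 0"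
  "\<theta> \<in> Z2_BL (*s) M5_1 \<Longrightarrow> t15 = 0 \<and> t25 = 0 \<and> t35 = 0"
proof -
  note defs = \<theta> algebras5_graded e_vec5 skew_form_def graded_product_simps
  show "t24 = 0 \<and> t34 = 0 \<and> t45 = 0" if "\<theta> \<in> Z2_BL (*s) L5_3"
    \<comment> \<open>With x = e1 the inner product [[x, y], x] is - e4 for each y used here, and
      the right side vanishes. Taking y = e2, e2 + e3 and e2 + e5 yields t24, t34 and t45 in
      turn.\<close>
    using Z2_BL_instances(1,3,5)[OF that, unfolded defs] by simp
  show "t25 = 0 \<and> t35 = 0 \<and> t45 = 0" if "\<theta> \<in> Z2_BL (*s) L5_5"
    using Z2_BL_instances(1,3,4)[OF that, unfolded defs] by simp
  show "t24 = t15 \<and> t34 = - t25 \<and> t35 = 0 \<and> t45 = 0" if "\<theta> \<in> Z2_BL (*s) L5_6"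
    using Z2_BL_instances(1,2,3,5)[OF that, unfolded defs] by (simp add: eq_neg_iff_add_eq_0
        algebra_simps)
  show "t24 = 0 \<and> t34 = - t25 \<and> t35 = 0 \<and> t45 = 0" if "\<theta> \<in> Z2_BL (*s) L5_7"
    using Z2_BL_instances(1,2,3,5)[OF that, unfolded defs] by (simp add: eq_neg_iff_add_eq_0
        algebra_simps)
  show "t24 = t15 \<and> t34 = 0 \<and> t35 = 0 \<and> t45 = 0" if "\<theta> \<in> Z2_BL (*s) L5_9"
    using Z2_BL_instances(1,3,5,6)[OF that, unfolded defs] by (simp add: algebra_simps)
  show "t15 = 0 \<and> t25 = 0 \<and> t35 = 0" if "\<theta> \<in> Z2_BL (*s) M5_1"
    \<comment> \<open>In M5_1 the left sides vanish because [[x, y], x] = 0, and [[x, y], y] is e5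
      up to sign. Pairing it with e1, e2 and e1 + e3 gives t15, t25 and t35.\<close>
    using Z2_BL_instances(4,7,8)[OF that, unfolded defs] by simp
qed

lemma Z2_M_algebras5D:
  assumes \<theta>: "\<theta> = skew_form t12 t13 t14 t15 t23 t24 t25 t34 t35 t45"
  shows "\<theta> \<in> Z2_M (*s) L5_8 \<Longrightarrow> t45 = 0" "\<theta> \<in> Z2_M (*s) M5_1 \<Longrightarrow> t45 = 0"
proof -
  note defs = \<theta> algebras5_graded e_vec5 skew_form_def graded_product_simps
  show "t45 = 0" if "\<theta> \<in> Z2_M (*s) L5_8"
    \<comment> \<open>The left side is \<theta>([e1, e2], [e1, e3]) = \<theta>(e4, e5), while all
      triple products in L5_8 vanish.\<close>
    using Z2_M_instance[OF that, of "e 1" "e 2" "e 1" "e 3", unfolded defs] by simp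
  show "t45 = 0" if "\<theta> \<in> Z2_M (*s) M5_1"
    \<comment> \<open>Here the left side vanishes because [e1, e4] = 0, and the only surviving term
      on the right is \<theta>([[e1, e2], e4], e4) = \<theta>(e5, e4).\<close>
    using Z2_M_instance[OF that, of "e 1" "e 4" "e 2" "e 4", unfolded defs] by simp
qed

lemma Z2_BL_algebras5I:
  "skew_form t12 t13 t14 t15 t23 t24 t25 t34 t35 t45 \<in> Z2_BL (*s) L5_1"
  "skew_form t12 t13 t14 t15 t23 t24 t25 t34 t35 t45 \<in> Z2_BL (*s) L5_2"
  "skew_form t12 t13 t14 t15 t23 0 t25 0 t35 0 \<in> Z2_BL (*s) L5_3"
  "skew_form t12 t13 t14 t15 t23 t24 t25 t34 t35 t45 \<in> Z2_BL (*s) L5_4"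
  "skew_form t12 t13 t14 t15 t23 t24 0 t34 0 0 \<in> Z2_BL (*s) L5_5"
  "skew_form t12 t13 t14 t15 t23 t15 t25 (- t25) 0 0 \<in> Z2_BL (*s) L5_6"
  "skew_form t12 t13 t14 t15 t23 0 t25 (- t25) 0 0 \<in> Z2_BL (*s) L5_7"
  "skew_form t12 t13 t14 t15 t23 t24 t25 t34 t35 t45 \<in> Z2_BL (*s) L5_8"
  "skew_form t12 t13 t14 t15 t23 t15 t25 0 0 0 \<in> Z2_BL (*s) L5_9"
  "skew_form t12 t13 t14 0 t23 t24 0 t34 0 t45 \<in> Z2_BL (*s) M5_1"
  unfolding Z2_BL_skew_form_iff algebras5_graded skew_form_def graded_product_simps
  by (simp_all add: algebra_simps)

lemma Z2_M_algebras5I: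
  "skew_form t12 t13 t14 t15 t23 t24 t25 t34 t35 t45 \<in> Z2_M (*s) L5_1"
  "skew_form t12 t13 t14 t15 t23 t24 t25 t34 t35 t45 \<in> Z2_M (*s) L5_2"
  "skew_form t12 t13 t14 t15 t23 0 t25 0 t35 0 \<in> Z2_M (*s) L5_3"
  "skew_form t12 t13 t14 t15 t23 t24 t25 t34 t35 t45 \<in> Z2_M (*s) L5_4"
  "skew_form t12 t13 t14 t15 t23 t24 0 t34 0 0 \<in> Z2_M (*s) L5_5"
  "skew_form t12 t13 t14 t15 t23 t15 t25 (- t25) 0 0 \<in> Z2_M (*s) L5_6"
  "skew_form t12 t13 t14 t15 t23 0 t25 (- t25) 0 0 \<in> Z2_M (*s) L5_7"
  "skew_form t12 t13 t14 t15 t23 t24 t25 t34 t35 0 \<in> Z2_M (*s) L5_8"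
  "skew_form t12 t13 t14 t15 t23 t15 t25 0 0 0 \<in> Z2_M (*s) L5_9"
  "skew_form t12 t13 t14 0 t23 t24 0 t34 0 0 \<in> Z2_M (*s) M5_1"
  unfolding Z2_M_def mem_Collect_eq
  by (intro conjI Z2_BL_algebras5I;
    unfold algebras5_graded skew_form_def graded_product_simps; simp add: algebra_simps)+

lemma Z2_BL_algebras5:
  assumes \<theta>: "\<theta> = skew_form t12 t13 t14 t15 t23 t24 t25 t34 t35 t45"
  shows "\<theta> \<in> Z2_BL (*s) L5_1"
  "\<theta> \<in> Z2_BL (*s) L5_2"
  "\<theta> \<in> Z2_BL (*s) L5_3 \<longleftrightarrow> t24 = 0 \<and> t34 = 0 \<and> t45 = 0"
  "\<theta> \<in> Z2_BL (*s) L5_4"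
  "\<theta> \<in> Z2_BL (*s) L5_5 \<longleftrightarrow> t25 = 0 \<and> t35 = 0 \<and> t45 = 0"
  "\<theta> \<in> Z2_BL (*s) L5_6 \<longleftrightarrow> t24 = t15 \<and> t34 = - t25 \<and> t35 = 0 \<and> t45 = 0"
  "\<theta> \<in> Z2_BL (*s) L5_7 \<longleftrightarrow> t24 = 0 \<and> t34 = - t25 \<and> t35 = 0 \<and> t45 = 0"
  "\<theta> \<in> Z2_BL (*s) L5_8"
  "\<theta> \<in> Z2_BL (*s) L5_9 \<longleftrightarrow> t24 = t15 \<and> t34 = 0 \<and> t35 = 0 \<and> t45 = 0"
  "\<theta> \<in> Z2_BL (*s) M5_1 \<longleftrightarrow> t15 = 0 \<and> t25 = 0 \<and> t35 = 0"
proof -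
  show "\<theta> \<in> Z2_BL (*s) L5_1"
    unfolding \<theta> by (rule Z2_BL_algebras5I(1))
  show "\<theta> \<in> Z2_BL (*s) L5_2"
    unfolding \<theta> by (rule Z2_BL_algebras5I(2))
  show "\<theta> \<in> Z2_BL (*s) L5_3 \<longleftrightarrow> t24 = 0 \<and> t34 = 0 \<and> t45 = 0"
    using Z2_BL_algebras5D(1)[OF \<theta>]
    by (auto simp: \<theta> Z2_BL_algebras5I(3))
  show "\<theta> \<in> Z2_BL (*s) L5_4"
    unfolding \<theta> by (rule Z2_BL_algebras5I(4))
  show "\<theta> \<in> Z2_BL (*s) L5_5 \<longleftrightarrow> t25 = 0 \<and> t35 = 0 \<and> t45 = 0"
    using Z2_BL_algebras5D(2)[OF \<theta>]
    by (auto simp: \<theta> Z2_BL_algebras5I(5))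
  show "\<theta> \<in> Z2_BL (*s) L5_6 \<longleftrightarrow> t24 = t15 \<and> t34 = - t25 \<and> t35 = 0 \<and> t45 = 0"
    using Z2_BL_algebras5D(3)[OF \<theta>]
    by (auto simp: \<theta> Z2_BL_algebras5I(6))
  show "\<theta> \<in> Z2_BL (*s) L5_7 \<longleftrightarrow> t24 = 0 \<and> t34 = - t25 \<and> t35 = 0 \<and> t45 = 0"
    using Z2_BL_algebras5D(4)[OF \<theta>]
    by (auto simp: \<theta> Z2_BL_algebras5I(7))
  show "\<theta> \<in> Z2_BL (*s) L5_8"
    unfolding \<theta> by (rule Z2_BL_algebras5I(8))
  show "\<theta> \<in> Z2_BL (*s) L5_9 \<longleftrightarrow> t24 = t15 \<and> t34 = 0 \<and> t35 = 0 \<and> t45 = 0"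
    using Z2_BL_algebras5D(5)[OF \<theta>]
    by (auto simp: \<theta> Z2_BL_algebras5I(9))
  show "\<theta> \<in> Z2_BL (*s) M5_1 \<longleftrightarrow> t15 = 0 \<and> t25 = 0 \<and> t35 = 0"
    using Z2_BL_algebras5D(6)[OF \<theta>]
    by (auto simp: \<theta> Z2_BL_algebras5I(10))
qed

text \<open>The necessary conditions are inherited from the larger space of binary Lie cocycles,
  except for t45 = 0 in the cases of L5_8 and M5_1, which the Malcev identity adds.\<close>

lemma Z2_M_algebras5:
  assumes \<theta>: "\<theta> = skew_form t12 t13 t14 t15 t23 t24 t25 t34 t35 t45"
  shows "\<theta> \<in> Z2_M (*s) L5_1"
  "\<theta> \<in> Z2_M (*s) L5_2"
  "\<theta> \<in> Z2_M (*s) L5_3 \<longleftrightarrow> t24 = 0 \<and> t34 = 0 \<and> t45 = 0"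
  "\<theta> \<in> Z2_M (*s) L5_4"
  "\<theta> \<in> Z2_M (*s) L5_5 \<longleftrightarrow> t25 = 0 \<and> t35 = 0 \<and> t45 = 0"
  "\<theta> \<in> Z2_M (*s) L5_6 \<longleftrightarrow> t24 = t15 \<and> t34 = - t25 \<and> t35 = 0 \<and> t45 = 0"
  "\<theta> \<in> Z2_M (*s) L5_7 \<longleftrightarrow> t24 = 0 \<and> t34 = - t25 \<and> t35 = 0 \<and> t45 = 0"
  "\<theta> \<in> Z2_M (*s) L5_8 \<longleftrightarrow> t45 = 0"
  "\<theta> \<in> Z2_M (*s) L5_9 \<longleftrightarrow> t24 = t15 \<and> t34 = 0 \<and> t35 = 0 \<and> t45 = 0"
  "\<theta> \<in> Z2_M (*s) M5_1 \<longleftrightarrow> t15 = 0 \<and> t25 = 0 \<and> t35 = 0 \<and> t45 = 0"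
proof -
  show "\<theta> \<in> Z2_M (*s) L5_1"
    unfolding \<theta> by (rule Z2_M_algebras5I(1))
  show "\<theta> \<in> Z2_M (*s) L5_2"
    unfolding \<theta> by (rule Z2_M_algebras5I(2))
  show "\<theta> \<in> Z2_M (*s) L5_3 \<longleftrightarrow> t24 = 0 \<and> t34 = 0 \<and> t45 = 0"
    using Z2_BL_algebras5D(1)[OF \<theta>] Z2_M_subset
    by (auto simp: \<theta> Z2_M_algebras5I(3))
  show "\<theta> \<in> Z2_M (*s) L5_4"
    unfolding \<theta> by (rule Z2_M_algebras5I(4))
  show "\<theta> \<in> Z2_M (*s) L5_5 \<longleftrightarrow> t25 = 0 \<and> t35 = 0 \<and> t45 = 0"
    using Z2_BL_algebras5D(2)[OF \<theta>] Z2_M_subset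
    by (auto simp: \<theta> Z2_M_algebras5I(5))
  show "\<theta> \<in> Z2_M (*s) L5_6 \<longleftrightarrow> t24 = t15 \<and> t34 = - t25 \<and> t35 = 0 \<and> t45 = 0"
    using Z2_BL_algebras5D(3)[OF \<theta>] Z2_M_subset
    by (auto simp: \<theta> Z2_M_algebras5I(6))
  show "\<theta> \<in> Z2_M (*s) L5_7 \<longleftrightarrow> t24 = 0 \<and> t34 = - t25 \<and> t35 = 0 \<and> t45 = 0"
    using Z2_BL_algebras5D(4)[OF \<theta>] Z2_M_subset
    by (auto simp: \<theta> Z2_M_algebras5I(7))
  show "\<theta> \<in> Z2_M (*s) L5_8 \<longleftrightarrow> t45 = 0"
    using Z2_M_algebras5D(1)[OF \<theta>] Z2_M_subset
    by (auto simp: \<theta> Z2_M_algebras5I(8))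
  show "\<theta> \<in> Z2_M (*s) L5_9 \<longleftrightarrow> t24 = t15 \<and> t34 = 0 \<and> t35 = 0 \<and> t45 = 0"
    using Z2_BL_algebras5D(5)[OF \<theta>] Z2_M_subset
    by (auto simp: \<theta> Z2_M_algebras5I(9))
  show "\<theta> \<in> Z2_M (*s) M5_1 \<longleftrightarrow> t15 = 0 \<and> t25 = 0 \<and> t35 = 0 \<and> t45 = 0"
    using Z2_BL_algebras5D(6)[OF \<theta>] Z2_M_algebras5D(2)[OF \<theta>] Z2_M_subset
    by (auto simp: \<theta> Z2_M_algebras5I(10))
qed

section \<open>Bases of the cohomology spaces\<close>

lemma two_neq_0_if_CHAR_neq_2:
  assumes "CHAR('f::field) \<noteq> 2" shows "(2 :: 'f) \<noteq> 0"
proof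
  assume "(2 :: 'f) = 0"
  then have "CHAR('f) dvd 2" using of_nat_eq_0_iff_char_dvd[of 2, where 'a = 'f] by simp
  then have "CHAR('f) = 1 \<or> CHAR('f) = 2" using dvd_imp_le[of "CHAR('f)" 2] by (cases "CHAR('f)"
      rule: nat.exhaust) auto
  then show False using assms by simp
qed

lemma lincomb_in_subspace:
  assumes "form_subspace Z" "set \<theta>s \<subseteq> Z" "length cs = length \<theta>s"
  shows "lincomb cs \<theta>s \<in> Z"
  using assms(3,2)
  by (induction cs \<theta>s rule: list_induct2) (auto intro: form_subspaceD[OF assms(1)] simp del:
      plus_fun_apply)

lemma skew_form_cases:
  fixes A :: "'f::field ^ 5 \<Rightarrow> 'f ^ 5 \<Rightarrow> 'f ^ 5"
  assumes "(2 :: 'f) \<noteq> 0" "\<theta> \<in> Z2_BL (*s) A"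
  obtains t12 t13 t14 t15 t23 t24 t25 t34 t35 t45
  where "\<theta> = skew_form t12 t13 t14 t15 t23 t24 t25 t34 t35 t45"
proof -
  have "bilinear_map (*s) (*) \<theta>" "\<And>x y. \<theta> x y = - \<theta> y x" using assms(2) unfolding Z2_BL_def by
      blast+
  from skew_form_exhaust[OF assms(1) this] that show ?thesis by blast
qed

lemma Z2_eqI:
  fixes A :: "'f::field ^ 5 \<Rightarrow> 'f ^ 5 \<Rightarrow> 'f ^ 5"
  assumes "(2 :: 'f) \<noteq> 0"
    and "\<And>t12 t13 t14 t15 t23 t24 t25 t34 t35 t45. skew_form t12 t13 t14 t15 t23 t24 t25 t34 t35
        t45 \<in> Z2_BL (*s) A \<Longrightarrow>
      skew_form t12 t13 t14 t15 t23 t24 t25 t34 t35 t45 \<in> Z2_M (*s) A"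
  shows "Z2_BL (*s) A = Z2_M (*s) A"
proof
  show "Z2_BL (*s) A \<subseteq> Z2_M (*s) A"
  proof
    fix \<theta> assume *: "\<theta> \<in> Z2_BL (*s) A"
    from skew_form_cases[OF assms(1) this] show "\<theta> \<in> Z2_M (*s) A" using assms(2) * by metis
  qed
qed (rule Z2_M_subset)

text \<open>Reduces a basis claim to linear algebra on ten coefficients; the spanning part asks for
  the coordinates of the class of a general cocycle.\<close>

lemma H2_M_has_basisI:
  fixes A :: "'f::field ^ 5 \<Rightarrow> 'f ^ 5 \<Rightarrow> 'f ^ 5"
  assumes "(2 :: 'f) \<noteq> 0" "set \<theta>s \<subseteq> Z2_M (*s) A"
    and "\<And>cs. length cs = length \<theta>s \<Longrightarrow> lincomb cs \<theta>s \<in> B2 (*s) A \<Longrightarrow> \<forall>c\<in>set cs. c = 0"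
    and "\<And>t12 t13 t14 t15 t23 t24 t25 t34 t35 t45. skew_form t12 t13 t14 t15 t23 t24 t25 t34 t35
        t45 \<in> Z2_M (*s) A \<Longrightarrow>
      \<exists>cs. length cs = length \<theta>s \<and> skew_form t12 t13 t14 t15 t23 t24 t25 t34 t35 t45 - lincomb
          cs \<theta>s \<in> B2 (*s) A"
  shows "H2_M_has_basis A (map (\<lambda>\<theta>. \<theta> +o B2 (*s) A) \<theta>s)"
  unfolding H2_M_has_basis_def H2_M_def
proof (rule qbasisI)
  show "form_subspace (B2 (*s) A)" by (rule form_subspace_B2) (rule vec.vector_space_axioms)
  have "form_subspace (Z2_M (*s) A)" by (rule form_subspace_Z2_M) (rule vec.vector_space_axioms)
  then show "lincomb cs \<theta>s \<in> Z2_M (*s) A" if "length cs = length \<theta>s" for cs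
    using assms(2) that by (rule lincomb_in_subspace)
  show "\<exists>cs. length cs = length \<theta>s \<and> \<theta> - lincomb cs \<theta>s \<in> B2 (*s) A" if "\<theta> \<in> Z2_M (*s) A" for \<theta>
    using skew_form_cases[OF assms(1) subsetD[OF Z2_M_subset that]] assms(4) that by metis
qed (use assms(2,3) in auto)

lemma Z2_BL_eq_Z2_M:
  assumes "(2 :: 'f::field) \<noteq> 0"
  shows "Z2_BL (*s) (L5_1 :: 'f ^ 5 \<Rightarrow> 'f ^ 5 \<Rightarrow> 'f ^ 5) = Z2_M (*s) L5_1"
    "Z2_BL (*s) (L5_2 :: 'f ^ 5 \<Rightarrow> 'f ^ 5 \<Rightarrow> 'f ^ 5) = Z2_M (*s) L5_2"
    "Z2_BL (*s) (L5_3 :: 'f ^ 5 \<Rightarrow> 'f ^ 5 \<Rightarrow> 'f ^ 5) = Z2_M (*s) L5_3"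
    "Z2_BL (*s) (L5_4 :: 'f ^ 5 \<Rightarrow> 'f ^ 5 \<Rightarrow> 'f ^ 5) = Z2_M (*s) L5_4"
    "Z2_BL (*s) (L5_5 :: 'f ^ 5 \<Rightarrow> 'f ^ 5 \<Rightarrow> 'f ^ 5) = Z2_M (*s) L5_5"
    "Z2_BL (*s) (L5_6 :: 'f ^ 5 \<Rightarrow> 'f ^ 5 \<Rightarrow> 'f ^ 5) = Z2_M (*s) L5_6"
    "Z2_BL (*s) (L5_7 :: 'f ^ 5 \<Rightarrow> 'f ^ 5 \<Rightarrow> 'f ^ 5) = Z2_M (*s) L5_7"
    "Z2_BL (*s) (L5_9 :: 'f ^ 5 \<Rightarrow> 'f ^ 5 \<Rightarrow> 'f ^ 5) = Z2_M (*s) L5_9"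
  by (rule Z2_eqI[OF assms], simp add: Z2_BL_algebras5[OF refl] Z2_M_algebras5[OF refl])+

lemmas form_simps = \<Delta>_skew_form skew_form_arith(1-3) length_Suc_conv

lemma form_subspace_B2_vec: "form_subspace (B2 (*s) (A :: 'f::field ^ 5 \<Rightarrow> 'f ^ 5 \<Rightarrow> 'f ^ 5))"
  by (rule form_subspace_B2) (rule vec.vector_space_axioms)

text \<open>Sums and differences of classes are rewritten as single cosets, the form in which
  \<open>H2_M_has_basisI\<close> delivers its basis.\<close>

lemma coset_B2_plus:
  fixes A :: "'f::field ^ 5 \<Rightarrow> 'f ^ 5 \<Rightarrow> 'f ^ 5"
  shows "Dcl A i j + Dcl A k l = (\<Delta> i j + \<Delta> k l) +o B2 (*s) A"
    "Dcl A i j + qscale (B2 (*s) A) (- 1) (Dcl A k l) = (\<Delta> i j - \<Delta> k l) +o B2 (*s) A"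
proof -
  have "\<Delta> i j + (\<lambda>x y :: 'f ^ 5. - 1 * \<Delta> k l x y) = \<Delta> i j - \<Delta> k l" by (simp add: fun_eq_iff)
  then show "Dcl A i j + Dcl A k l = (\<Delta> i j + \<Delta> k l) +o B2 (*s) A"
    "Dcl A i j + qscale (B2 (*s) A) (- 1) (Dcl A k l) = (\<Delta> i j - \<Delta> k l) +o B2 (*s) A"
    unfolding Dcl_def qscale_coset[OF form_subspace_B2_vec] coset_plus[OF form_subspace_B2_vec]
        by simp_all
qed

lemma H2_M_L5_1:
  assumes "(2 :: 'f::field) \<noteq> 0"
  shows "let A = (L5_1 :: 'f ^ 5 \<Rightarrow> 'f ^ 5 \<Rightarrow> 'f ^ 5); D = Dcl A in
    H2_M_has_basis A [D 1 2, D 1 3, D 1 4, D 1 5, D 2 3, D 2 4, D 2 5, D 3 4, D 3 5, D 4 5]"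
proof -
  let ?A = "L5_1 :: 'f ^ 5 \<Rightarrow> 'f ^ 5 \<Rightarrow> 'f ^ 5"
  have "H2_M_has_basis ?A (map (\<lambda>\<theta>. \<theta> +o B2 (*s) ?A)
    [\<Delta> 1 2, \<Delta> 1 3, \<Delta> 1 4, \<Delta> 1 5, \<Delta> 2 3, \<Delta> 2 4, \<Delta> 2 5, \<Delta> 3 4, \<Delta> 3 5, \<Delta> 4 5])"
  proof (rule H2_M_has_basisI[OF assms], goal_cases)
    case 1 show ?case by (simp add: form_simps Z2_M_algebras5[OF refl])
  next
    case (2 cs) then show ?case by (auto simp: form_simps B2_algebras5[OF refl]
        skew_form_arith(4) skew_form_eq_iff)
  next
    case (3 t12 t13 t14 t15 t23 t24 t25 t34 t35 t45)
    then show ?case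
      by (intro exI[of _ "[t12, t13, t14, t15, t23, t24, t25, t34, t35, t45]"])
        (simp add: form_simps Z2_M_algebras5[OF refl] B2_algebras5[OF refl] skew_form_arith(4)
            skew_form_eq_iff)
  qed
  then show ?thesis by (simp add: Let_def Dcl_def)
qed

lemma H2_M_L5_2:
  assumes "(2 :: 'f::field) \<noteq> 0"
  shows "let A = (L5_2 :: 'f ^ 5 \<Rightarrow> 'f ^ 5 \<Rightarrow> 'f ^ 5); D = Dcl A in
    H2_M_has_basis A [D 1 3, D 1 4, D 2 3, D 2 4, D 3 4, D 1 5, D 2 5, D 3 5, D 4 5]"
proof -
  let ?A = "L5_2 :: 'f ^ 5 \<Rightarrow> 'f ^ 5 \<Rightarrow> 'f ^ 5"
  have "H2_M_has_basis ?A (map (\<lambda>\<theta>. \<theta> +o B2 (*s) ?A)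
    [\<Delta> 1 3, \<Delta> 1 4, \<Delta> 2 3, \<Delta> 2 4, \<Delta> 3 4, \<Delta> 1 5, \<Delta> 2 5, \<Delta> 3 5, \<Delta> 4 5])"
  proof (rule H2_M_has_basisI[OF assms], goal_cases)
    case 1 show ?case by (simp add: form_simps Z2_M_algebras5[OF refl])
  next
    case (2 cs) then show ?case by (auto simp: form_simps B2_algebras5[OF refl])
  next
    case (3 t12 t13 t14 t15 t23 t24 t25 t34 t35 t45)
    then show ?case
      by (intro exI[of _ "[t13, t14, t23, t24, t34, t15, t25, t35, t45]"])
        (simp add: form_simps Z2_M_algebras5[OF refl] B2_algebras5[OF refl])
  qed
  then show ?thesis by (simp add: Let_def Dcl_def)
qed

lemma H2_M_L5_3:
  assumes "(2 :: 'f::field) \<noteq> 0"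
  shows "let A = (L5_3 :: 'f ^ 5 \<Rightarrow> 'f ^ 5 \<Rightarrow> 'f ^ 5); D = Dcl A in
    H2_M_has_basis A [D 1 4, D 2 3, D 1 5, D 2 5, D 3 5]"
proof -
  let ?A = "L5_3 :: 'f ^ 5 \<Rightarrow> 'f ^ 5 \<Rightarrow> 'f ^ 5"
  have "H2_M_has_basis ?A (map (\<lambda>\<theta>. \<theta> +o B2 (*s) ?A)
    [\<Delta> 1 4, \<Delta> 2 3, \<Delta> 1 5, \<Delta> 2 5, \<Delta> 3 5])"
  proof (rule H2_M_has_basisI[OF assms], goal_cases)
    case 1 show ?case by (simp add: form_simps Z2_M_algebras5[OF refl])
  next
    case (2 cs) then show ?case by (auto simp: form_simps B2_algebras5[OF refl])
  next
    case (3 t12 t13 t14 t15 t23 t24 t25 t34 t35 t45)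
    then show ?case
      by (intro exI[of _ "[t14, t23, t15, t25, t35]"])
        (simp add: form_simps Z2_M_algebras5[OF refl] B2_algebras5[OF refl])
  qed
  then show ?thesis by (simp add: Let_def Dcl_def)
qed

lemma H2_M_L5_4:
  assumes "(2 :: 'f::field) \<noteq> 0"
  shows "let A = (L5_4 :: 'f ^ 5 \<Rightarrow> 'f ^ 5 \<Rightarrow> 'f ^ 5); D = Dcl A in
    H2_M_has_basis A [D 1 3, D 1 4, D 2 3, D 2 4, D 3 4, D 1 5, D 2 5, D 3 5, D 4 5]"
proof -
  let ?A = "L5_4 :: 'f ^ 5 \<Rightarrow> 'f ^ 5 \<Rightarrow> 'f ^ 5"
  have "H2_M_has_basis ?A (map (\<lambda>\<theta>. \<theta> +o B2 (*s) ?A)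
    [\<Delta> 1 3, \<Delta> 1 4, \<Delta> 2 3, \<Delta> 2 4, \<Delta> 3 4, \<Delta> 1 5, \<Delta> 2 5, \<Delta> 3 5, \<Delta> 4 5])"
  proof (rule H2_M_has_basisI[OF assms], goal_cases)
    case 1 show ?case by (simp add: form_simps Z2_M_algebras5[OF refl])
  next
    case (2 cs) then show ?case by (auto simp: form_simps B2_algebras5[OF refl])
  next
    case (3 t12 t13 t14 t15 t23 t24 t25 t34 t35 t45)
    then show ?case
      \<comment> \<open>The coboundary dual to e5 is \<open>\<Delta> 1 2 + \<Delta> 3 4\<close>, so
        the class of \<open>\<Delta> 1 2\<close> is minus that of
        \<open>\<Delta> 3 4\<close>.\<close>
      by (intro exI[of _ "[t13, t14, t23, t24, t34 - t12, t15, t25, t35, t45]"])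
        (simp add: form_simps Z2_M_algebras5[OF refl] B2_algebras5[OF refl])
  qed
  then show ?thesis by (simp add: Let_def Dcl_def)
qed

lemma H2_M_L5_5:
  assumes "(2 :: 'f::field) \<noteq> 0"
  shows "let A = (L5_5 :: 'f ^ 5 \<Rightarrow> 'f ^ 5 \<Rightarrow> 'f ^ 5); D = Dcl A in
    H2_M_has_basis A [D 1 3, D 1 4, D 2 3, D 3 4, D 1 5]"
proof -
  let ?A = "L5_5 :: 'f ^ 5 \<Rightarrow> 'f ^ 5 \<Rightarrow> 'f ^ 5"
  have "H2_M_has_basis ?A (map (\<lambda>\<theta>. \<theta> +o B2 (*s) ?A)
    [\<Delta> 1 3, \<Delta> 1 4, \<Delta> 2 3, \<Delta> 3 4, \<Delta> 1 5])"
  proof (rule H2_M_has_basisI[OF assms], goal_cases)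
    case 1 show ?case by (simp add: form_simps Z2_M_algebras5[OF refl])
  next
    case (2 cs) then show ?case by (auto simp: form_simps B2_algebras5[OF refl])
  next
    case (3 t12 t13 t14 t15 t23 t24 t25 t34 t35 t45)
    then show ?case
      \<comment> \<open>Modulo the coboundary \<open>\<Delta> 1 3 + \<Delta> 2 4\<close>, the form
        \<open>\<Delta> 2 4\<close> is replaced by minus \<open>\<Delta> 1 3\<close>.\<close>
      by (intro exI[of _ "[t13 - t24, t14, t23, t34, t15]"])
        (simp add: form_simps Z2_M_algebras5[OF refl] B2_algebras5[OF refl])
  qed
  then show ?thesis by (simp add: Let_def Dcl_def)
qed

lemma H2_M_L5_6:
  assumes "(2 :: 'f::field) \<noteq> 0"
  shows "let A = (L5_6 :: 'f ^ 5 \<Rightarrow> 'f ^ 5 \<Rightarrow> 'f ^ 5); D = Dcl A in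
    H2_M_has_basis A [D 1 4, D 1 5 + D 2 4, D 2 5 + qscale (B2 (*s) A) (- 1) (D 3 4)]"
proof -
  let ?A = "L5_6 :: 'f ^ 5 \<Rightarrow> 'f ^ 5 \<Rightarrow> 'f ^ 5"
  have "H2_M_has_basis ?A (map (\<lambda>\<theta>. \<theta> +o B2 (*s) ?A)
    [\<Delta> 1 4, \<Delta> 1 5 + \<Delta> 2 4, \<Delta> 2 5 - \<Delta> 3 4])"
  proof (rule H2_M_has_basisI[OF assms], goal_cases)
    case 1 show ?case by (simp add: form_simps Z2_M_algebras5[OF refl])
  next
    case (2 cs) then show ?case by (auto simp: form_simps B2_algebras5[OF refl])
  next
    case (3 t12 t13 t14 t15 t23 t24 t25 t34 t35 t45)
    then show ?case
      \<comment> \<open>Modulo the coboundary \<open>\<Delta> 1 4 + \<Delta> 2 3\<close>, the form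
        \<open>\<Delta> 2 3\<close> is replaced by minus \<open>\<Delta> 1 4\<close>.\<close>
      by (intro exI[of _ "[t14 - t23, t15, t25]"])
        (simp add: form_simps Z2_M_algebras5[OF refl] B2_algebras5[OF refl])
  qed
  then show ?thesis by (simp add: Let_def coset_B2_plus Dcl_def[symmetric])
qed

lemma H2_M_L5_7:
  assumes "(2 :: 'f::field) \<noteq> 0"
  shows "let A = (L5_7 :: 'f ^ 5 \<Rightarrow> 'f ^ 5 \<Rightarrow> 'f ^ 5); D = Dcl A in
    H2_M_has_basis A [D 1 5, D 2 3, D 2 5 + qscale (B2 (*s) A) (- 1) (D 3 4)]"
proof -
  let ?A = "L5_7 :: 'f ^ 5 \<Rightarrow> 'f ^ 5 \<Rightarrow> 'f ^ 5"
  have "H2_M_has_basis ?A (map (\<lambda>\<theta>. \<theta> +o B2 (*s) ?A)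
    [\<Delta> 1 5, \<Delta> 2 3, \<Delta> 2 5 - \<Delta> 3 4])"
  proof (rule H2_M_has_basisI[OF assms], goal_cases)
    case 1 show ?case by (simp add: form_simps Z2_M_algebras5[OF refl])
  next
    case (2 cs) then show ?case by (auto simp: form_simps B2_algebras5[OF refl])
  next
    case (3 t12 t13 t14 t15 t23 t24 t25 t34 t35 t45)
    then show ?case
      by (intro exI[of _ "[t15, t23, t25]"])
        (simp add: form_simps Z2_M_algebras5[OF refl] B2_algebras5[OF refl])
  qed
  then show ?thesis by (simp add: Let_def coset_B2_plus Dcl_def[symmetric])
qed

lemma H2_M_L5_8:
  assumes "(2 :: 'f::field) \<noteq> 0"
  shows "let A = (L5_8 :: 'f ^ 5 \<Rightarrow> 'f ^ 5 \<Rightarrow> 'f ^ 5); D = Dcl A in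
    H2_M_has_basis A [D 1 4, D 1 5, D 2 3, D 2 4, D 3 4, D 2 5, D 3 5]"
proof -
  let ?A = "L5_8 :: 'f ^ 5 \<Rightarrow> 'f ^ 5 \<Rightarrow> 'f ^ 5"
  have "H2_M_has_basis ?A (map (\<lambda>\<theta>. \<theta> +o B2 (*s) ?A)
    [\<Delta> 1 4, \<Delta> 1 5, \<Delta> 2 3, \<Delta> 2 4, \<Delta> 3 4, \<Delta> 2 5, \<Delta> 3 5])"
  proof (rule H2_M_has_basisI[OF assms], goal_cases)
    case 1 show ?case by (simp add: form_simps Z2_M_algebras5[OF refl])
  next
    case (2 cs) then show ?case by (auto simp: form_simps B2_algebras5[OF refl])
  next
    case (3 t12 t13 t14 t15 t23 t24 t25 t34 t35 t45)
    then show ?case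
      by (intro exI[of _ "[t14, t15, t23, t24, t34, t25, t35]"])
        (simp add: form_simps Z2_M_algebras5[OF refl] B2_algebras5[OF refl])
  qed
  then show ?thesis by (simp add: Let_def Dcl_def)
qed

lemma H2_M_L5_9:
  assumes "(2 :: 'f::field) \<noteq> 0"
  shows "let A = (L5_9 :: 'f ^ 5 \<Rightarrow> 'f ^ 5 \<Rightarrow> 'f ^ 5); D = Dcl A in
    H2_M_has_basis A [D 1 4, D 1 5 + D 2 4, D 2 5]"
proof -
  let ?A = "L5_9 :: 'f ^ 5 \<Rightarrow> 'f ^ 5 \<Rightarrow> 'f ^ 5"
  have "H2_M_has_basis ?A (map (\<lambda>\<theta>. \<theta> +o B2 (*s) ?A)
    [\<Delta> 1 4, \<Delta> 1 5 + \<Delta> 2 4, \<Delta> 2 5])"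
  proof (rule H2_M_has_basisI[OF assms], goal_cases)
    case 1 show ?case by (simp add: form_simps Z2_M_algebras5[OF refl])
  next
    case (2 cs) then show ?case by (auto simp: form_simps B2_algebras5[OF refl])
  next
    case (3 t12 t13 t14 t15 t23 t24 t25 t34 t35 t45)
    then show ?case
      by (intro exI[of _ "[t14, t15, t25]"])
        (simp add: form_simps Z2_M_algebras5[OF refl] B2_algebras5[OF refl])
  qed
  then show ?thesis by (simp add: Let_def coset_B2_plus Dcl_def[symmetric])
qed

lemma H2_M_M5_1:
  assumes "(2 :: 'f::field) \<noteq> 0"
  shows "let A = (M5_1 :: 'f ^ 5 \<Rightarrow> 'f ^ 5 \<Rightarrow> 'f ^ 5); D = Dcl A in
    H2_M_has_basis A [D 1 3, D 1 4, D 2 3, D 2 4]"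
proof -
  let ?A = "M5_1 :: 'f ^ 5 \<Rightarrow> 'f ^ 5 \<Rightarrow> 'f ^ 5"
  have "H2_M_has_basis ?A (map (\<lambda>\<theta>. \<theta> +o B2 (*s) ?A)
    [\<Delta> 1 3, \<Delta> 1 4, \<Delta> 2 3, \<Delta> 2 4])"
  proof (rule H2_M_has_basisI[OF assms], goal_cases)
    case 1 show ?case by (simp add: form_simps Z2_M_algebras5[OF refl])
  next
    case (2 cs) then show ?case by (auto simp: form_simps B2_algebras5[OF refl])
  next
    case (3 t12 t13 t14 t15 t23 t24 t25 t34 t35 t45)
    then show ?case
      by (intro exI[of _ "[t13, t14, t23, t24]"])
        (simp add: form_simps Z2_M_algebras5[OF refl] B2_algebras5[OF refl])
  qed
  then show ?thesis by (simp add: Let_def Dcl_def)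
qed

section \<open>The class of \<open>\<Delta> 4 5\<close> and the sets U_1\<close>

lemma form_subspace_Z2_vec: "form_subspace (Z2_M (*s) (A :: 'f::field ^ 5 \<Rightarrow> 'f ^ 5 \<Rightarrow> 'f ^ 5))"
  "form_subspace (Z2_BL (*s) A)"
  by (rule form_subspace_Z2_M form_subspace_Z2_BL, rule vec.vector_space_axioms)+

text \<open>Coboundaries of L5_8 involve only \<open>\<Delta> 1 2\<close> and
  \<open>\<Delta> 1 3\<close>, those of M5_1 only \<open>\<Delta> 1 2\<close> and
  \<open>\<Delta> 3 4\<close>; none of these coefficients is constrained for Malcev
  cocycles.\<close>

lemma B2_subset_Z2_M:
  "B2 (*s) L5_8 \<subseteq> Z2_M (*s) L5_8" "B2 (*s) M5_1 \<subseteq> Z2_M (*s) M5_1"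
  unfolding algebras5_graded B2_graded_product
  by (auto simp: Z2_M_algebras5[OF refl, unfolded algebras5_graded])

text \<open>Erasing the coefficient t45 projects binary Lie cocycles onto Malcev cocycles, and no
  nonzero multiple of \<open>\<Delta> 4 5\<close> is a Malcev cocycle.\<close>

lemma H2_BL_is_H2_M_plusI:
  fixes A :: "'f::field ^ 5 \<Rightarrow> 'f ^ 5 \<Rightarrow> 'f ^ 5"
  assumes "(2 :: 'f) \<noteq> 0" "B2 (*s) A \<subseteq> Z2_M (*s) A" "\<Delta> 4 5 \<in> Z2_BL (*s) A"
    and "\<And>t12 t13 t14 t15 t23 t24 t25 t34 t35 t45. skew_form t12 t13 t14 t15 t23 t24 t25 t34 t35
        t45 \<in> Z2_M (*s) A \<Longrightarrow> t45 = 0"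
    and "\<And>t12 t13 t14 t15 t23 t24 t25 t34 t35 t45. skew_form t12 t13 t14 t15 t23 t24 t25 t34 t35
        t45 \<in> Z2_BL (*s) A \<Longrightarrow>
      skew_form t12 t13 t14 t15 t23 t24 t25 t34 t35 0 \<in> Z2_M (*s) A"
  shows "H2_BL_is_H2_M_plus A (Dcl A 4 5)"
proof -
  have 1: "c = 0" if "(\<lambda>x y. c * \<Delta> 4 5 x y) \<in> Z2_M (*s) A" for c
    using assms(4)[of 0 0 0 0 0 0 0 0 0 c] that by (simp add: form_simps)
  have "\<exists>\<eta> c. \<theta> = \<eta> + (\<lambda>x y. c * \<Delta> 4 5 x y) \<and> \<eta> \<in> Z2_M (*s) A" if \<theta>: "\<theta> \<in> Z2_BL (*s) A" for \<theta>
  proof -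
    obtain t12 t13 t14 t15 t23 t24 t25 t34 t35 t45 where t: "\<theta> = skew_form t12 t13 t14 t15 t23
        t24 t25 t34 t35 t45"
      using skew_form_cases[OF assms(1) \<theta>] .
    have "\<theta> = skew_form t12 t13 t14 t15 t23 t24 t25 t34 t35 0 + (\<lambda>x y. t45 * \<Delta> 4 5 x y)"
      by (simp add: t form_simps)
    moreover have "skew_form t12 t13 t14 t15 t23 t24 t25 t34 t35 0 \<in> Z2_M (*s) A"
      using assms(5) \<theta> unfolding t .
    ultimately show ?thesis by blast
  qed
  then have 2: "Z2_BL (*s) A = {\<theta> + (\<lambda>x y. c * \<Delta> 4 5 x y) | \<theta> c. \<theta> \<in> Z2_M (*s) A}"
    using form_subspaceD(2,3)[OF form_subspace_Z2_vec(2), of _ A] Z2_M_subset[of "(*s)" A]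
        assms(3) by blast
  note qdirect_sumI[OF form_subspace_B2_vec form_subspace_Z2_vec(1) assms(2) 1 2]
  then show ?thesis unfolding H2_BL_is_H2_M_plus_def H2_BL_def H2_M_def Dcl_def by blast
qed

text \<open>The witness is the line spanned by the class of \<eta>. Because coboundaries are Malcev
  cocycles, that class could lie in \<open>H2_M\<close> only if \<eta> itself were a Malcev
  cocycle.\<close>

lemma U_set_nonempty:
  fixes A :: "'f::field ^ 5 \<Rightarrow> 'f ^ 5 \<Rightarrow> 'f ^ 5"
  assumes B: "B2 (*s) A \<subseteq> Z2_M (*s) A" and \<eta>: "\<eta> \<in> Z2_BL (*s) A" "\<eta> \<notin> Z2_M (*s) A"
    and perp: "form_perp \<eta> \<inter> Ann A = {0}"
  shows "U_set 1 (*s) A \<noteq> {}"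
proof -
  let ?B = "B2 (*s) A"
  let ?W = "qspan ?B (map (\<lambda>\<theta>. \<theta> +o ?B) [\<eta>])"
  have W: "?W = {lincomb cs [\<eta>] +o ?B | cs. length cs = length [\<eta>]}" by (rule qspan_cosets[OF
      form_subspace_B2_vec])
  have "lincomb [1] [\<eta>] = \<eta>" by (simp add: fun_eq_iff)
  then have in_W: "\<eta> +o ?B \<in> ?W" unfolding W by (intro CollectI exI[of _ "[1]"]) simp
  have "?W \<subseteq> H2_BL (*s) A"
    unfolding W H2_BL_def using lincomb_in_subspace[OF form_subspace_Z2_vec(2), of "[\<eta>]" A] \<eta>(1)
        by auto
  moreover have "qindependent ?B (map (\<lambda>\<theta>. \<theta> +o ?B) [\<eta>])"
    unfolding qindependent_cosets[OF form_subspace_B2_vec]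
  proof (intro allI impI)
    fix cs assume "length cs = length [\<eta>]" "lincomb cs [\<eta>] \<in> ?B"
    then obtain c where c: "cs = [c]" "(\<lambda>x y. c * \<eta> x y) \<in> Z2_M (*s) A" using B by (auto simp:
        length_Suc_conv)
    have "c = 0"
    proof (rule ccontr)
      assume "c \<noteq> 0"
      then have "(\<lambda>x y. inverse c * (c * \<eta> x y)) = \<eta>" by (simp add: fun_eq_iff)
      then show False using form_subspaceD(3)[OF form_subspace_Z2_vec(1) c(2), of "inverse c"]
          \<eta>(2) by simp
    qed
    then show "\<forall>c\<in>set cs. c = 0" using c(1) by simp
  qed
  ultimately have "?W \<in> grassmannian ?B 1 (H2_BL (*s) A)"
    unfolding grassmannian_def qbasis_def using in_W
    by (intro CollectI conjI exI[of _ "map (\<lambda>\<theta>. \<theta> +o ?B) [\<eta>]"]) auto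
  then have "?W \<in> T_set 1 (*s) A"
    unfolding T_set_def using \<eta>(1) perp by (intro CollectI conjI exI[of _ "[\<eta>]"]) auto
  moreover have "?W \<notin> grassmannian ?B 1 (H2_M (*s) A)"
  proof
    assume "?W \<in> grassmannian ?B 1 (H2_M (*s) A)"
    then have "\<eta> +o ?B \<in> H2_M (*s) A" using in_W by (auto simp: grassmannian_def)
    then obtain \<theta> where \<theta>: "\<theta> \<in> Z2_M (*s) A" "\<eta> +o ?B = \<theta> +o ?B" unfolding H2_M_def by blast
    then have "\<eta> - \<theta> \<in> Z2_M (*s) A" using coset_eq_iff[OF form_subspace_B2_vec] B by blast
    from form_subspaceD(2)[OF form_subspace_Z2_vec(1) this \<theta>(1)] show False using \<eta>(2) by simp
  qed
  ultimately show ?thesis unfolding U_set_def by blast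
qed

lemma U_set_empty:
  assumes "Z2_BL s br = Z2_M s br" shows "U_set r s br = {}"
  using assms by (auto simp: U_set_def T_set_def H2_BL_def H2_M_def)

lemma \<Delta>_45:
  "\<Delta> 4 5 \<in> Z2_BL (*s) L5_8" "\<Delta> 4 5 \<notin> Z2_M (*s) L5_8"
  "\<Delta> 4 5 \<in> Z2_BL (*s) M5_1" "\<Delta> 4 5 \<notin> Z2_M (*s) M5_1"
  by (simp_all add: \<Delta>_skew_form Z2_BL_algebras5[OF refl] Z2_M_algebras5[OF refl])

text \<open>\<open>\<Delta> 4 5\<close> pairs e4 with e5, so its radical consists of vectors whose
  fourth and fifth coordinates vanish, whereas both annihilators lie in the span of e4 and
  e5.\<close>

lemma form_perp_\<Delta>_45:
  "form_perp (\<Delta> 4 5) \<inter> Ann L5_8 = {0 :: 'f::field ^ 5}" "form_perp (\<Delta> 4 5) \<inter> Ann M5_1 = {0 :: 'f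
      ^ 5}"
proof -
  have "x $ 4 = 0 \<and> x $ 5 = 0" if "x \<in> form_perp (\<Delta> 4 5)" for x :: "'f ^ 5"
    using that[unfolded form_perp_def \<Delta>_def mem_Collect_eq, rule_format, of "e 5"]
      that[unfolded form_perp_def \<Delta>_def mem_Collect_eq, rule_format, of "e 4"] by (simp add: e_vec5)
  then show "form_perp (\<Delta> 4 5) \<inter> Ann L5_8 = {0 :: 'f ^ 5}" "form_perp (\<Delta> 4 5) \<inter> Ann M5_1 = {0 ::
      'f ^ 5}"
    unfolding Ann_algebras5 by (auto simp: coord_subspace_def vec_eq_5 forall_5 form_perp_def \<Delta>_def)
qed

lemma H2_BL_is_H2_M_plus_algebras5:
  assumes "(2 :: 'f::field) \<noteq> 0"
  shows "H2_BL_is_H2_M_plus (L5_8 :: 'f ^ 5 \<Rightarrow> 'f ^ 5 \<Rightarrow> 'f ^ 5) (Dcl L5_8 4 5)"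
      "H2_BL_is_H2_M_plus (M5_1 :: 'f ^ 5 \<Rightarrow> 'f ^ 5 \<Rightarrow> 'f ^ 5) (Dcl M5_1 4 5)"
  by (rule H2_BL_is_H2_M_plusI[OF assms B2_subset_Z2_M(1) \<Delta>_45(1)]; simp add: Z2_BL_algebras5[OF
      refl] Z2_M_algebras5[OF refl])
    (rule H2_BL_is_H2_M_plusI[OF assms B2_subset_Z2_M(2) \<Delta>_45(3)]; simp add: Z2_BL_algebras5[OF
        refl] Z2_M_algebras5[OF refl])

lemma Ann_span_algebras5:
  "Ann (L5_2 :: 'f::field ^ 5 \<Rightarrow> _) = vec.span {e 3, e 4, e 5}"
  "Ann (L5_3 :: 'f ^ 5 \<Rightarrow> _) = vec.span {e 4, e 5}" "Ann (L5_4 :: 'f ^ 5 \<Rightarrow> _) = vec.span {e 5}"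
  "Ann (L5_5 :: 'f ^ 5 \<Rightarrow> _) = vec.span {e 5}" "Ann (L5_6 :: 'f ^ 5 \<Rightarrow> _) = vec.span {e 5}"
  "Ann (L5_7 :: 'f ^ 5 \<Rightarrow> _) = vec.span {e 5}" "Ann (L5_8 :: 'f ^ 5 \<Rightarrow> _) = vec.span {e 4, e 5}"
  "Ann (L5_9 :: 'f ^ 5 \<Rightarrow> _) = vec.span {e 4, e 5}" "Ann (M5_1 :: 'f ^ 5 \<Rightarrow> _) = vec.span {e 5}"
  "Ann (L5_1 :: 'f ^ 5 \<Rightarrow> _) = UNIV"
  unfolding Ann_algebras5 span_coord_subspace[symmetric] by (simp_all add: span_coord_subspace)
      (simp add: coord_subspace_def)

theorem theorem8:
  assumes "CHAR('f::field) \<noteq> 2"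
  shows
    "(\<forall>(s :: 'f \<Rightarrow> 'v::ab_group_add \<Rightarrow> 'v) br.
        binary_lie_algebra s br \<and> nilpotent_algebra s br \<and> vector_space.dim s UNIV = 5 \<longrightarrow>
          malcev_algebra s br \<and>
          (\<exists>A\<in>set (algebras5 :: ('f ^ 5 \<Rightarrow> 'f ^ 5 \<Rightarrow> 'f ^ 5) list).
             algebra_isomorphic s br (*s) A)) \<and>

     (\<forall>A\<in>set (algebras5 :: ('f ^ 5 \<Rightarrow> 'f ^ 5 \<Rightarrow> 'f ^ 5) list).
        binary_lie_algebra (*s) A \<and> nilpotent_algebra (*s) A \<and> malcev_algebra (*s) A) \<and>
     (\<forall>i<length (algebras5 :: ('f ^ 5 \<Rightarrow> 'f ^ 5 \<Rightarrow> 'f ^ 5) list).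
      \<forall>j<length (algebras5 :: ('f ^ 5 \<Rightarrow> 'f ^ 5 \<Rightarrow> 'f ^ 5) list).
        i \<noteq> j \<longrightarrow> \<not> algebra_isomorphic (*s) ((algebras5 :: ('f ^ 5 \<Rightarrow> 'f ^ 5 \<Rightarrow> 'f ^ 5) list) ! i)
                                     (*s) (algebras5 ! j)) \<and>

     (let A = (L5_1 :: 'f ^ 5 \<Rightarrow> 'f ^ 5 \<Rightarrow> 'f ^ 5); D = Dcl A in
        H2_BL (*s) A = H2_M (*s) A \<and>
        H2_M_has_basis A [D 1 2, D 1 3, D 1 4, D 1 5, D 2 3, D 2 4, D 2 5, D 3 4, D 3 5, D 4 5] \<and>
        Ann A = UNIV) \<and>

     (let A = (L5_2 :: 'f ^ 5 \<Rightarrow> 'f ^ 5 \<Rightarrow> 'f ^ 5); D = Dcl A in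
        H2_BL (*s) A = H2_M (*s) A \<and>
        H2_M_has_basis A [D 1 3, D 1 4, D 2 3, D 2 4, D 3 4, D 1 5, D 2 5, D 3 5, D 4 5] \<and>
        Ann A = vec.span {e 3, e 4, e 5}) \<and>

     (let A = (L5_3 :: 'f ^ 5 \<Rightarrow> 'f ^ 5 \<Rightarrow> 'f ^ 5); D = Dcl A in
        H2_BL (*s) A = H2_M (*s) A \<and>
        H2_M_has_basis A [D 1 4, D 2 3, D 1 5, D 2 5, D 3 5] \<and>
        Ann A = vec.span {e 4, e 5}) \<and>

     (let A = (L5_4 :: 'f ^ 5 \<Rightarrow> 'f ^ 5 \<Rightarrow> 'f ^ 5); D = Dcl A in
        H2_BL (*s) A = H2_M (*s) A \<and>
        H2_M_has_basis A [D 1 3, D 1 4, D 2 3, D 2 4, D 3 4, D 1 5, D 2 5, D 3 5, D 4 5] \<and>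
        Ann A = vec.span {e 5}) \<and>

     (let A = (L5_5 :: 'f ^ 5 \<Rightarrow> 'f ^ 5 \<Rightarrow> 'f ^ 5); D = Dcl A in
        H2_BL (*s) A = H2_M (*s) A \<and>
        H2_M_has_basis A [D 1 3, D 1 4, D 2 3, D 3 4, D 1 5] \<and>
        Ann A = vec.span {e 5}) \<and>

     (let A = (L5_6 :: 'f ^ 5 \<Rightarrow> 'f ^ 5 \<Rightarrow> 'f ^ 5); D = Dcl A in
        H2_BL (*s) A = H2_M (*s) A \<and>
        H2_M_has_basis A [D 1 4, D 1 5 + D 2 4, D 2 5 + qscale (B2 (*s) A) (- 1) (D 3 4)] \<and>
        Ann A = vec.span {e 5}) \<and>

     (let A = (L5_7 :: 'f ^ 5 \<Rightarrow> 'f ^ 5 \<Rightarrow> 'f ^ 5); D = Dcl A in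
        H2_BL (*s) A = H2_M (*s) A \<and>
        H2_M_has_basis A [D 1 5, D 2 3, D 2 5 + qscale (B2 (*s) A) (- 1) (D 3 4)] \<and>
        Ann A = vec.span {e 5}) \<and>

     (let A = (L5_8 :: 'f ^ 5 \<Rightarrow> 'f ^ 5 \<Rightarrow> 'f ^ 5); D = Dcl A in
        H2_M_has_basis A [D 1 4, D 1 5, D 2 3, D 2 4, D 3 4, D 2 5, D 3 5] \<and>
        H2_BL_is_H2_M_plus A (D 4 5) \<and>
        Ann A = vec.span {e 4, e 5}) \<and>

     (let A = (L5_9 :: 'f ^ 5 \<Rightarrow> 'f ^ 5 \<Rightarrow> 'f ^ 5); D = Dcl A in
        H2_BL (*s) A = H2_M (*s) A \<and>
        H2_M_has_basis A [D 1 4, D 1 5 + D 2 4, D 2 5] \<and>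
        Ann A = vec.span {e 4, e 5}) \<and>

     (let A = (M5_1 :: 'f ^ 5 \<Rightarrow> 'f ^ 5 \<Rightarrow> 'f ^ 5); D = Dcl A in
        H2_M_has_basis A [D 1 3, D 1 4, D 2 3, D 2 4] \<and>
        H2_BL_is_H2_M_plus A (D 4 5) \<and>
        Ann A = vec.span {e 5}) \<and>

     U_set 1 (*s) (L5_8 :: 'f ^ 5 \<Rightarrow> 'f ^ 5 \<Rightarrow> 'f ^ 5) \<noteq> {} \<and>
     U_set 1 (*s) (M5_1 :: 'f ^ 5 \<Rightarrow> 'f ^ 5 \<Rightarrow> 'f ^ 5) \<noteq> {} \<and>
     (\<forall>A\<in>{L5_1, L5_2, L5_3, L5_4, L5_5, L5_6, L5_7, L5_9 :: 'f ^ 5 \<Rightarrow> 'f ^ 5 \<Rightarrow> 'f ^ 5}.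
        U_set 1 (*s) A = {})"
proof -
  have two: "(2 :: 'f) \<noteq> 0" by (rule two_neq_0_if_CHAR_neq_2[OF assms])
  note Z = Z2_BL_eq_Z2_M[OF two]
  have H: "H2_BL (*s) A = H2_M (*s) A" if "Z2_BL (*s) A = Z2_M (*s) A" for A :: "'f ^ 5 \<Rightarrow> 'f ^ 5 \<Rightarrow> 'f ^ 5"
    using that by (simp add: H2_BL_def H2_M_def)
  note H2 = Z[THEN H]
    H2_M_L5_1[OF two, unfolded Let_def] H2_M_L5_2[OF two, unfolded Let_def] H2_M_L5_3[OF two, unfolded Let_def]
    H2_M_L5_4[OF two, unfolded Let_def] H2_M_L5_5[OF two, unfolded Let_def] H2_M_L5_6[OF two, unfolded Let_def]
    H2_M_L5_7[OF two, unfolded Let_def] H2_M_L5_8[OF two, unfolded Let_def] H2_M_L5_9[OF two, unfolded Let_def]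
    H2_M_M5_1[OF two, unfolded Let_def]
  have U_empty: "\<forall>A\<in>{L5_1, L5_2, L5_3, L5_4, L5_5, L5_6, L5_7, L5_9 :: 'f ^ 5 \<Rightarrow> 'f ^ 5 \<Rightarrow> 'f ^ 5}. U_set 1 (*s) A = {}"
    using Z[THEN U_set_empty] by blast
  note U = U_set_nonempty[OF B2_subset_Z2_M(1) \<Delta>_45(1,2) form_perp_\<Delta>_45(1)]
    U_set_nonempty[OF B2_subset_Z2_M(2) \<Delta>_45(3,4) form_perp_\<Delta>_45(2)]
  have classification: "\<forall>(s :: 'f \<Rightarrow> 'v \<Rightarrow> 'v) br.
        binary_lie_algebra s br \<and> nilpotent_algebra s br \<and> vector_space.dim s UNIV = 5 \<longrightarrow>
          malcev_algebra s br \<and>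
          (\<exists>A\<in>set (algebras5 :: ('f ^ 5 \<Rightarrow> 'f ^ 5 \<Rightarrow> 'f ^ 5) list).
             algebra_isomorphic s br (*s) A)"
    by (intro allI impI conjI; elim conjE; rule binary_lie_classification)
  have members: "\<forall>A\<in>set (algebras5 :: ('f ^ 5 \<Rightarrow> 'f ^ 5 \<Rightarrow> 'f ^ 5) list).
      binary_lie_algebra (*s) A \<and> nilpotent_algebra (*s) A \<and> malcev_algebra (*s) A"
    using algebras5_nilpotent_malcev by blast
  have nonisomorphic: "\<forall>i<length (algebras5 :: ('f ^ 5 \<Rightarrow> 'f ^ 5 \<Rightarrow> 'f ^ 5) list).
      \<forall>j<length (algebras5 :: ('f ^ 5 \<Rightarrow> 'f ^ 5 \<Rightarrow> 'f ^ 5) list).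
        i \<noteq> j \<longrightarrow> \<not> algebra_isomorphic (*s) ((algebras5 :: ('f ^ 5 \<Rightarrow> 'f ^ 5 \<Rightarrow> 'f ^ 5) list) ! i)
                                     (*s) (algebras5 ! j)"
    by (intro allI impI algebras5_nonisomorphic)
  show ?thesis
    unfolding Let_def
    by (intro conjI classification members nonisomorphic U_empty U H2 H2_BL_is_H2_M_plus_algebras5[OF two] Ann_span_algebras5)
qed

end
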